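(* Let $\xi, \xi_1, \dots, \xi_n$ be i.i.d. random elements in $\mathbb{R}^D$. Let $\mathcal{F}$ be a class of measurable functions $f: \mathbb{R}^D \to \mathbb{R}$ with a finite $\psi_1$-diameter and denote $\Psi = \left\| \sup_{f \in \mathcal{F}} |f(\xi)| \right\|_{\psi_1}$. Suppose that there exist $A \geq 1$, $\zeta \geq 0$ and a random variable $D_n$ such that, almost surely, $$\mathcal{N}\big(\varepsilon, \mathcal{F}, L^2(\mathsf{P}_n)\big) \leq A\left(\frac{D_n}{\varepsilon}\right)^\zeta \quad \text{for all } 0 < \varepsilon \leq \mathcal{D}\big(\mathcal{F}, L^2(\mathsf{P}_n)\big).$$ Suppose also that there exist $\varkappa \in (0,1]$ and $B \geq 1$ such that $\mathsf{P} f^2 \leq B(\mathsf{P} f)^\varkappa$ for all $f \in \mathcal{F}$. Then, for any $\delta \in (0,1)$ and $\varepsilon > 0$, with probability at least $1-\delta$, simultaneously for all $f \in \mathcal{F}$, $$\max\big\{\mathsf{P}_n f - (1+\varepsilon)\mathsf{P} f,\ \mathsf{P} f - (1+\varepsilon)\mathsf{P}_n f\big\} \lesssim \left(\frac{(1+\varepsilon)^2 B}{\varepsilon^\varkappa}\,\Upsilon(n,\delta)\right)^{1/(2-\varkappa)} + (1+\varepsilon)(\Psi \vee 1)\,\Upsilon(n,\delta)\log n,$$ where $$\Upsilon(n,\delta) = \frac1n\left(\log A + \zeta\log n + \zeta\left(\mathbb{E}\log^3 D_n\right)^{1/3} + \log(e/\delta)\right)$$ and $\lesssim$ stands for inequality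 up to an absolute multiplicative constant.
   Context: $\mathsf{P} f = \mathbb{E} f(\xi)$ and $\mathsf{P}_n f = \frac1n\sum_{i=1}^n f(\xi_i)$. For a real random variable $\eta$, $\|\eta\|_{\psi_1} = \inf\{t > 0 : \mathbb{E}\exp(|\eta|/t) \leq 2\}$. The empirical $L^2$-norm is $\|f\|_{L^2(\mathsf{P}_n)}^2 = \frac1n\sum_{i=1}^n f(\xi_i)^2$; $\mathcal{N}(\varepsilon, \mathcal{F}, L^2(\mathsf{P}_n))$ is the $\varepsilon$-covering number of $\mathcal{F}$ with respect to this (pseudo)metric, and $\mathcal{D}(\mathcal{F}, L^2(\mathsf{P}_n)) = \sup_{f,g\in\mathcal{F}}\|f-g\|_{L^2(\mathsf{P}_n)}$ is the corresponding diameter. $x \vee y = \max\{x,y\}$.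
   Formalization: Formal version assumes n ≥ 2, D_n ≥ 1 almost surely, log^3 D_n integrable, P f ≥ 0, and that every f in F is a pointwise limit of a sequence from a fixed countable subclass; without such conditions the claim can fail or be undefined. *)

theory Defs
  imports "HOL-Probability.Probability"
begin

text \<open>
  The dimension \<open>D\<close> is a natural number inside the logic (so that an absolute constant can be
  chosen before it): points of \<open>D\<close>-dimensional space are extensional functions on \<open>{..<D}\<close>, and
  the product sigma-algebra is the Borel sigma-algebra.
\<close>

definition borel_space :: "nat \<Rightarrow> (nat \<Rightarrow> real) measure" where
  "borel_space D = PiM {..<D} (\<lambda>_. borel)"

text \<open>
  The random elements are indexed by \<open>{0..n}\<close>: \<open>X 0\<close> is the generic copy \<open>\<xi>\<close>, and
  \<open>X 1, \<dots>, X n\<close> is the sample.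
\<close>

definition iid_sample :: "'a measure \<Rightarrow> 'b measure \<Rightarrow> nat \<Rightarrow> (nat \<Rightarrow> 'a \<Rightarrow> 'b) \<Rightarrow> bool" where
  "iid_sample M N n X \<longleftrightarrow>
     prob_space.indep_vars M (\<lambda>_. N) X {0..n} \<and>
     (\<forall>i\<in>{1..n}. distr M N (X i) = distr M N (X 0))"

definition emp_mean :: "nat \<Rightarrow> (nat \<Rightarrow> 'b) \<Rightarrow> ('b \<Rightarrow> real) \<Rightarrow> real" where
  "emp_mean n x f = (\<Sum>i=1..n. f (x i)) / real n"

definition emp_norm :: "nat \<Rightarrow> (nat \<Rightarrow> 'b) \<Rightarrow> ('b \<Rightarrow> real) \<Rightarrow> real" where
  "emp_norm n x f = sqrt (emp_mean n x (\<lambda>y. (f y)\<^sup>2))"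

definition emp_dist :: "nat \<Rightarrow> (nat \<Rightarrow> 'b) \<Rightarrow> ('b \<Rightarrow> real) \<Rightarrow> ('b \<Rightarrow> real) \<Rightarrow> real" where
  "emp_dist n x f g = emp_norm n x (\<lambda>y. f y - g y)"

text \<open>
  Closed balls; the centers need not belong to \<open>F\<close>. This is the smallest of the usual variants, so
  an upper bound on any of them is also an upper bound on this one. The value is \<open>\<infinity>\<close> if there is no
  finite cover.
\<close>

definition covering_number :: "('c \<Rightarrow> 'c \<Rightarrow> real) \<Rightarrow> real \<Rightarrow> 'c set \<Rightarrow> enat" where
  "covering_number d \<epsilon> F =
     Inf {enat (card C) | C. finite C \<and> (\<forall>f\<in>F. \<exists>c\<in>C. d f c \<le> \<epsilon>)}"

definition set_diameter :: "('c \<Rightarrow> 'c \<Rightarrow> real) \<Rightarrow> 'c set \<Rightarrow> ereal" where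
  "set_diameter d F = (SUP f\<in>F. SUP g\<in>F. ereal (d f g))"

fun exp_ext :: "ereal \<Rightarrow> ennreal" where
  "exp_ext (ereal r) = ennreal (exp r)"
| "exp_ext PInfty = \<infinity>"
| "exp_ext MInfty = 0"

text \<open>
  The Orlicz norm is defined for extended-real arguments because it is applied to a supremum of
  functions; it equals \<open>\<infinity>\<close> (infimum of the empty set) if no \<open>t\<close> is admissible.
\<close>

definition psi1_norm :: "'a measure \<Rightarrow> ('a \<Rightarrow> ereal) \<Rightarrow> ereal" where
  "psi1_norm M \<eta> =
     Inf {ereal t | t. 0 < t \<and> (\<integral>\<^sup>+ \<omega>. exp_ext (\<bar>\<eta> \<omega>\<bar> / ereal t) \<partial>M) \<le> 2}"

definition psi1_diameter :: "'a measure \<Rightarrow> ('a \<Rightarrow> 'b) \<Rightarrow> ('b \<Rightarrow> real) set \<Rightarrow> ereal" where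
  "psi1_diameter M \<xi> F =
     (SUP f\<in>F. SUP g\<in>F. psi1_norm M (\<lambda>\<omega>. ereal (f (\<xi> \<omega>) - g (\<xi> \<omega>))))"

definition psi1_envelope :: "'a measure \<Rightarrow> ('a \<Rightarrow> 'b) \<Rightarrow> ('b \<Rightarrow> real) set \<Rightarrow> ereal" where
  "psi1_envelope M \<xi> F = psi1_norm M (\<lambda>\<omega>. SUP f\<in>F. ereal \<bar>f (\<xi> \<omega>)\<bar>)"

text \<open>
  The usual measurability convention for suprema over a possibly uncountable class: every member is
  the pointwise limit of a sequence from a fixed countable subclass. Countable classes of measurable
  functions satisfy it. Without such a convention uniform deviation bounds can fail: under CH,
  take the indicators of the countable initial segments of a well-ordering of an interval.
\<close>

definition pointwise_measurable_class :: "'b measure \<Rightarrow> ('b \<Rightarrow> real) set \<Rightarrow> bool" where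
  "pointwise_measurable_class N F \<longleftrightarrow>
     F \<subseteq> borel_measurable N \<and>
     (\<exists>G\<subseteq>F. countable G \<and>
        (\<forall>f\<in>F. \<exists>g :: nat \<Rightarrow> 'b \<Rightarrow> real. range g \<subseteq> G \<and>
           (\<forall>x\<in>space N. (\<lambda>k. g k x) \<longlonglongrightarrow> f x)))"

definition Upsilon ::
  "'a measure \<Rightarrow> real \<Rightarrow> real \<Rightarrow> ('a \<Rightarrow> real) \<Rightarrow> nat \<Rightarrow> real \<Rightarrow> real" where
  "Upsilon M A \<zeta> Dn n \<delta> =
     (ln A + \<zeta> * ln (real n) + \<zeta> * root 3 (\<integral>\<omega>. (ln (Dn \<omega>)) ^ 3 \<partial>M) + ln (exp 1 / \<delta>)) / real n"

end

theory Submission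
  imports Defs
begin

text \<open>No chaining is needed, because an \<open>L\<^sup>2(P\<^sub>n)\<close>-net at scale \<open>1/n\<close> already has log-cardinality of the order of
  \<open>n \<Upsilon>(n, \<delta>)\<close> whenever \<open>D\<^sub>n\<close> is at most \<open>exp (2 r + 1)\<close> with \<open>r = (E log\<^sup>3 D\<^sub>n)\<^sup>1\<^sup>/\<^sup>3\<close>, which by Markov's inequality
  has probability at least \<open>7/8\<close>. This constant probability is boosted to \<open>1 - \<delta>\<close> by Talagrand's control by two
  points: outside an event of probability \<open>2\<^sup>-\<^sup>k\<close>, all but \<open>k\<close> coordinates of a sample occur in one of two samples that
  have a small net, so the sample has a net of polynomially larger cardinality on these coordinates. For \<open>k\<close> of
  the order of \<open>log (1/\<delta>)\<close> the exceptional coordinates contribute only \<open>k K\<close> to a sum of functions bounded by \<open>K\<close>.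
  A ghost sample and random swaps of the two samples, which leave the existence of the net invariant, reduce the
  uniform deviation to Rademacher sums over the net. The envelope is truncated at \<open>K = 2 c log n\<close> with
  \<open>c = 2 max \<Psi> 1\<close>; the truncated tail has an exponential moment of order one on the whole sample. The result
  \<open>\<bar>P\<^sub>n f - P f\<bar> \<lesssim> \<surd>(\<Upsilon> P f\<^sup>2) + max \<Psi> 1 \<Upsilon> log n\<close> becomes a relative bound by Young's inequality.\<close>

section \<open>Talagrand's two-point control inequality\<close>


text \<open>Only a third moment of \<open>ln D_n\<close> is available, so Markov's inequality at
  level \<delta> would put a power of 1/\<delta> into the entropy bound. This is why the net is
  first obtained with constant probability. Closeness to a single good sample would not suffice for
  the boost: the Hamming distance to a set of constant probability is typically of order sqrt n,
  whereas the number of coordinates missed by two good samples has an exponential moment. The random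
  swaps need an event that is invariant under exchanging each sample point with its ghost. The event
  that a net exists for both halves jointly, off a set of discarded pairs, has this property.
  Passing to nets for the pair raises the cardinality to a fourth power, which costs only a factor
  in the logarithm. The radius 1/n is affordable because moving to a centre changes a sum of n terms
  by sqrt (n * 1/n), a constant. The ghost half carries a second task: its sum of squares replaces
  the unknown variance of a data-dependent function.\<close>

lemma prod_three_le_one:
  fixes u x y :: real
  assumes "0 \<le> x" "x \<le> 1" "0 \<le> y" "y \<le> 1" "u + x + y \<le> 3"
  shows "u * x * y \<le> 1"
proof -
  have "u * (x * y) \<le> (3 - x - y) * (x * y)"
    using assms by (intro mult_right_mono) auto
  also have "x * y \<le> ((x + y) / 2)\<^sup>2"
    using sum_squares_ge_zero[of "x - y" 0] by (simp add: power2_eq_square field_simps)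
  then have "(3 - x - y) * (x * y) \<le> (3 - x - y) * ((x + y) / 2)\<^sup>2"
    using assms by (intro mult_left_mono) auto
  also have "\<dots> \<le> 1"
  proof -
    define s where "s = (x + y) / 2"
    have s: "0 \<le> s" "x + y = 2 * s" using assms by (auto simp: s_def)
    have "1 - (3 - 2 * s) * s\<^sup>2 = (1 - s)\<^sup>2 * (1 + 2 * s)"
      by (simp add: power2_eq_square algebra_simps)
    moreover have "0 \<le> (1 - s)\<^sup>2 * (1 + 2 * s)" using s by simp
    moreover have "3 - x - y = 3 - 2 * s" using s by linarith
    ultimately show ?thesis by (simp only: s_def[symmetric])
  qed
  finally show ?thesis by (simp add: mult.assoc)
qed

lemma add_three_le:
  fixes u x y :: real
  assumes "0 \<le> u" "u \<le> 2" "0 \<le> x" "x \<le> 1" "0 \<le> y" "y \<le> 1" "u * x \<le> 1" "u * y \<le> 1"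
  shows "u + x + y \<le> 3"
proof (cases "x + y \<le> 1")
  case True then show ?thesis using assms by simp
next
  case False
  define s where "s = x + y"
  have s: "1 < s" "s \<le> 2" using False assms by (auto simp: s_def)
  have "u * s \<le> 2" using assms by (simp add: s_def algebra_simps)
  moreover have "0 \<le> (s - 1) * (2 - s)" using s by simp
  ultimately have "u * s \<le> (3 - s) * s" by (simp add: algebra_simps)
  then have "u \<le> 3 - s" using s by (simp add: mult_le_cancel_right)
  then show ?thesis by (simp add: s_def)
qed

text \<open>This is one coordinate of the induction for the two-point inequality. After
  normalization by the suprema \<open>p\<close> and \<open>q\<close>, the numbers u =
  \<open>H w * p * q\<close>, x = \<open>a w / p\<close> and y = \<open>b w / q\<close> satisfy u
  \<le> 2, u x \<le> 1 and u y \<le> 1. Products cannot be integrated, so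
  \<open>add_three_le\<close> weakens these constraints to u + x + y \<le> 3, which can. Then
  \<open>prod_three_le_one\<close> converts the integrated sum back into a product, in which
  \<open>p\<close> and \<open>q\<close> cancel.\<close>

lemma nn_integral_three_product_le_one:
  fixes H a b :: "'c \<Rightarrow> ennreal"
  assumes "prob_space M"
    and [measurable]: "H \<in> borel_measurable M" "a \<in> borel_measurable M" "b \<in> borel_measurable M"
    and a1: "\<And>w. w \<in> space M \<Longrightarrow> a w \<le> 1" and b1: "\<And>w. w \<in> space M \<Longrightarrow> b w \<le> 1"
    and ab: "\<And>w v. w \<in> space M \<Longrightarrow> v \<in> space M \<Longrightarrow> H w * a w * b v \<le> 1"
    and ba: "\<And>w v. w \<in> space M \<Longrightarrow> v \<in> space M \<Longrightarrow> H w * a v * b w \<le> 1"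
    and aa: "\<And>w v v'. w \<in> space M \<Longrightarrow> v \<in> space M \<Longrightarrow> v' \<in> space M \<Longrightarrow> H w * a v * b v' \<le> 2"
  shows "(\<integral>\<^sup>+w. H w \<partial>M) * (\<integral>\<^sup>+w. a w \<partial>M) * (\<integral>\<^sup>+w. b w \<partial>M) \<le> 1"
proof -
  interpret prob_space M by fact
  define p where "p = (SUP w\<in>space M. a w)"
  define q where "q = (SUP w\<in>space M. b w)"
  have ap: "a w \<le> p" and bq: "b w \<le> q" if "w \<in> space M" for w
    using that by (auto simp: p_def q_def intro: SUP_upper)
  have p1: "p \<le> 1" and q1: "q \<le> 1" using a1 b1 by (auto simp: p_def q_def intro!: SUP_least)
  have Hab: "H w * a w * q \<le> 1" if "w \<in> space M" for w
    unfolding q_def SUP_mult_left_ennreal using ab that by (intro SUP_least) auto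
  have Hba: "H w * p * b w \<le> 1" if "w \<in> space M" for w
  proof -
    have "(H w * b w) * p \<le> 1"
      unfolding p_def SUP_mult_left_ennreal using ba that by (intro SUP_least) (auto simp: ac_simps)
    then show ?thesis by (simp add: ac_simps)
  qed
  have Haa: "H w * p * q \<le> 2" if "w \<in> space M" for w
  proof -
    have "(H w * a v) * q \<le> 2" if "v \<in> space M" for v
      unfolding q_def SUP_mult_left_ennreal using aa that \<open>w \<in> space M\<close> by (intro SUP_least) auto
    then have "(H w * q) * p \<le> 2"
      unfolding p_def SUP_mult_left_ennreal by (intro SUP_least) (auto simp: ac_simps)
    then show ?thesis by (simp add: ac_simps)
  qed
  show ?thesis
  proof (cases "p = 0 \<or> q = 0")
    case True
    then have "(\<integral>\<^sup>+w. a w \<partial>M) = 0 \<or> (\<integral>\<^sup>+w. b w \<partial>M) = 0"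
    proof
      assume "p = 0"
      then have "(\<integral>\<^sup>+w. a w \<partial>M) = (\<integral>\<^sup>+w. 0 \<partial>M)" using ap by (intro nn_integral_cong) auto
      then show ?thesis by simp
    next
      assume "q = 0"
      then have "(\<integral>\<^sup>+w. b w \<partial>M) = (\<integral>\<^sup>+w. 0 \<partial>M)" using bq by (intro nn_integral_cong) auto
      then show ?thesis by simp
    qed
    then show ?thesis by auto
  next
    case False
    obtain p' where p': "p = ennreal p'" "0 \<le> p'" "p' \<le> 1"
      using p1 by (cases p) (auto simp: top_unique simp flip: ennreal_1)
    obtain q' where q': "q = ennreal q'" "0 \<le> q'" "q' \<le> 1"
      using q1 by (cases q) (auto simp: top_unique simp flip: ennreal_1)
    have pos: "0 < p'" "0 < q'" using False p' q' by auto
    define a' where "a' w = enn2real (a w)" for w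
    define b' where "b' w = enn2real (b w)" for w
    define h where "h w = enn2real (H w)" for w
    have a': "a w = ennreal (a' w)" "0 \<le> a' w" "a' w \<le> p'" if "w \<in> space M" for w
      using ap[OF that] p' by (cases "a w"; force simp: a'_def top_unique)+
    have b': "b w = ennreal (b' w)" "0 \<le> b' w" "b' w \<le> q'" if "w \<in> space M" for w
      using bq[OF that] q' by (cases "b w"; force simp: b'_def top_unique)+
    have h: "H w = ennreal (h w)" "0 \<le> h w" if "w \<in> space M" for w
    proof -
      have "H w \<noteq> \<top>"
      proof
        assume "H w = \<top>"
        then have "H w * p * q = \<top>" using pos p' q' by (simp add: ennreal_mult_eq_top_iff ennreal_top_mult)
        with Haa[OF that] show False by (simp add: top_unique)
      qed
      then show "H w = ennreal (h w)" "0 \<le> h w" by (auto simp: h_def less_top)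
    qed
    have le3: "h w * p' * q' + a' w / p' + b' w / q' \<le> 3" if w: "w \<in> space M" for w
    proof (rule add_three_le)
      show "h w * p' * q' \<le> 2"
        using Haa[OF w] h[OF w] p' q'
        by (simp flip: ennreal_mult add: ennreal_le_iff flip: ennreal_numeral)
      show "h w * p' * q' * (a' w / p') \<le> 1"
        using Hab[OF w] h[OF w] a'[OF w] p' q' pos
        by (simp flip: ennreal_mult ennreal_1 add: ennreal_le_iff field_simps)
      show "h w * p' * q' * (b' w / q') \<le> 1"
        using Hba[OF w] h[OF w] b'[OF w] p' q' pos
        by (simp flip: ennreal_mult ennreal_1 add: ennreal_le_iff field_simps)
    qed (use h[OF w] a'[OF w] b'[OF w] pos in auto)
    have [measurable]: "h \<in> borel_measurable M" "a' \<in> borel_measurable M" "b' \<in> borel_measurable M"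
      unfolding h_def a'_def b'_def by measurable
    have hb: "h w \<le> 2 / (p' * q')" if "w \<in> space M" for w
      using Haa[OF that] h[OF that] p' q' pos
      by (simp flip: ennreal_mult add: ennreal_le_iff field_simps flip: ennreal_numeral)
    have ih: "integrable M h"
      using hb h by (intro integrable_const_bound[where B="2 / (p' * q')"]) auto
    have ia: "integrable M a'" using a' by (intro integrable_const_bound[where B=p']) auto
    have ib: "integrable M b'" using b' by (intro integrable_const_bound[where B=q']) auto
    have I: "(\<integral>\<^sup>+w. H w \<partial>M) = ennreal (\<integral>w. h w \<partial>M)" "(\<integral>\<^sup>+w. a w \<partial>M) = ennreal (\<integral>w. a' w \<partial>M)"
      "(\<integral>\<^sup>+w. b w \<partial>M) = ennreal (\<integral>w. b' w \<partial>M)"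
      using ih ia ib h a' b'
      by (auto simp: nn_integral_eq_integral[symmetric] intro!: nn_integral_cong AE_I2)
    have nn: "0 \<le> (\<integral>w. h w \<partial>M)" "0 \<le> (\<integral>w. a' w \<partial>M)" "0 \<le> (\<integral>w. b' w \<partial>M)"
      using h a' b' by (auto intro!: integral_nonneg_AE AE_I2)
    have le: "(\<integral>w. a' w \<partial>M) \<le> p'" "(\<integral>w. b' w \<partial>M) \<le> q'"
      using integral_mono[OF ia, of "\<lambda>_. p'"] integral_mono[OF ib, of "\<lambda>_. q'"] a' b'
      by (auto simp: prob_space)
    have "(\<integral>w. h w * p' * q' + a' w / p' + b' w / q' \<partial>M) \<le> (\<integral>w. 3 \<partial>M)"
      using ih ia ib le3 by (intro integral_mono) auto
    then have "(\<integral>w. h w \<partial>M) * p' * q' + (\<integral>w. a' w \<partial>M) / p' + (\<integral>w. b' w \<partial>M) / q' \<le> 3"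
      using ih ia ib by (simp add: prob_space)
    then have "(\<integral>w. h w \<partial>M) * p' * q' * ((\<integral>w. a' w \<partial>M) / p') * ((\<integral>w. b' w \<partial>M) / q') \<le> 1"
      using nn le pos by (intro prod_three_le_one) auto
    then have "(\<integral>w. h w \<partial>M) * (\<integral>w. a' w \<partial>M) * (\<integral>w. b' w \<partial>M) \<le> 1"
      using pos by (simp add: field_simps)
    then show ?thesis unfolding I using nn
      by (simp flip: ennreal_mult ennreal_1 add: ennreal_le_iff)
  qed
qed

text \<open>Induction on the coordinates: for a fixed last coordinate \<open>w\<close>, the section of one of the two sets
  is taken at \<open>w\<close> and the section of the other one anywhere, or both are taken anywhere at the cost of one
  mismatch. Suprema of measures of sections replace projections, which need not be measurable.\<close>

theorem talagrand_two_points: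
  fixes M :: "'b measure" and I :: "'i set"
  assumes "prob_space M" and "finite I"
    and "A \<in> sets (Pi\<^sub>M I (\<lambda>_. M))" and "B \<in> sets (Pi\<^sub>M I (\<lambda>_. M))"
    and "h \<in> measurable (Pi\<^sub>M I (\<lambda>_. M)) (count_space (UNIV :: nat set))"
    and "\<And>x y y'. x \<in> space (Pi\<^sub>M I (\<lambda>_. M)) \<Longrightarrow> y \<in> A \<Longrightarrow> y' \<in> B \<Longrightarrow>
      h x \<le> card {i\<in>I. x i \<noteq> y i \<and> x i \<noteq> y' i}"
  shows "(\<integral>\<^sup>+x. 2 ^ h x \<partial>Pi\<^sub>M I (\<lambda>_. M)) * emeasure (Pi\<^sub>M I (\<lambda>_. M)) A * emeasure (Pi\<^sub>M I (\<lambda>_. M)) B \<le> 1"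
  using assms(2-)
proof (induction I arbitrary: A B h rule: finite_induct)
  case empty
  interpret prob_space M by fact
  interpret P: prob_space "Pi\<^sub>M ({}::'i set) (\<lambda>_. M)" by (intro prob_space_PiM) (rule prob_space_axioms)
  show ?case
  proof (cases "A = {} \<or> B = {}")
    case False
    then obtain y y' where "y \<in> A" "y' \<in> B" by auto
    then have h0: "h x = 0" if "x \<in> space (Pi\<^sub>M ({}::'i set) (\<lambda>_. M))" for x
      using empty(4)[OF that, of y y'] by simp
    have "(\<integral>\<^sup>+x. 2 ^ h x \<partial>Pi\<^sub>M ({}::'i set) (\<lambda>_. M)) = (\<integral>\<^sup>+x. 1 \<partial>Pi\<^sub>M ({}::'i set) (\<lambda>_. M))"
      by (rule nn_integral_cong) (simp add: h0)
    also have "\<dots> = 1" by (simp add: P.emeasure_space_1)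
    finally show ?thesis
      using P.emeasure_le_1[of A] P.emeasure_le_1[of B] mult_mono[of "emeasure (Pi\<^sub>M ({}::'i set) (\<lambda>_. M)) A" 1 _ 1] by simp
  qed auto
next
  case (insert i I)
  interpret prob_space M by fact
  interpret product_sigma_finite "\<lambda>_. M" by unfold_locales
  interpret P: prob_space "Pi\<^sub>M I (\<lambda>_. M)" by (intro prob_space_PiM) (rule prob_space_axioms)
  note [measurable] = insert.prems(1,2,3)
  let ?N = "Pi\<^sub>M I (\<lambda>_. M)"
  define S where "S C w = {x\<in>space ?N. x(i := w) \<in> C}" for C w
  have S[measurable]: "S C w \<in> sets ?N" if "w \<in> space M" "C \<in> sets (Pi\<^sub>M (insert i I) (\<lambda>_. M))" for C w
    using that unfolding S_def by measurable
  have em: "emeasure (Pi\<^sub>M (insert i I) (\<lambda>_. M)) C = (\<integral>\<^sup>+w. emeasure ?N (S C w) \<partial>M)"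
      "(\<lambda>w. emeasure ?N (S C w)) \<in> borel_measurable M"
    if C[measurable]: "C \<in> sets (Pi\<^sub>M (insert i I) (\<lambda>_. M))" for C
  proof -
    have eq: "(\<integral>\<^sup>+x. indicator C (x(i := w)) \<partial>?N) = emeasure ?N (S C w)" if "w \<in> space M" for w
      using S[OF that C] by (auto simp: S_def indicator_def simp flip: nn_integral_indicator intro!: nn_integral_cong)
    have "emeasure (Pi\<^sub>M (insert i I) (\<lambda>_. M)) C = (\<integral>\<^sup>+x. indicator C x \<partial>Pi\<^sub>M (insert i I) (\<lambda>_. M))"
      by simp
    also have "\<dots> = (\<integral>\<^sup>+w. (\<integral>\<^sup>+x. indicator C (x(i := w)) \<partial>?N) \<partial>M)"
      using insert.hyps by (intro product_nn_integral_insert_rev) auto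
    also have "\<dots> = (\<integral>\<^sup>+w. emeasure ?N (S C w) \<partial>M)" by (intro nn_integral_cong) (rule eq)
    finally show "emeasure (Pi\<^sub>M (insert i I) (\<lambda>_. M)) C = (\<integral>\<^sup>+w. emeasure ?N (S C w) \<partial>M)" .
    have "(\<lambda>w. \<integral>\<^sup>+x. indicator C (x(i := w)) \<partial>?N) \<in> borel_measurable M"
      by measurable
    then show "(\<lambda>w. emeasure ?N (S C w)) \<in> borel_measurable M"
      by (subst (asm) measurable_cong[OF eq])
  qed
  define H :: "'b \<Rightarrow> ennreal" where "H w = (\<integral>\<^sup>+x. 2 ^ h (x(i := w)) \<partial>?N)" for w
  have [measurable]: "H \<in> borel_measurable M" unfolding H_def by measurable
  have HI: "(\<integral>\<^sup>+x. 2 ^ h x \<partial>Pi\<^sub>M (insert i I) (\<lambda>_. M)) = (\<integral>\<^sup>+w. H w \<partial>M)"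
    unfolding H_def using insert.hyps by (intro product_nn_integral_insert_rev) auto
  have card_le: "h (x(i := w)) \<le> card {j\<in>I. x j \<noteq> y j \<and> x j \<noteq> y' j} + (if w = v \<or> w = v' then 0 else 1)"
    if "x \<in> space ?N" "w \<in> space M" "y \<in> S A v" "y' \<in> S B v'" for x w y y' v v'
  proof -
    have "x(i := w) \<in> space (Pi\<^sub>M (insert i I) (\<lambda>_. M))"
      using that by (auto simp: space_PiM PiE_iff extensional_def)
    then have "h (x(i := w)) \<le> card {j\<in>insert i I. (x(i := w)) j \<noteq> (y(i := v)) j \<and> (x(i := w)) j \<noteq> (y'(i := v')) j}"
      using that by (intro insert.prems) (simp_all only: S_def mem_Collect_eq)
    also have "\<dots> \<le> card ({j\<in>I. x j \<noteq> y j \<and> x j \<noteq> y' j} \<union> (if w = v \<or> w = v' then {} else {i}))"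
      using insert.hyps by (intro card_mono) auto
    also have "\<dots> \<le> card {j\<in>I. x j \<noteq> y j \<and> x j \<noteq> y' j} + (if w = v \<or> w = v' then 0 else 1)"
      by (rule order.trans[OF card_Un_le]) auto
    finally show ?thesis .
  qed
  have 1: "H w * emeasure ?N (S A v) * emeasure ?N (S B v') \<le> 1"
    if w: "w \<in> space M" "v \<in> space M" "v' \<in> space M" "w = v \<or> w = v'" for w v v'
    unfolding H_def
  proof (rule insert.IH)
    show "S A v \<in> sets ?N" "S B v' \<in> sets ?N" using w by auto
    show "(\<lambda>x. h (x(i := w))) \<in> measurable ?N (count_space UNIV)" using w by measurable
    show "h (x(i := w)) \<le> card {i \<in> I. x i \<noteq> y i \<and> x i \<noteq> y' i}"
      if "x \<in> space ?N" "y \<in> S A v" "y' \<in> S B v'" for x y y'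
      using card_le[OF that(1) w(1) that(2,3)] w by auto
  qed
  \<comment> \<open>The last coordinate accounts for at most one mismatch, so the induction
    hypothesis applies to \<open>h - 1\<close> and loses a factor 2. Truncated subtraction is
    harmless: \<open>2 ^ h\<close> \<le> \<open>2 * 2 ^ (h - 1)\<close> also holds at
    \<open>h = 0\<close>.\<close>
  have 2: "H w * emeasure ?N (S A v) * emeasure ?N (S B v') \<le> 2"
    if w: "w \<in> space M" "v \<in> space M" "v' \<in> space M" for w v v'
  proof -
    have "(\<integral>\<^sup>+x. 2 ^ (h (x(i := w)) - 1) \<partial>?N) * emeasure ?N (S A v) * emeasure ?N (S B v') \<le> 1"
    proof (rule insert.IH)
      show "S A v \<in> sets ?N" "S B v' \<in> sets ?N" using w by auto
      show "(\<lambda>x. h (x(i := w)) - 1) \<in> measurable ?N (count_space UNIV)" using w by measurable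
      show "h (x(i := w)) - 1 \<le> card {i \<in> I. x i \<noteq> y i \<and> x i \<noteq> y' i}"
        if "x \<in> space ?N" "y \<in> S A v" "y' \<in> S B v'" for x y y'
        using card_le[OF that(1) w(1) that(2,3)] w by (auto split: if_splits)
    qed
    moreover have "H w \<le> (\<integral>\<^sup>+x. 2 * 2 ^ (h (x(i := w)) - 1) \<partial>?N)"
      unfolding H_def
    proof (intro nn_integral_mono)
      fix x show "(2::ennreal) ^ h (x(i := w)) \<le> 2 * 2 ^ (h (x(i := w)) - 1)"
        by (cases "h (x(i := w))") (auto simp: one_le_numeral)
    qed
    then have "H w \<le> 2 * (\<integral>\<^sup>+x. 2 ^ (h (x(i := w)) - 1) \<partial>?N)"
      using w by (subst (asm) nn_integral_cmult) auto
    ultimately show ?thesis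
      by (smt (verit) mult.assoc mult_left_mono mult_right_mono order.trans mult_1_right zero_le)
  qed
  show ?case
    unfolding HI em(1)[OF insert.prems(1)] em(1)[OF insert.prems(2)]
    using 1 2 em(2) insert.prems P.emeasure_le_1
    by (intro nn_integral_three_product_le_one) (auto intro: prob_space_axioms)
qed

section \<open>Random signs\<close>


lemma cosh_le_exp_half_square:
  fixes x :: real
  shows "cosh x \<le> exp (x\<^sup>2 / 2)"
proof -
  have *: "cosh y \<le> exp (y\<^sup>2 / 2)" if "0 \<le> y" for y :: real
  proof -
    have d1: "sinh z \<le> z * cosh z" if "0 \<le> z" for z :: real
    proof -
      have "(\<lambda>z::real. z * cosh z - sinh z) 0 \<le> (\<lambda>z. z * cosh z - sinh z) z"
        by (rule DERIV_nonneg_imp_nondecreasing[OF that])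
           (auto intro!: derivative_eq_intros exI)
      then show ?thesis by simp
    qed
    have "(\<lambda>z::real. ln (cosh z) - z\<^sup>2 / 2) y \<le> (\<lambda>z. ln (cosh z) - z\<^sup>2 / 2) 0"
    proof (rule DERIV_nonpos_imp_nonincreasing[OF that])
      fix z :: real assume z: "0 \<le> z" "z \<le> y"
      have "((\<lambda>z::real. ln (cosh z) - z\<^sup>2 / 2) has_real_derivative (sinh z / cosh z - z)) (at z)"
        by (auto intro!: derivative_eq_intros simp: cosh_real_pos)
      moreover have "sinh z / cosh z - z \<le> 0"
        using d1[OF z(1)] by (simp add: pos_divide_le_eq cosh_real_pos)
      ultimately show "\<exists>w. ((\<lambda>z::real. ln (cosh z) - z\<^sup>2 / 2) has_real_derivative w) (at z) \<and> w \<le> 0"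
        by blast
    qed
    then have "ln (cosh y) \<le> y\<^sup>2 / 2" by simp
    moreover have "cosh y = exp (ln (cosh y))" by (simp add: cosh_real_pos)
    ultimately show ?thesis by (metis exp_le_cancel_iff)
  qed
  show ?thesis
  proof (cases "0 \<le> x")
    case False
    then show ?thesis using *[of "-x"] by simp
  qed (rule *)
qed

text \<open>A Rademacher sum, with \<open>T\<close> the set of coordinates carrying a minus sign.
  Averaging over signs becomes counting in \<open>Pow I\<close>, and the same \<open>T\<close> later
  serves as the set of swapped pairs.\<close>

definition signed_sum :: "'i set \<Rightarrow> 'i set \<Rightarrow> ('i \<Rightarrow> real) \<Rightarrow> real" where
  "signed_sum I T a = (\<Sum>i\<in>I. if i \<in> T then - a i else a i)"

lemma signed_sum_uminus: "signed_sum I T (\<lambda>i. - a i) = - signed_sum I T a"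
  by (auto simp: signed_sum_def simp flip: sum_negf intro!: sum.cong)

text \<open>Expanding the product of \<open>exp (- a i) + exp (a i)\<close> over subsets of
  \<open>I\<close> produces exactly the sign patterns, and each factor is
  \<open>2 * cosh (a i)\<close>, which is sub-Gaussian.\<close>

lemma sum_exp_signed_sum_le:
  assumes "finite I"
  shows "(\<Sum>T\<in>Pow I. exp (signed_sum I T a)) \<le> 2 ^ card I * exp ((\<Sum>i\<in>I. (a i)\<^sup>2) / 2)"
proof -
  have "(\<Sum>T\<in>Pow I. exp (signed_sum I T a)) = (\<Sum>T\<in>Pow I. (\<Prod>i\<in>T. exp (- a i)) * (\<Prod>i\<in>I-T. exp (a i)))"
  proof (intro sum.cong refl)
    fix T assume T: "T \<in> Pow I"
    then have "signed_sum I T a = (\<Sum>i\<in>T. - a i) + (\<Sum>i\<in>I-T. a i)"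
      unfolding signed_sum_def using assms
      by (subst sum.subset_diff[of T I]) (auto intro!: arg_cong2[where f="(+)"] sum.cong)
    then show "exp (signed_sum I T a) = (\<Prod>i\<in>T. exp (- a i)) * (\<Prod>i\<in>I-T. exp (a i))"
      using T assms finite_subset[of T I] by (simp add: exp_add exp_sum)
  qed
  also have "\<dots> = (\<Prod>i\<in>I. exp (- a i) + exp (a i))"
    using prod_add[OF assms, of "\<lambda>i. exp (- a i)" "\<lambda>i. exp (a i)"] by simp
  also have "\<dots> \<le> (\<Prod>i\<in>I. 2 * exp ((a i)\<^sup>2 / 2))"
  proof (rule prod_mono)
    fix i
    show "0 \<le> exp (- a i) + exp (a i) \<and> exp (- a i) + exp (a i) \<le> 2 * exp ((a i)\<^sup>2 / 2)"
      using cosh_le_exp_half_square[of "a i"] by (auto simp: cosh_def add_nonneg_nonneg)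
  qed
  also have "\<dots> = 2 ^ card I * exp ((\<Sum>i\<in>I. (a i)\<^sup>2) / 2)"
    using assms by (simp add: prod.distrib exp_sum sum_divide_distrib)
  finally show ?thesis .
qed

lemma card_signed_sum_gt_le:
  assumes "finite I" "0 < L"
  shows "real (card {T\<in>Pow I. sqrt (2 * L * (\<Sum>i\<in>I. (a i)\<^sup>2)) < signed_sum I T a}) \<le> 2 ^ card I * exp (- L)"
proof (cases "(\<Sum>i\<in>I. (a i)\<^sup>2) = 0")
  \<comment> \<open>If all coefficients vanish, the strict inequality makes the counted set empty;
    the Chernoff parameter below needs a positive sum of squares.\<close>
  case True
  then have "a i = 0" if "i \<in> I" for i
    using that assms by (simp add: sum_nonneg_eq_0_iff)
  then have "signed_sum I T a = 0" for T
    unfolding signed_sum_def by (intro sum.neutral) auto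
  then show ?thesis using True by simp
next
  case False
  define s where "s = (\<Sum>i\<in>I. (a i)\<^sup>2)"
  have s: "0 < s" using False sum_nonneg[of I "\<lambda>i. (a i)\<^sup>2"] by (simp add: s_def)
  \<comment> \<open>The minimizer of the Chernoff exponent l^2 s / 2 - l sqrt (2 L s), whose minimal
    value is - L.\<close>
  define l where "l = sqrt (2 * L / s)"
  have "2 * L / s * (2 * L * s) = (2 * L)\<^sup>2" using s by (simp add: power2_eq_square)
  then have "l * sqrt (2 * L * s) = sqrt ((2 * L)\<^sup>2)" by (simp only: l_def flip: real_sqrt_mult)
  also have "\<dots> = 2 * L" using assms by (subst real_sqrt_abs) simp
  finally have l3: "l * sqrt (2 * L * s) = 2 * L" .
  have l: "0 < l" "l\<^sup>2 * s = 2 * L" using s assms by (simp_all add: l_def)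
  let ?B = "{T\<in>Pow I. sqrt (2 * L * s) < signed_sum I T a}"
  have scale: "signed_sum I T (\<lambda>i. l * a i) = l * signed_sum I T a" for T
    unfolding signed_sum_def sum_distrib_left by (intro sum.cong) auto
  have "real (card ?B) * exp (2 * L) = (\<Sum>T\<in>?B. exp (2 * L))" by simp
  also have "\<dots> \<le> (\<Sum>T\<in>?B. exp (signed_sum I T (\<lambda>i. l * a i)))"
  proof (intro sum_mono)
    fix T assume "T \<in> ?B"
    then have "l * sqrt (2 * L * s) \<le> l * signed_sum I T a" using l by (intro mult_left_mono) auto
    then show "exp (2 * L) \<le> exp (signed_sum I T (\<lambda>i. l * a i))" unfolding scale l3 by simp
  qed
  also have "\<dots> \<le> (\<Sum>T\<in>Pow I. exp (signed_sum I T (\<lambda>i. l * a i)))"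
    using assms by (intro sum_mono2) auto
  also have "\<dots> \<le> 2 ^ card I * exp ((\<Sum>i\<in>I. (l * a i)\<^sup>2) / 2)"
    by (rule sum_exp_signed_sum_le[OF assms(1)])
  also have "(\<Sum>i\<in>I. (l * a i)\<^sup>2) = 2 * L"
    using l by (simp add: power_mult_distrib s_def flip: sum_distrib_left)
  finally have "real (card ?B) * exp (2 * L) \<le> 2 ^ card I * exp L" by simp
  then have "real (card ?B) \<le> 2 ^ card I * exp L * exp (- 2 * L)"
    by (simp add: exp_minus divide_simps)
  also have "\<dots> = 2 ^ card I * exp (- L)"
    by (simp add: mult.assoc flip: exp_add)
  finally show ?thesis by (simp add: s_def)
qed

lemma card_abs_signed_sum_gt_le:
  assumes "finite I" "0 < L"
  shows "real (card {T\<in>Pow I. sqrt (2 * L * (\<Sum>i\<in>I. (a i)\<^sup>2)) < \<bar>signed_sum I T a\<bar>}) \<le> 2 ^ card I * (2 * exp (- L))"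
proof -
  let ?B = "\<lambda>a. {T\<in>Pow I. sqrt (2 * L * (\<Sum>i\<in>I. (a i)\<^sup>2)) < signed_sum I T a}"
  have "{T\<in>Pow I. sqrt (2 * L * (\<Sum>i\<in>I. (a i)\<^sup>2)) < \<bar>signed_sum I T a\<bar>} = ?B a \<union> ?B (\<lambda>i. - a i)"
    by (auto simp: signed_sum_uminus abs_real_def split: if_splits)
  then have "real (card {T\<in>Pow I. sqrt (2 * L * (\<Sum>i\<in>I. (a i)\<^sup>2)) < \<bar>signed_sum I T a\<bar>})
      \<le> real (card (?B a)) + real (card (?B (\<lambda>i. - a i)))"
    using card_Un_le[of "?B a" "?B (\<lambda>i. - a i)"] by simp
  then show ?thesis
    using card_signed_sum_gt_le[OF assms, of a] card_signed_sum_gt_le[OF assms, of "\<lambda>i. - a i"] by simp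
qed

text \<open>The bound \<open>b\<close> for the squares makes \<open>\<Sum>P\<^sup>2\<close> at most a multiple of \<open>\<Sum>Q\<^sup>2 + L K\<^sup>2\<close>, so that the
  variance in the bound \<open>a\<close> is controlled by one of the two samples only.\<close>

lemma abs_sum_diff_le_of_near:
  fixes p q P Q :: "'i \<Rightarrow> real"
  assumes I: "finite I" and JI: "J \<subseteq> I" and kJ: "card J \<le> k" and K: "0 \<le> K" and L: "0 \<le> L" and R: "0 \<le> R"
    and n: "card I \<le> n"
    and p: "\<And>i. i \<in> I \<Longrightarrow> \<bar>p i\<bar> \<le> K" and q: "\<And>i. i \<in> I \<Longrightarrow> \<bar>q i\<bar> \<le> K"
    and P: "\<And>i. i \<in> I \<Longrightarrow> \<bar>P i\<bar> \<le> K" and Q: "\<And>i. i \<in> I \<Longrightarrow> \<bar>Q i\<bar> \<le> K"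
    and a: "\<bar>\<Sum>i\<in>I-J. P i - Q i\<bar> \<le> sqrt (2 * L * (\<Sum>i\<in>I-J. (P i - Q i)\<^sup>2))"
    and b: "\<bar>\<Sum>i\<in>I-J. (P i)\<^sup>2 - (Q i)\<^sup>2\<bar> \<le> sqrt (2 * L * (\<Sum>i\<in>I-J. ((P i)\<^sup>2 - (Q i)\<^sup>2)\<^sup>2))"
    and c: "(\<Sum>i\<in>I-J. (p i - P i)\<^sup>2 + (q i - Q i)\<^sup>2) \<le> R"
    and d: "(\<Sum>i\<in>I. (q i)\<^sup>2) \<le> s"
  shows "\<bar>\<Sum>i\<in>I. p i - q i\<bar> \<le> 2 * real k * K + sqrt (2 * real n * R) + sqrt (4 * L * (8 * s + 8 * R + 2 * L * K\<^sup>2))"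
proof -
  define H where "H = I - J"
  have H: "finite H" "H \<subseteq> I" "I = J \<union> H" "J \<inter> H = {}" "finite J"
    using I JI finite_subset by (auto simp: H_def)
  define S1 where "S1 = (\<Sum>i\<in>H. (P i)\<^sup>2)"
  define S2 where "S2 = (\<Sum>i\<in>H. (Q i)\<^sup>2)"
  have S: "0 \<le> S1" "0 \<le> S2" by (auto simp: S1_def S2_def intro: sum_nonneg)
  have S2: "S2 \<le> 2 * s + 2 * R"
  proof -
    have "S2 \<le> (\<Sum>i\<in>H. 2 * (q i)\<^sup>2 + 2 * ((p i - P i)\<^sup>2 + (q i - Q i)\<^sup>2))"
      unfolding S2_def
    proof (intro sum_mono)
      fix i
      have "0 \<le> (2 * q i - Q i)\<^sup>2 + 2 * (p i - P i)\<^sup>2" by simp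
      then show "(Q i)\<^sup>2 \<le> 2 * (q i)\<^sup>2 + 2 * ((p i - P i)\<^sup>2 + (q i - Q i)\<^sup>2)"
        by (simp add: power2_eq_square algebra_simps)
    qed
    also have "\<dots> = 2 * (\<Sum>i\<in>H. (q i)\<^sup>2) + 2 * (\<Sum>i\<in>H. (p i - P i)\<^sup>2 + (q i - Q i)\<^sup>2)"
      by (simp add: sum.distrib sum_distrib_left)
    also have "(\<Sum>i\<in>H. (q i)\<^sup>2) \<le> (\<Sum>i\<in>I. (q i)\<^sup>2)"
      using I H by (intro sum_mono2) auto
    finally show ?thesis using c d by (simp add: H_def)
  qed
  have var: "(\<Sum>i\<in>H. (P i - Q i)\<^sup>2) \<le> 2 * (S1 + S2)"
  proof -
    have "(\<Sum>i\<in>H. (P i - Q i)\<^sup>2) \<le> (\<Sum>i\<in>H. 2 * ((P i)\<^sup>2 + (Q i)\<^sup>2))"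
    proof (intro sum_mono)
      fix i
      have "0 \<le> (P i + Q i)\<^sup>2" by simp
      then show "(P i - Q i)\<^sup>2 \<le> 2 * ((P i)\<^sup>2 + (Q i)\<^sup>2)" by (simp add: power2_eq_square algebra_simps)
    qed
    then show ?thesis by (simp add: S1_def S2_def sum.distrib sum_distrib_left)
  qed
  have var2: "(\<Sum>i\<in>H. ((P i)\<^sup>2 - (Q i)\<^sup>2)\<^sup>2) \<le> K\<^sup>2 * (S1 + S2)"
  proof -
    have "(\<Sum>i\<in>H. ((P i)\<^sup>2 - (Q i)\<^sup>2)\<^sup>2) \<le> (\<Sum>i\<in>H. K\<^sup>2 * ((P i)\<^sup>2 + (Q i)\<^sup>2))"
    proof (intro sum_mono)
      fix i assume i: "i \<in> H"
      define x y where "x = (P i)\<^sup>2" and "y = (Q i)\<^sup>2"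
      have xy: "0 \<le> x" "0 \<le> y" "x \<le> K\<^sup>2" "y \<le> K\<^sup>2"
        using P[of i] Q[of i] i H K abs_le_square_iff[of "P i" K] abs_le_square_iff[of "Q i" K]
        by (auto simp: x_def y_def)
      have "(x - y)\<^sup>2 \<le> x * x + y * y" using xy by (simp add: power2_eq_square algebra_simps)
      also have "\<dots> \<le> K\<^sup>2 * x + K\<^sup>2 * y" using xy by (intro add_mono mult_right_mono) auto
      finally show "((P i)\<^sup>2 - (Q i)\<^sup>2)\<^sup>2 \<le> K\<^sup>2 * ((P i)\<^sup>2 + (Q i)\<^sup>2)" by (simp add: x_def y_def algebra_simps)
    qed
    then show ?thesis by (simp add: S1_def S2_def sum.distrib flip: sum_distrib_left)
  qed
  \<comment> \<open>A self-bounding argument: the fluctuation of S1 - S2 is at most sqrt (2 L K^2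
    (S1 + S2)), and the arithmetic-geometric mean inequality moves half of S1 + S2 to the left-hand
    side, leaving only S2 and K^2.\<close>
  have Sc: "S1 + S2 \<le> 4 * S2 + 2 * L * K\<^sup>2"
  proof -
    have "S1 - S2 \<le> sqrt (2 * L * (\<Sum>i\<in>H. ((P i)\<^sup>2 - (Q i)\<^sup>2)\<^sup>2))"
      using b by (simp add: S1_def S2_def H_def sum_subtractf)
    also have "\<dots> \<le> sqrt (2 * L * (K\<^sup>2 * (S1 + S2)))"
      using var2 L by (intro real_sqrt_le_mono mult_left_mono) auto
    also have "\<dots> = sqrt ((2 * L * K\<^sup>2) * (S1 + S2))" by (simp add: ac_simps)
    also have "\<dots> \<le> (2 * L * K\<^sup>2 + (S1 + S2)) / 2"
      using S L by (intro arith_geo_mean_sqrt) auto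
    finally show ?thesis by (simp add: field_simps)
  qed
  have "\<bar>\<Sum>i\<in>I. p i - q i\<bar> \<le> \<bar>\<Sum>i\<in>J. p i - q i\<bar> + \<bar>\<Sum>i\<in>H. p i - q i\<bar>"
    using sum.union_disjoint[OF H(5,1,4), of "\<lambda>i. p i - q i"] abs_triangle_ineq[of "\<Sum>i\<in>J. p i - q i" "\<Sum>i\<in>H. p i - q i"]
    by (simp only: H(3)[symmetric])
  moreover have "\<bar>\<Sum>i\<in>J. p i - q i\<bar> \<le> 2 * real k * K"
  proof -
    have "\<bar>\<Sum>i\<in>J. p i - q i\<bar> \<le> (\<Sum>i\<in>J. \<bar>p i - q i\<bar>)" by (rule sum_abs)
    also have "\<dots> \<le> (\<Sum>i\<in>J. 2 * K)"
    proof (intro sum_mono)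
      fix i assume "i \<in> J" then show "\<bar>p i - q i\<bar> \<le> 2 * K" using p[of i] q[of i] JI by auto
    qed
    also have "\<dots> \<le> real k * (2 * K)"
      using kJ K by (simp, intro mult_right_mono) auto
    finally show ?thesis by simp
  qed
  moreover have "\<bar>\<Sum>i\<in>H. p i - q i\<bar> \<le> \<bar>\<Sum>i\<in>H. P i - Q i\<bar> + (\<Sum>i\<in>H. \<bar>(p i - P i) - (q i - Q i)\<bar>)"
  proof -
    have "(\<Sum>i\<in>H. p i - q i) = (\<Sum>i\<in>H. P i - Q i) + (\<Sum>i\<in>H. (p i - P i) - (q i - Q i))"
      by (simp flip: sum.distrib)
    then show ?thesis
      using sum_abs[of "\<lambda>i. (p i - P i) - (q i - Q i)" H] by linarith
  qed
  \<comment> \<open>The cost of replacing the functions by their centres. By Cauchy-Schwarz it is of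
    order sqrt (n R), which stays bounded when \<open>R\<close> is of order 1/n.\<close>
  moreover have "(\<Sum>i\<in>H. \<bar>(p i - P i) - (q i - Q i)\<bar>) \<le> sqrt (2 * real n * R)"
  proof (rule real_le_rsqrt)
    let ?d = "\<lambda>i. (p i - P i) - (q i - Q i)"
    have "(\<Sum>i\<in>H. \<bar>?d i\<bar> * 1)\<^sup>2 \<le> (\<Sum>i\<in>H. \<bar>?d i\<bar>\<^sup>2) * (\<Sum>i\<in>H. 1\<^sup>2)"
      by (rule Cauchy_Schwarz_ineq_sum)
    also have "\<dots> \<le> (2 * R) * real n"
    proof (intro mult_mono)
      have "(\<Sum>i\<in>H. \<bar>?d i\<bar>\<^sup>2) \<le> (\<Sum>i\<in>H. 2 * ((p i - P i)\<^sup>2 + (q i - Q i)\<^sup>2))"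
      proof (intro sum_mono)
        fix i
        have "0 \<le> ((p i - P i) + (q i - Q i))\<^sup>2" by simp
        then show "\<bar>?d i\<bar>\<^sup>2 \<le> 2 * ((p i - P i)\<^sup>2 + (q i - Q i)\<^sup>2)"
          unfolding power2_abs by (simp add: power2_eq_square algebra_simps)
      qed
      then show "(\<Sum>i\<in>H. \<bar>?d i\<bar>\<^sup>2) \<le> 2 * R" using c unfolding H_def sum_distrib_left[symmetric] by linarith
      have "card H \<le> n" using card_mono[OF I H(2)] n by simp
      then show "(\<Sum>i\<in>H. 1\<^sup>2) \<le> real n" by simp
    qed (use R in \<open>auto intro: sum_nonneg\<close>)
    finally show "(\<Sum>i\<in>H. \<bar>?d i\<bar>)\<^sup>2 \<le> 2 * real n * R" by (simp add: ac_simps)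
  qed
  moreover have "\<bar>\<Sum>i\<in>H. P i - Q i\<bar> \<le> sqrt (4 * L * (8 * s + 8 * R + 2 * L * K\<^sup>2))"
  proof -
    have "\<bar>\<Sum>i\<in>H. P i - Q i\<bar> \<le> sqrt (2 * L * (\<Sum>i\<in>H. (P i - Q i)\<^sup>2))" using a by (simp add: H_def)
    also have "\<dots> \<le> sqrt (2 * L * (2 * (8 * s + 8 * R + 2 * L * K\<^sup>2)))"
      using var Sc S2 L by (intro real_sqrt_le_mono mult_left_mono) auto
    finally show ?thesis by (simp add: ac_simps)
  qed
  ultimately show ?thesis by linarith
qed

section \<open>Ghost samples and random swaps\<close>


lemma pred_countable_Bex:
  assumes "countable X" "\<And>c. c \<in> X \<Longrightarrow> Measurable.pred N (\<lambda>x. P x c)"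
  shows "Measurable.pred N (\<lambda>x. \<exists>c\<in>X. P x c)"
proof -
  have "{x\<in>space N. \<exists>c\<in>X. P x c} = (\<Union>c\<in>X. {x\<in>space N. P x c})" by auto
  also have "\<dots> \<in> sets N" using assms by (intro sets.countable_UN'') (auto simp: pred_def)
  finally show ?thesis by (simp add: pred_def)
qed

lemma pred_countable_Ball:
  assumes "countable X" "\<And>c. c \<in> X \<Longrightarrow> Measurable.pred N (\<lambda>x. P x c)"
  shows "Measurable.pred N (\<lambda>x. \<forall>c\<in>X. P x c)"
proof -
  have "Measurable.pred N (\<lambda>x. \<not> (\<exists>c\<in>X. \<not> P x c))"
    using assms(2) by (intro pred_intros_logic pred_countable_Bex[OF assms(1)])
  then show ?thesis by simp
qed

section \<open>Second moments of sums over a product measure\<close>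

lemma (in prob_space) integral_PiM_sum_centered_square:
  fixes f :: "'a \<Rightarrow> real"
  assumes J: "finite J" and f[measurable]: "f \<in> borel_measurable M"
    and fK: "\<And>x. x \<in> space M \<Longrightarrow> \<bar>f x\<bar> \<le> K" and f0: "(\<integral>x. f x \<partial>M) = 0"
  shows "integrable (Pi\<^sub>M J (\<lambda>_. M)) (\<lambda>b. (\<Sum>j\<in>J. f (b j))\<^sup>2)" (is ?I)
    and "(\<integral>b. (\<Sum>j\<in>J. f (b j))\<^sup>2 \<partial>Pi\<^sub>M J (\<lambda>_. M)) = card J * (\<integral>x. (f x)\<^sup>2 \<partial>M)" (is ?E)
proof -
  interpret product_sigma_finite "\<lambda>_. M" by unfold_locales
  have if1: "integrable M f" by (intro integrable_const_bound[where B=K]) (use fK in auto)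
  have if2: "integrable M (\<lambda>x. f x * f x)"
  proof (intro integrable_const_bound[where B="K * K"] AE_I2)
    fix x assume "x \<in> space M"
    then show "norm (f x * f x) \<le> K * K"
      using power_mono[OF fK[of x], of 2] by (simp add: power2_eq_square)
  qed auto
  \<comment> \<open>The product f(b_j) f(b_k) is written as a product over all coordinates, with
    factor 1 away from j and k, and with factor f^2 at the index if j = k. The product formula for
    integrals then handles diagonal and off-diagonal terms alike.\<close>
  define F where "F j k i x = (if i = j then f x else 1) * (if i = k then f x else 1)" for j k i :: 'b and x
  have intF: "integrable M (F j k i)" for j k i
    using if1 if2 by (cases "i = j"; cases "i = k") (simp_all add: F_def[abs_def])
  have prodF: "(\<Prod>i\<in>J. F j k i (b i)) = f (b j) * f (b k)" if "j \<in> J" "k \<in> J" for j k b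
    using that J by (simp add: F_def prod.distrib prod.delta)
  have int: "integrable (Pi\<^sub>M J (\<lambda>_. M)) (\<lambda>b. f (b j) * f (b k))" if "j \<in> J" "k \<in> J" for j k
    using product_integrable_prod[where f="F j k", OF J intF] prodF[OF that] by simp
  have val: "(\<integral>b. f (b j) * f (b k) \<partial>Pi\<^sub>M J (\<lambda>_. M)) = (if j = k then (\<integral>x. (f x)\<^sup>2 \<partial>M) else 0)"
    if "j \<in> J" "k \<in> J" for j k
  proof -
    have "(\<integral>b. f (b j) * f (b k) \<partial>Pi\<^sub>M J (\<lambda>_. M)) = (\<Prod>i\<in>J. \<integral>x. F j k i x \<partial>M)"
      using product_integral_prod[where f="F j k", OF J intF] prodF[OF that] by simp
    also have "\<dots> = (if j = k then (\<integral>x. (f x)\<^sup>2 \<partial>M) else 0)"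
    proof (cases "j = k")
      case True
      have "(\<integral>x. F j k i x \<partial>M) = (if i = j then (\<integral>x. (f x)\<^sup>2 \<partial>M) else 1)" for i
        using True by (auto simp: F_def power2_eq_square prob_space)
      then show ?thesis using True that J by (simp add: prod.delta)
    next
      case False
      have "(\<integral>x. F j k j x \<partial>M) = 0" using False f0 by (simp add: F_def)
      then show ?thesis using False that J by (auto intro!: prod_zero)
    qed
    finally show ?thesis .
  qed
  have eq: "(\<Sum>j\<in>J. f (b j))\<^sup>2 = (\<Sum>j\<in>J. \<Sum>k\<in>J. f (b j) * f (b k))" for b
    by (simp add: power2_eq_square sum_product)
  show ?I unfolding eq using int by (intro Bochner_Integration.integrable_sum) auto
  have "(\<integral>b. (\<Sum>j\<in>J. f (b j))\<^sup>2 \<partial>Pi\<^sub>M J (\<lambda>_. M)) = (\<Sum>j\<in>J. \<Sum>k\<in>J. \<integral>b. f (b j) * f (b k) \<partial>Pi\<^sub>M J (\<lambda>_. M))"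
    unfolding eq using int by (simp add: Bochner_Integration.integral_sum Bochner_Integration.integrable_sum)
  also have "\<dots> = (\<Sum>j\<in>J. \<Sum>k\<in>J. if j = k then (\<integral>x. (f x)\<^sup>2 \<partial>M) else 0)"
    using val by (intro sum.cong) auto
  also have "\<dots> = card J * (\<integral>x. (f x)\<^sup>2 \<partial>M)" using J by (simp add: sum.delta)
  finally show ?E .
qed

text \<open>Chebyshev's inequality, with the variance enlarged to the raw second moment because this
  is what the condition relating P f^2 to P f controls.\<close>

lemma (in prob_space) PiM_sum_deviation:
  fixes f :: "'a \<Rightarrow> real"
  assumes J: "finite J" and f[measurable]: "f \<in> borel_measurable M"
    and fK: "\<And>x. x \<in> space M \<Longrightarrow> \<bar>f x\<bar> \<le> K" and t: "0 < t"
  shows "measure (Pi\<^sub>M J (\<lambda>_. M)) {b\<in>space (Pi\<^sub>M J (\<lambda>_. M)). t \<le> \<bar>(\<Sum>j\<in>J. f (b j)) - card J * (\<integral>x. f x \<partial>M)\<bar>}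
    \<le> card J * (\<integral>x. (f x)\<^sup>2 \<partial>M) / t\<^sup>2"
proof -
  interpret P: prob_space "Pi\<^sub>M J (\<lambda>_. M)" by (intro prob_space_PiM) (rule prob_space_axioms)
  define m where "m = (\<integral>x. f x \<partial>M)"
  have if1: "integrable M f" by (intro integrable_const_bound[where B=K]) (use fK in auto)
  have if2: "integrable M (\<lambda>x. (f x)\<^sup>2)"
  proof (intro integrable_const_bound[where B="K * K"] AE_I2)
    fix x assume "x \<in> space M"
    then show "norm ((f x)\<^sup>2) \<le> K * K"
      using power_mono[OF fK[of x], of 2] by (simp add: power2_eq_square)
  qed auto
  define g where "g x = f x - m" for x
  have g[measurable]: "g \<in> borel_measurable M" unfolding g_def by measurable
  have gK: "\<bar>g x\<bar> \<le> K + \<bar>m\<bar>" if "x \<in> space M" for x using fK[OF that] by (simp add: g_def)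
  have g0: "(\<integral>x. g x \<partial>M) = 0" using if1 by (simp add: g_def m_def prob_space)
  note G = integral_PiM_sum_centered_square[OF J g gK g0]
  have sum: "(\<Sum>j\<in>J. g (b j)) = (\<Sum>j\<in>J. f (b j)) - card J * m" for b
    by (simp add: g_def sum_subtractf)
  have "measure (Pi\<^sub>M J (\<lambda>_. M)) {b\<in>space (Pi\<^sub>M J (\<lambda>_. M)). t \<le> \<bar>\<Sum>j\<in>J. g (b j)\<bar>} \<le> card J * (\<integral>x. (g x)\<^sup>2 \<partial>M) / t\<^sup>2"
    using P.second_moment_method[of "\<lambda>b. \<Sum>j\<in>J. g (b j)" t] G t by simp
  also have "\<dots> \<le> card J * (\<integral>x. (f x)\<^sup>2 \<partial>M) / t\<^sup>2"
  proof -
    have "(\<integral>x. (g x)\<^sup>2 \<partial>M) = (\<integral>x. (f x)\<^sup>2 \<partial>M) - m\<^sup>2"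
    proof -
      have "(\<integral>x. (g x)\<^sup>2 \<partial>M) = (\<integral>x. (f x)\<^sup>2 - (2 * m) * f x + m\<^sup>2 \<partial>M)"
        by (simp add: g_def power2_diff algebra_simps)
      also have "\<dots> = (\<integral>x. (f x)\<^sup>2 \<partial>M) - 2 * m * m + m\<^sup>2"
        using if1 if2 by (simp add: m_def prob_space)
      finally show ?thesis by (simp add: power2_eq_square)
    qed
    then have "(\<integral>x. (g x)\<^sup>2 \<partial>M) \<le> (\<integral>x. (f x)\<^sup>2 \<partial>M)" by simp
    then show ?thesis by (intro divide_right_mono mult_left_mono) auto
  qed
  finally show ?thesis by (simp add: sum m_def)
qed

lemma (in prob_space) PiM_sum_square_tail:
  fixes f :: "'a \<Rightarrow> real"
  assumes J: "finite J" and f[measurable]: "f \<in> borel_measurable M"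
    and fK: "\<And>x. x \<in> space M \<Longrightarrow> \<bar>f x\<bar> \<le> K" and t: "0 < t"
  shows "measure (Pi\<^sub>M J (\<lambda>_. M)) {b\<in>space (Pi\<^sub>M J (\<lambda>_. M)). t \<le> (\<Sum>j\<in>J. (f (b j))\<^sup>2)}
    \<le> card J * (\<integral>x. (f x)\<^sup>2 \<partial>M) / t"
proof -
  interpret P: prob_space "Pi\<^sub>M J (\<lambda>_. M)" by (intro prob_space_PiM) (rule prob_space_axioms)
  have b: "\<bar>(f x)\<^sup>2\<bar> \<le> K * K" if "x \<in> space M" for x
    using power_mono[OF fK[OF that], of 2] by (simp add: power2_eq_square)
  have int: "integrable (Pi\<^sub>M J (\<lambda>_. M)) (\<lambda>b. (f (b j))\<^sup>2)" if j: "j \<in> J" for j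
  proof (intro P.integrable_const_bound[where B="K * K"] AE_I2)
    fix x assume "x \<in> space (Pi\<^sub>M J (\<lambda>_. M))"
    then have "x j \<in> space M" using j by (auto simp: space_PiM)
    then show "norm ((f (x j))\<^sup>2) \<le> K * K" using b by auto
  qed (use j in measurable)
  have val: "(\<integral>b. (f (b j))\<^sup>2 \<partial>Pi\<^sub>M J (\<lambda>_. M)) = (\<integral>x. (f x)\<^sup>2 \<partial>M)" if j: "j \<in> J" for j
  proof -
    have "(\<integral>x. (f x)\<^sup>2 \<partial>M) = (\<integral>x. (f x)\<^sup>2 \<partial>distr (Pi\<^sub>M J (\<lambda>_. M)) M (\<lambda>b. b j))"
      using distr_PiM_component[of J "\<lambda>_. M", OF prob_space_axioms j] by simp
    also have "\<dots> = (\<integral>b. (f (b j))\<^sup>2 \<partial>Pi\<^sub>M J (\<lambda>_. M))"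
      using j by (subst integral_distr) auto
    finally show ?thesis by simp
  qed
  have "measure (Pi\<^sub>M J (\<lambda>_. M)) {b\<in>space (Pi\<^sub>M J (\<lambda>_. M)). t \<le> (\<Sum>j\<in>J. (f (b j))\<^sup>2)}
      \<le> (\<integral>b. (\<Sum>j\<in>J. (f (b j))\<^sup>2) \<partial>Pi\<^sub>M J (\<lambda>_. M)) / t"
    using int t by (intro integral_Markov_inequality_measure[where A="{}"]) (auto intro!: sum_nonneg)
  also have "(\<integral>b. (\<Sum>j\<in>J. (f (b j))\<^sup>2) \<partial>Pi\<^sub>M J (\<lambda>_. M)) = card J * (\<integral>x. (f x)\<^sup>2 \<partial>M)"
    using int val by (simp add: Bochner_Integration.integral_sum)
  finally show ?thesis .
qed

text \<open>A sample together with its ghost copy is one point of the product over \<open>I \<times> UNIV\<close>: the coordinates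
  \<open>(i, True)\<close> form the sample and the coordinates \<open>(i, False)\<close> the copy.\<close>

definition flip_pairs :: "'i set \<Rightarrow> 'i set \<Rightarrow> ('i \<times> bool \<Rightarrow> 'b) \<Rightarrow> ('i \<times> bool \<Rightarrow> 'b)" where
  "flip_pairs I T z = (\<lambda>k\<in>I \<times> UNIV. z (fst k, snd k \<noteq> (fst k \<in> T)))"

lemma flip_pairs_apply: "i \<in> I \<Longrightarrow> flip_pairs I T z (i, b) = z (i, b \<noteq> (i \<in> T))"
  by (simp add: flip_pairs_def)

lemma (in prob_space) distr_flip_pairs:
  "distr (Pi\<^sub>M (I \<times> UNIV) (\<lambda>_. M)) (Pi\<^sub>M (I \<times> UNIV) (\<lambda>_. M)) (flip_pairs I T) = Pi\<^sub>M (I \<times> UNIV) (\<lambda>_. M)"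
proof -
  have "inj_on (\<lambda>k. (fst k, snd k \<noteq> (fst k \<in> T))) (I \<times> UNIV)"
    by (auto simp: inj_on_def)
  from distr_PiM_reindex[OF prob_space_axioms this, of "I \<times> UNIV"] show ?thesis
    unfolding flip_pairs_def[abs_def] by (auto simp: Pi_iff)
qed

lemma measurable_flip_pairs [measurable]:
  "flip_pairs I T \<in> measurable (Pi\<^sub>M (I \<times> UNIV) (\<lambda>_. M)) (Pi\<^sub>M (I \<times> UNIV) (\<lambda>_. M))"
  unfolding flip_pairs_def[abs_def] by (intro measurable_restrict measurable_component_singleton) auto

text \<open>Swapping pairs preserves both the product measure and \<open>W\<close>, so the
  probability equals its average over all swaps \<open>T\<close>. Interchanging average and integral
  leaves a counting problem for each fixed \<open>z\<close> in \<open>W\<close>: only the signs are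
  random there, and everything built from the net of \<open>z\<close> is deterministic.\<close>

lemma (in prob_space) prob_le_of_flip_fraction:
  fixes I :: "'i set" and Q W :: "('i \<times> bool \<Rightarrow> 'a) \<Rightarrow> bool" and c :: real
  defines "P \<equiv> Pi\<^sub>M (I \<times> (UNIV :: bool set)) (\<lambda>_. M)"
  assumes I: "finite I" and c: "0 \<le> c"
    and Q[measurable]: "Measurable.pred P Q" and W[measurable]: "Measurable.pred P W"
    and inv: "\<And>T z. T \<subseteq> I \<Longrightarrow> z \<in> space P \<Longrightarrow> W (flip_pairs I T z) = W z"
    and frac: "\<And>z. z \<in> space P \<Longrightarrow> W z \<Longrightarrow> real (card {T\<in>Pow I. Q (flip_pairs I T z)}) \<le> c * 2 ^ card I"
  shows "measure P {z\<in>space P. Q z \<and> W z} \<le> c"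
proof -
  interpret P: prob_space P unfolding P_def by (intro prob_space_PiM) (rule prob_space_axioms)
  have flip[measurable]: "flip_pairs I T \<in> measurable P P" for T unfolding P_def by measurable
  define S where "S T = {z\<in>space P. Q (flip_pairs I T z) \<and> W z}" for T
  have [measurable]: "S T \<in> sets P" for T
    unfolding S_def by measurable
  have ind: "integrable P (indicator (S T) :: _ \<Rightarrow> real)" for T
    by (intro integrable_real_indicator) (simp_all add: P.emeasure_finite less_top[symmetric])
  have eq: "measure P {z\<in>space P. Q z \<and> W z} = measure P (S T)" if T: "T \<subseteq> I" for T
  proof -
    have "measure P {z\<in>space P. Q z \<and> W z} = measure (distr P P (flip_pairs I T)) {z\<in>space P. Q z \<and> W z}"
      unfolding P_def distr_flip_pairs ..
    also have "\<dots> = measure P (flip_pairs I T -` {z\<in>space P. Q z \<and> W z} \<inter> space P)"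
      by (intro measure_distr) measurable
    also have "flip_pairs I T -` {z\<in>space P. Q z \<and> W z} \<inter> space P = S T"
      using inv[OF T] measurable_space[OF flip] by (auto simp: S_def)
    finally show ?thesis .
  qed
  have "2 ^ card I * measure P {z\<in>space P. Q z \<and> W z} = (\<Sum>T\<in>Pow I. measure P (S T))"
  proof -
    have "(\<Sum>T\<in>Pow I. measure P (S T)) = (\<Sum>T\<in>Pow I. measure P {z\<in>space P. Q z \<and> W z})"
      by (intro sum.cong refl eq[symmetric]) auto
    then show ?thesis using I by (simp add: card_Pow)
  qed
  also have "\<dots> = (\<integral>z. (\<Sum>T\<in>Pow I. indicator (S T) z) \<partial>P)"
    by (subst Bochner_Integration.integral_sum) (auto intro: ind)
  also have "\<dots> \<le> (\<integral>z. c * 2 ^ card I \<partial>P)"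
  proof (intro integral_mono)
    fix z assume z: "z \<in> space P"
    have "(\<Sum>T\<in>Pow I. indicator (S T) z) = (\<Sum>T\<in>Pow I. if Q (flip_pairs I T z) \<and> W z then 1 else (0::real))"
      using z by (intro sum.cong) (auto simp: S_def)
    also have "\<dots> = real (card {T\<in>Pow I. Q (flip_pairs I T z) \<and> W z})"
      using I by (simp add: sum.If_cases Int_def)
    also have "\<dots> \<le> c * 2 ^ card I"
      using frac[OF z] c by (cases "W z") auto
    finally show "(\<Sum>T\<in>Pow I. indicator (S T) z) \<le> c * 2 ^ card I" .
  qed (auto intro: ind)
  finally show ?thesis by (simp add: P.prob_space mult.commute)
qed

section \<open>Empirical nets\<close>


text \<open>The radius bounds a sum of squares, that is n times the squared empirical distance.
  Centres are taken from \<open>G\<close> so that they inherit its envelope; moreover the finite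
  subsets of a countable \<open>G\<close> form a countable family, which makes the predicate
  measurable.\<close>

definition has_net :: "'i set \<Rightarrow> ('b \<Rightarrow> real) set \<Rightarrow> nat \<Rightarrow> real \<Rightarrow> ('i \<Rightarrow> 'b) \<Rightarrow> bool" where
  "has_net I G m r x \<longleftrightarrow> (\<exists>C\<in>{C. finite C \<and> C \<subseteq> G}. card C \<le> m \<and>
     (\<forall>f\<in>G. \<exists>c\<in>C. (\<Sum>i\<in>I. (f (x i) - c (x i))\<^sup>2) \<le> r))"

text \<open>Whole pairs are discarded through \<open>J\<close>, and distances add up both members of
  a pair. Both choices make the predicate symmetric in the two halves, hence invariant under
  swaps.\<close>

definition has_pair_net ::
  "'i set \<Rightarrow> ('b \<Rightarrow> real) set \<Rightarrow> nat \<Rightarrow> real \<Rightarrow> nat \<Rightarrow> ('i \<times> bool \<Rightarrow> 'b) \<Rightarrow> bool" where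
  "has_pair_net I G m r k z \<longleftrightarrow> (\<exists>J\<in>Pow I. card J \<le> k \<and> (\<exists>C\<in>{C. finite C \<and> C \<subseteq> G}. card C \<le> m \<and>
     (\<forall>f\<in>G. \<exists>c\<in>C. (\<Sum>i\<in>I-J. (f (z (i, True)) - c (z (i, True)))\<^sup>2 + (f (z (i, False)) - c (z (i, False)))\<^sup>2) \<le> r)))"

lemma pred_has_net:
  assumes "countable G" "G \<subseteq> borel_measurable M"
  shows "Measurable.pred (Pi\<^sub>M I (\<lambda>_. M)) (has_net I G m r)"
proof -
  have [measurable]: "(\<lambda>x. f (x i)) \<in> borel_measurable (Pi\<^sub>M I (\<lambda>_. M))" if "f \<in> G" "i \<in> I" for f i
    using that assms(2) by (intro measurable_compose[OF measurable_component_singleton]) auto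
  have "Measurable.pred (Pi\<^sub>M I (\<lambda>_. M)) (\<lambda>x. (\<Sum>i\<in>I. (f (x i) - c (x i))\<^sup>2) \<le> r)"
    if "f \<in> G" "c \<in> G" for f c
    using that by measurable
  then show ?thesis
    unfolding has_net_def
    by (intro pred_countable_Bex pred_countable_Ball pred_intros_logic countable_Collect_finite_subset assms(1)
        countable_finite) auto
qed

lemma pred_has_pair_net:
  assumes "finite I" "countable G" "G \<subseteq> borel_measurable M"
  shows "Measurable.pred (Pi\<^sub>M (I \<times> UNIV) (\<lambda>_. M)) (has_pair_net I G m r k)"
proof -
  have [measurable]: "(\<lambda>x. f (x (i, b))) \<in> borel_measurable (Pi\<^sub>M (I \<times> UNIV) (\<lambda>_. M))" if "f \<in> G" "i \<in> I" for f i b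
    using that assms(3) by (intro measurable_compose[OF measurable_component_singleton]) auto
  have "Measurable.pred (Pi\<^sub>M (I \<times> UNIV) (\<lambda>_. M)) (\<lambda>z.
      (\<Sum>i\<in>I-J. (f (z (i, True)) - c (z (i, True)))\<^sup>2 + (f (z (i, False)) - c (z (i, False)))\<^sup>2) \<le> r)"
    if "f \<in> G" "c \<in> G" for f c J
    using that by measurable
  then show ?thesis
    unfolding has_pair_net_def
    by (intro pred_countable_Bex pred_countable_Ball pred_intros_logic countable_Collect_finite_subset assms(2)
        countable_finite finite_Pow_iff[THEN iffD2] assms(1)) auto
qed

lemma has_pair_net_mono: "has_pair_net I G m r k z \<Longrightarrow> k \<le> k' \<Longrightarrow> has_pair_net I G m r k' z"
  unfolding has_pair_net_def using order.trans by blast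

lemma has_pair_net_flip: "has_pair_net I G m r k (flip_pairs I T z) = has_pair_net I G m r k z"
proof -
  have "(\<Sum>i\<in>I-J. (f (flip_pairs I T z (i, True)) - c (flip_pairs I T z (i, True)))\<^sup>2
      + (f (flip_pairs I T z (i, False)) - c (flip_pairs I T z (i, False)))\<^sup>2)
    = (\<Sum>i\<in>I-J. (f (z (i, True)) - c (z (i, True)))\<^sup>2 + (f (z (i, False)) - c (z (i, False)))\<^sup>2)"
    for J and f c :: "'b \<Rightarrow> real"
    by (intro sum.cong refl, rename_tac i, case_tac "i \<in> T") (auto simp: flip_pairs_apply)
  then show ?thesis unfolding has_pair_net_def by simp
qed

lemma sum_square_diff_triangle:
  fixes f g h :: "'i \<Rightarrow> real"
  assumes "(\<Sum>i\<in>I. (f i - g i)\<^sup>2) \<le> r" "(\<Sum>i\<in>I. (h i - g i)\<^sup>2) \<le> r"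
  shows "(\<Sum>i\<in>I. (f i - h i)\<^sup>2) \<le> 4 * r"
proof -
  have "(\<Sum>i\<in>I. (f i - h i)\<^sup>2) \<le> (\<Sum>i\<in>I. 2 * (f i - g i)\<^sup>2 + 2 * (h i - g i)\<^sup>2)"
  proof (intro sum_mono)
    fix i
    have "0 \<le> ((f i - g i) + (h i - g i))\<^sup>2" by simp
    then show "(f i - h i)\<^sup>2 \<le> 2 * (f i - g i)\<^sup>2 + 2 * (h i - g i)\<^sup>2"
      by (simp add: power2_eq_square algebra_simps)
  qed
  also have "\<dots> = 2 * (\<Sum>i\<in>I. (f i - g i)\<^sup>2) + 2 * (\<Sum>i\<in>I. (h i - g i)\<^sup>2)"
    by (simp add: sum.distrib sum_distrib_left)
  finally show ?thesis using assms by linarith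
qed

text \<open>Outside the exceptional coordinates every point of the pair sample is a point of one of four
  samples with a net, so distances are dominated by the sum of four distances. The classes of functions
  with the same four nearest centres then have small diameter.\<close>

lemma has_pair_net_of_two_points:
  fixes G :: "('b \<Rightarrow> real) set"
  assumes I: "finite I"
    and y: "\<And>b. has_net I G m r (\<lambda>i. y (i, b))" and y': "\<And>b. has_net I G m r (\<lambda>i. y' (i, b))"
  shows "has_pair_net I G (m ^ 4) (16 * r) (card {k\<in>I \<times> UNIV. z k \<noteq> y k \<and> z k \<noteq> y' k}) z"
proof -
  \<comment> \<open>A pair is discarded as soon as one of its two members is uncovered. Projecting
    to the index of the pair cannot increase the cardinality, so the mismatch count still bounds
    it.\<close>
  define J where "J = fst ` {k\<in>I \<times> (UNIV::bool set). z k \<noteq> y k \<and> z k \<noteq> y' k}"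
  have "finite {k\<in>I \<times> (UNIV::bool set). z k \<noteq> y k \<and> z k \<noteq> y' k}"
    using I by (auto intro: finite_subset[of _ "I \<times> UNIV"])
  then have cJ: "card J \<le> card {k\<in>I \<times> (UNIV::bool set). z k \<noteq> y k \<and> z k \<noteq> y' k}"
    unfolding J_def by (rule card_image_le)
  have JI: "J \<subseteq> I" by (auto simp: J_def)
  have outside: "z (i, b) = y (i, b) \<or> z (i, b) = y' (i, b)" if "i \<in> I - J" for i b
    using that by (force simp: J_def)
  define Y where "Y j = (if fst j then y else y')" for j :: "bool \<times> bool"
  have Y: "has_net I G m r (\<lambda>i. Y j (i, snd j))" for j using y[of "snd j"] y'[of "snd j"] by (cases "fst j") (simp_all add: Y_def)
  define D where "D j f c = (\<Sum>i\<in>I. (f (Y j (i, snd j)) - c (Y j (i, snd j)))\<^sup>2)" for j and f c :: "'b \<Rightarrow> real"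
  define C where "C j = (SOME C. finite C \<and> C \<subseteq> G \<and> card C \<le> m \<and> (\<forall>f\<in>G. \<exists>c\<in>C. D j f c \<le> r))" for j
  have "finite (C j) \<and> C j \<subseteq> G \<and> card (C j) \<le> m \<and> (\<forall>f\<in>G. \<exists>c\<in>C j. D j f c \<le> r)" for j
    unfolding C_def by (rule someI_ex) (use Y[of j] in \<open>auto simp: has_net_def D_def\<close>)
  then have C: "\<And>j. finite (C j)" "\<And>j. C j \<subseteq> G" "\<And>j. card (C j) \<le> m"
    and Cnear: "\<And>j. \<forall>f\<in>G. \<exists>c\<in>C j. D j f c \<le> r" by auto
  define \<phi> where "\<phi> j f = (SOME c. c \<in> C j \<and> D j f c \<le> r)" for j f
  have "\<phi> j f \<in> C j \<and> D j f (\<phi> j f) \<le> r" if "f \<in> G" for j f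
    unfolding \<phi>_def by (rule someI_ex[of "\<lambda>c. c \<in> C j \<and> D j f c \<le> r"]) (use Cnear[of j] that in auto)
  then have \<phi>: "\<And>j f. f \<in> G \<Longrightarrow> \<phi> j f \<in> C j"
    "\<And>j f. f \<in> G \<Longrightarrow> (\<Sum>i\<in>I. (f (Y j (i, snd j)) - \<phi> j f (Y j (i, snd j)))\<^sup>2) \<le> r"
    unfolding D_def by auto
  define \<Phi> where "\<Phi> f = (\<lambda>j. \<phi> j f)" for f
  define rep where "rep p = (SOME g. g \<in> G \<and> \<Phi> g = p)" for p
  have rep: "rep (\<Phi> f) \<in> G \<and> \<Phi> (rep (\<Phi> f)) = \<Phi> f" if "f \<in> G" for f
    unfolding rep_def by (rule someI[of _ f]) (use that in auto)
  define N where "N = rep ` (\<Phi> ` G)"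
  have sub: "\<Phi> ` G \<subseteq> Pi\<^sub>E UNIV C" using \<phi>(1) by (auto simp: \<Phi>_def)
  have finP: "finite (Pi\<^sub>E (UNIV :: (bool \<times> bool) set) C)" using C by (intro finite_PiE) auto
  have "card N \<le> card (\<Phi> ` G)" unfolding N_def using finite_subset[OF sub finP] by (rule card_image_le)
  also have "\<dots> \<le> card (Pi\<^sub>E (UNIV :: (bool \<times> bool) set) C)" by (rule card_mono[OF finP sub])
  also have "\<dots> = (\<Prod>j\<in>UNIV. card (C j))" by (simp add: card_PiE)
  also have "\<dots> \<le> (\<Prod>j\<in>(UNIV :: (bool \<times> bool) set). m)" using C by (intro prod_mono) auto
  also have "\<dots> = m ^ 4" by (simp add: card_UNIV_bool flip: UNIV_Times_UNIV)
  finally have cN: "card N \<le> m ^ 4" .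
  have fN: "finite N" unfolding N_def using finite_subset[OF sub finP] by auto
  have NG: "N \<subseteq> G" using rep by (auto simp: N_def)
  have near: "\<exists>c\<in>N. (\<Sum>i\<in>I-J. (f (z (i, True)) - c (z (i, True)))\<^sup>2 + (f (z (i, False)) - c (z (i, False)))\<^sup>2) \<le> 16 * r"
    if f: "f \<in> G" for f
  proof
    define c where "c = rep (\<Phi> f)"
    show "rep (\<Phi> f) \<in> N" using f by (auto simp: N_def)
    have cG: "c \<in> G" "\<And>j. \<phi> j c = \<phi> j f" using rep[OF f] by (auto simp: c_def \<Phi>_def fun_eq_iff)
    define d where "d j i = (f (Y j (i, snd j)) - c (Y j (i, snd j)))\<^sup>2" for j i
    have d: "(\<Sum>i\<in>I. d j i) \<le> 4 * r" for j
      unfolding d_def using \<phi>(2)[OF f, of j] \<phi>(2)[OF cG(1), of j] unfolding cG(2)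
      by (rule sum_square_diff_triangle)
    have dn: "0 \<le> d j i" for j i by (simp add: d_def)
    have pt: "(f (z (i, b)) - c (z (i, b)))\<^sup>2 \<le> d (True, b) i + d (False, b) i" if "i \<in> I - J" for i b
      using outside[OF that, of b] dn[of "(True, b)" i] dn[of "(False, b)" i] by (auto simp: d_def Y_def)
    have "(\<Sum>i\<in>I-J. (f (z (i, True)) - c (z (i, True)))\<^sup>2 + (f (z (i, False)) - c (z (i, False)))\<^sup>2)
        \<le> (\<Sum>i\<in>I-J. d (True, True) i + d (False, True) i + (d (True, False) i + d (False, False) i))"
      by (intro sum_mono add_mono pt)
    also have "\<dots> \<le> (\<Sum>i\<in>I. d (True, True) i + d (False, True) i + (d (True, False) i + d (False, False) i))"
      using I dn by (intro sum_mono2) (auto intro!: add_nonneg_nonneg)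
    \<comment> \<open>There are four samples, and in each of them \<open>f\<close> and its
      representative share a centre, so they are at squared distance at most
      \<open>4 * r\<close>.\<close>
    also have "\<dots> \<le> 16 * r"
      using d[of "(True, True)"] d[of "(True, False)"] d[of "(False, True)"] d[of "(False, False)"]
      by (simp add: sum.distrib)
    finally show "(\<Sum>i\<in>I-J. (f (z (i, True)) - rep (\<Phi> f) (z (i, True)))\<^sup>2 + (f (z (i, False)) - rep (\<Phi> f) (z (i, False)))\<^sup>2) \<le> 16 * r"
      by (simp add: c_def)
  qed
  show ?thesis
    unfolding has_pair_net_def using JI cJ fN NG cN near by blast
qed

lemma (in prob_space) distr_pair_component:
  "distr (Pi\<^sub>M (I \<times> UNIV) (\<lambda>_. M)) (Pi\<^sub>M I (\<lambda>_. M)) (\<lambda>z. \<lambda>i\<in>I. z (i, b :: bool)) = Pi\<^sub>M I (\<lambda>_. M)"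
  using distr_PiM_reindex[OF prob_space_axioms, where f="\<lambda>i. (i, b)" and I=I and K="I \<times> UNIV"]
  by (auto simp: inj_on_def)

text \<open>Both halves are good with probability at least 3/4, and (3/4)^2 \<ge> 1/2, so the
  two-point inequality with both sets equal to this event bounds the integral of
  \<open>2 ^ h\<close> by 2. Markov's inequality at \<open>2 ^ (k + 1)\<close> then gives exactly
  \<open>(1/2) ^ k\<close>.\<close>

lemma (in prob_space) prob_no_pair_net_le:
  fixes G :: "('a \<Rightarrow> real) set" and I :: "'i set"
  assumes I: "finite I" and G: "countable G" "G \<subseteq> borel_measurable M"
    and good: "7/8 \<le> measure (Pi\<^sub>M I (\<lambda>_. M)) {x\<in>space (Pi\<^sub>M I (\<lambda>_. M)). has_net I G m r x}"
  shows "measure (Pi\<^sub>M (I \<times> UNIV) (\<lambda>_. M))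
    {z\<in>space (Pi\<^sub>M (I \<times> UNIV) (\<lambda>_. M)). \<not> has_pair_net I G (m ^ 4) (16 * r) k z} \<le> (1/2) ^ k"
proof -
  define P where "P = Pi\<^sub>M (I \<times> (UNIV :: bool set)) (\<lambda>_. M)"
  interpret P: prob_space P unfolding P_def by (intro prob_space_PiM) (rule prob_space_axioms)
  interpret PI: prob_space "Pi\<^sub>M I (\<lambda>_. M)" by (intro prob_space_PiM) (rule prob_space_axioms)
  have net[measurable]: "Measurable.pred (Pi\<^sub>M I (\<lambda>_. M)) (has_net I G m r)"
    by (rule pred_has_net[OF G])
  have proj[measurable]: "(\<lambda>z. \<lambda>i\<in>I. z (i, b)) \<in> measurable P (Pi\<^sub>M I (\<lambda>_. M))" for b
    unfolding P_def by (intro measurable_restrict measurable_component_singleton) auto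
  have restrict: "has_net I G m r (\<lambda>i\<in>I. z (i, b)) = has_net I G m r (\<lambda>i. z (i, b))" for z and b :: bool
    by (simp add: has_net_def)
  have net2[measurable]: "Measurable.pred P (\<lambda>z. has_net I G m r (\<lambda>i. z (i, b)))" for b
    using measurable_compose[OF proj net, of b] by (simp add: restrict)
  have pn[measurable]: "Measurable.pred P (has_pair_net I G (m ^ 4) (16 * r) j)" for j
    unfolding P_def by (rule pred_has_pair_net[OF I G])
  have bad: "measure P {z\<in>space P. \<not> has_net I G m r (\<lambda>i. z (i, b))} \<le> 1/8" for b
  proof -
    have "measure P {z\<in>space P. \<not> has_net I G m r (\<lambda>i. z (i, b))}
       = measure (distr P (Pi\<^sub>M I (\<lambda>_. M)) (\<lambda>z. \<lambda>i\<in>I. z (i, b))) {x\<in>space (Pi\<^sub>M I (\<lambda>_. M)). \<not> has_net I G m r x}"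
      using measurable_space[OF proj, of _ b]
      by (subst measure_distr) (auto intro!: arg_cong[where f="measure P"] simp: restrict)
    also have "\<dots> = 1 - measure (Pi\<^sub>M I (\<lambda>_. M)) {x\<in>space (Pi\<^sub>M I (\<lambda>_. M)). has_net I G m r x}"
      unfolding P_def distr_pair_component by (subst PI.prob_neg) auto
    finally show ?thesis using good by simp
  qed
  define A where "A = {z\<in>space P. \<forall>b. has_net I G m r (\<lambda>i. z (i, b))}"
  have A[measurable]: "A \<in> sets P" unfolding A_def by measurable
  have pA: "3/4 \<le> measure P A"
  proof -
    have "space P - A \<subseteq> {z\<in>space P. \<not> has_net I G m r (\<lambda>i. z (i, True))} \<union> {z\<in>space P. \<not> has_net I G m r (\<lambda>i. z (i, False))}"
      unfolding A_def by (auto, metis (full_types))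
    then have "measure P (space P - A) \<le> measure P ({z\<in>space P. \<not> has_net I G m r (\<lambda>i. z (i, True))} \<union> {z\<in>space P. \<not> has_net I G m r (\<lambda>i. z (i, False))})"
      by (intro P.finite_measure_mono) measurable
    also have "\<dots> \<le> 1/8 + 1/8"
      using bad by (intro order.trans[OF measure_Un_le] add_mono) measurable
    finally show ?thesis by (simp add: P.prob_compl)
  qed
  \<comment> \<open>The least number of pairs to discard is used in place of the distance to the
    good set: it is measurable, being defined from countably many measurable conditions, and
    \<open>two\<close> shows that it lies below the mismatch count for any two good points.\<close>
  define h where "h z = (LEAST j. has_pair_net I G (m ^ 4) (16 * r) j z)" for z
  have h[measurable]: "h \<in> measurable P (count_space UNIV)" unfolding h_def by measurable
  have two: "has_pair_net I G (m ^ 4) (16 * r) (card {j\<in>I \<times> UNIV. z j \<noteq> y j \<and> z j \<noteq> y' j}) z"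
    if "y \<in> A" "y' \<in> A" for z y y'
    using that by (intro has_pair_net_of_two_points I) (auto simp: A_def)
  have "A \<noteq> {}" using pA by auto
  then obtain y0 where y0: "y0 \<in> A" by auto
  have "(\<integral>\<^sup>+z. 2 ^ h z \<partial>P) * emeasure P A * emeasure P A \<le> 1"
    unfolding P_def
  proof (rule talagrand_two_points[OF prob_space_axioms])
    fix x y y' assume "y \<in> A" "y' \<in> A"
    then show "h x \<le> card {i \<in> I \<times> UNIV. x i \<noteq> y i \<and> x i \<noteq> y' i}"
      unfolding h_def by (intro Least_le two)
  qed (use I A h in \<open>auto simp: P_def\<close>)
  moreover have "ennreal (1/2) \<le> emeasure P A * emeasure P A"
  proof -
    have "ennreal (1/2) \<le> ennreal (3/4 * (3/4))" by (rule ennreal_leI) simp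
    also have "\<dots> \<le> ennreal (measure P A * measure P A)" using pA by (intro ennreal_leI mult_mono) auto
    finally show ?thesis by (simp add: P.emeasure_eq_measure ennreal_mult)
  qed
  ultimately have H: "(\<integral>\<^sup>+z. 2 ^ h z \<partial>P) * ennreal (1/2) \<le> 1"
    by (metis (no_types, lifting) mult.assoc mult_left_mono order.trans zero_le)
  have "{z\<in>space P. \<not> has_pair_net I G (m ^ 4) (16 * r) k z} \<subseteq> {z\<in>space P. 1 \<le> ennreal ((1/2) ^ (k + 1)) * 2 ^ h z}"
  proof safe
    fix z assume z: "\<not> has_pair_net I G (m ^ 4) (16 * r) k z"
    have "has_pair_net I G (m ^ 4) (16 * r) (h z) z"
      unfolding h_def using two[OF y0 y0] by (rule LeastI)
    then have "k + 1 \<le> h z" using z has_pair_net_mono by (metis not_less_eq_eq Suc_eq_plus1)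
    then have "(2::real) ^ (k + 1) \<le> 2 ^ h z" by (intro power_increasing) auto
    then have "1 \<le> (1/2) ^ (k + 1) * (2::real) ^ h z" by (simp add: power_divide field_simps)
    then have "ennreal 1 \<le> ennreal ((1/2) ^ (k + 1) * (2::real) ^ h z)" by (rule ennreal_leI)
    also have "\<dots> = ennreal ((1/2) ^ (k + 1)) * ennreal (2 ^ h z)" by (rule ennreal_mult) auto
    also have "ennreal (2 ^ h z) = 2 ^ h z" by (simp flip: ennreal_power)
    finally show "1 \<le> ennreal ((1/2) ^ (k + 1)) * 2 ^ h z" by simp
  qed
  then have "emeasure P {z\<in>space P. \<not> has_pair_net I G (m ^ 4) (16 * r) k z}
      \<le> emeasure P {z\<in>space P. 1 \<le> ennreal ((1/2) ^ (k + 1)) * 2 ^ h z}"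
    by (intro emeasure_mono) auto
  also have "\<dots> \<le> ennreal ((1/2) ^ (k + 1)) * (\<integral>\<^sup>+z. 2 ^ h z * indicator (space P) z \<partial>P)"
    by (rule nn_integral_Markov_inequality) auto
  also have "(\<integral>\<^sup>+z. 2 ^ h z * indicator (space P) z \<partial>P) = (\<integral>\<^sup>+z. 2 ^ h z \<partial>P)"
    by (intro nn_integral_cong) auto
  also have "ennreal ((1/2) ^ (k + 1)) * (\<integral>\<^sup>+z. 2 ^ h z \<partial>P) = ennreal ((1/2) ^ k) * ((\<integral>\<^sup>+z. 2 ^ h z \<partial>P) * ennreal (1/2))"
  proof -
    have "ennreal ((1/2) ^ (k + 1)) = ennreal ((1/2) ^ k) * ennreal (1/2)"
      by (subst ennreal_mult[symmetric]) auto
    then show ?thesis by (simp only: ac_simps)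
  qed
  also have "\<dots> \<le> ennreal ((1/2) ^ k)" using mult_left_mono[OF H, of "ennreal ((1/2) ^ k)"] by simp
  finally show ?thesis unfolding P_def[symmetric]
    by (simp add: P.emeasure_eq_measure ennreal_le_iff)
qed

section \<open>Uniform deviation bounds\<close>


text \<open>For a function that violates the bound on the first half, an independent ghost half is
  typical with conditional probability at least 1/2: Chebyshev's inequality loses 1/4 for its sum,
  and Markov's inequality loses 1/4 for its sum of squares. The second condition is kept in the
  conclusion because it supplies the variance bound in the swap argument.\<close>

lemma (in prob_space) prob_deviation_le_ghost:
  fixes G :: "('a \<Rightarrow> real) set" and I :: "'i set" and a t V :: "('a \<Rightarrow> real) \<Rightarrow> real"
  assumes I: "finite I" and G: "countable G" "G \<subseteq> borel_measurable M"
    and GK: "\<And>f x. f \<in> G \<Longrightarrow> x \<in> space M \<Longrightarrow> \<bar>f x\<bar> \<le> K"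
    and t: "\<And>f. f \<in> G \<Longrightarrow> 0 < t f" "\<And>f. f \<in> G \<Longrightarrow> 4 * (card I * (\<integral>x. (f x)\<^sup>2 \<partial>M)) \<le> (t f)\<^sup>2"
    and V: "\<And>f. f \<in> G \<Longrightarrow> 0 < V f" "\<And>f. f \<in> G \<Longrightarrow> card I * (\<integral>x. (f x)\<^sup>2 \<partial>M) \<le> V f"
  shows "measure (Pi\<^sub>M I (\<lambda>_. M)) {x\<in>space (Pi\<^sub>M I (\<lambda>_. M)).
      \<exists>f\<in>G. a f + t f < \<bar>(\<Sum>i\<in>I. f (x i)) - card I * (\<integral>x. f x \<partial>M)\<bar>}
    \<le> 2 * measure (Pi\<^sub>M (I \<times> UNIV) (\<lambda>_. M)) {z\<in>space (Pi\<^sub>M (I \<times> UNIV) (\<lambda>_. M)).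
      \<exists>f\<in>G. a f < \<bar>\<Sum>i\<in>I. f (z (i, True)) - f (z (i, False))\<bar> \<and> (\<Sum>i\<in>I. (f (z (i, False)))\<^sup>2) \<le> 4 * V f}"
proof -
  define P where "P = Pi\<^sub>M (I \<times> (UNIV :: bool set)) (\<lambda>_. M)"
  define PI where "PI = Pi\<^sub>M I (\<lambda>_. M)"
  define J1 where "J1 = I \<times> {True}"
  define J2 where "J2 = I \<times> {False}"
  define P1 where "P1 = Pi\<^sub>M J1 (\<lambda>_. M)"
  define P2 where "P2 = Pi\<^sub>M J2 (\<lambda>_. M)"
  interpret product_sigma_finite "\<lambda>_. M" by unfold_locales
  interpret P: prob_space P unfolding P_def by (intro prob_space_PiM) (rule prob_space_axioms)
  interpret PI: prob_space PI unfolding PI_def by (intro prob_space_PiM) (rule prob_space_axioms)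
  interpret P1: prob_space P1 unfolding P1_def by (intro prob_space_PiM) (rule prob_space_axioms)
  interpret P2: prob_space P2 unfolding P2_def by (intro prob_space_PiM) (rule prob_space_axioms)
  have J: "J1 \<inter> J2 = {}" "finite J1" "finite J2" "J1 \<union> J2 = I \<times> UNIV" "card J2 = card I"
    using I by (auto simp: J1_def J2_def card_cartesian_product)
  define Q where "Q z \<longleftrightarrow> (\<exists>f\<in>G. a f < \<bar>\<Sum>i\<in>I. f (z (i, True)) - f (z (i, False))\<bar> \<and> (\<Sum>i\<in>I. (f (z (i, False)))\<^sup>2) \<le> 4 * V f)"
    for z :: "'i \<times> bool \<Rightarrow> 'a"
  define B where "B x \<longleftrightarrow> (\<exists>f\<in>G. a f + t f < \<bar>(\<Sum>i\<in>I. f (x i)) - card I * (\<integral>x. f x \<partial>M)\<bar>)" for x :: "'i \<Rightarrow> 'a"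
  have Qm[measurable]: "Measurable.pred P Q"
  proof -
    have [measurable]: "(\<lambda>z. f (z (i, b))) \<in> borel_measurable P" if "f \<in> G" "i \<in> I" for f i b
      unfolding P_def using that G(2) by (intro measurable_compose[OF measurable_component_singleton]) auto
    show ?thesis unfolding Q_def by (intro pred_countable_Bex G(1)) measurable
  qed
  have Bm[measurable]: "Measurable.pred PI B"
  proof -
    have [measurable]: "(\<lambda>z. f (z i)) \<in> borel_measurable PI" if "f \<in> G" "i \<in> I" for f i
      unfolding PI_def using that G(2) by (intro measurable_compose[OF measurable_component_singleton]) auto
    show ?thesis unfolding B_def by (intro pred_countable_Bex G(1)) measurable
  qed
  have merge[measurable]: "merge J1 J2 \<in> measurable (P1 \<Otimes>\<^sub>M P2) P"
    unfolding P1_def P2_def P_def J(4)[symmetric] by (rule measurable_merge)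
  have res[measurable]: "(\<lambda>u. \<lambda>i\<in>I. u (i, True)) \<in> measurable P1 PI"
    unfolding P1_def PI_def by (intro measurable_restrict measurable_component_singleton) (auto simp: J1_def)
  have resB: "B (\<lambda>i\<in>I. u (i, True)) = B (\<lambda>i. u (i, True))" for u :: "'i \<times> bool \<Rightarrow> 'a"
    by (simp add: B_def)
  \<comment> \<open>The violating \<open>f\<close> may depend on \<open>u\<close>, but it stays
    fixed while \<open>w\<close> is integrated. Bounding the inner integral for each
    \<open>u\<close> separately avoids a measurable selection of \<open>f\<close>.\<close>
  have inner: "(1/2) * indicator {u\<in>space P1. B (\<lambda>i. u (i, True))} u \<le> (\<integral>\<^sup>+w. indicator {z\<in>space P. Q z} (merge J1 J2 (u, w)) \<partial>P2)"
    if u: "u \<in> space P1" for u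
  proof (cases "B (\<lambda>i. u (i, True))")
    case True
    then obtain f where f: "f \<in> G" and fB: "a f + t f < \<bar>(\<Sum>i\<in>I. f (u (i, True))) - card I * (\<integral>x. f x \<partial>M)\<bar>"
      by (auto simp: B_def)
    have fm[measurable]: "f \<in> borel_measurable M" using f G by auto
    have fwm: "(\<lambda>w. f (w j)) \<in> borel_measurable P2" if "j \<in> J2" for j
      unfolding P2_def using that by measurable
    have sum2: "(\<Sum>j\<in>J2. g (w j)) = (\<Sum>i\<in>I. g (w (i, False)))" for g :: "'a \<Rightarrow> real" and w
    proof -
      have "J2 = (\<lambda>i. (i, False)) ` I" by (auto simp: J2_def)
      then show ?thesis by (simp add: sum.reindex inj_on_def)
    qed
    define E1 where "E1 = {w\<in>space P2. t f \<le> \<bar>(\<Sum>j\<in>J2. f (w j)) - card J2 * (\<integral>x. f x \<partial>M)\<bar>}"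
    define E2 where "E2 = {w\<in>space P2. 4 * V f \<le> (\<Sum>j\<in>J2. (f (w j))\<^sup>2)}"
    have [measurable]: "E1 \<in> sets P2" "E2 \<in> sets P2"
      unfolding E1_def E2_def using fwm by measurable
    have "measure P2 E1 \<le> card J2 * (\<integral>x. (f x)\<^sup>2 \<partial>M) / (t f)\<^sup>2"
      unfolding E1_def P2_def by (intro PiM_sum_deviation[OF J(3) fm GK[OF f] t(1)[OF f]])
    also have "\<dots> \<le> 1/4" using t[OF f] by (simp add: J(5) pos_divide_le_eq)
    finally have p1: "measure P2 E1 \<le> 1/4" .
    have "measure P2 E2 \<le> card J2 * (\<integral>x. (f x)\<^sup>2 \<partial>M) / (4 * V f)"
      unfolding E2_def P2_def using V(1)[OF f] by (intro PiM_sum_square_tail[OF J(3) fm GK[OF f]]) auto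
    also have "\<dots> \<le> 1/4" using V[OF f] by (simp add: J(5) pos_divide_le_eq)
    finally have p2: "measure P2 E2 \<le> 1/4" .
    have "measure P2 (E1 \<union> E2) \<le> 1/2"
      using p1 p2 by (intro order.trans[OF measure_Un_le]) auto
    then have "1/2 \<le> measure P2 (space P2 - (E1 \<union> E2))"
      by (subst P2.prob_compl) auto
    then have "ennreal (1/2) \<le> emeasure P2 (space P2 - (E1 \<union> E2))"
      unfolding P2.emeasure_eq_measure by (rule ennreal_leI)
    also have "\<dots> = (\<integral>\<^sup>+w. indicator (space P2 - (E1 \<union> E2)) w \<partial>P2)" by simp
    also have "\<dots> \<le> (\<integral>\<^sup>+w. indicator {z\<in>space P. Q z} (merge J1 J2 (u, w)) \<partial>P2)"
    proof (intro nn_integral_mono)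
      fix w assume w: "w \<in> space P2"
      have mT: "merge J1 J2 (u, w) (i, True) = u (i, True)" if "i \<in> I" for i
        using that by (simp add: merge_def J1_def)
      have mF: "merge J1 J2 (u, w) (i, False) = w (i, False)" if "i \<in> I" for i
        using that by (simp add: merge_def J1_def J2_def)
      have "Q (merge J1 J2 (u, w))" if "w \<notin> E1" "w \<notin> E2"
        unfolding Q_def
      proof (intro bexI[OF _ f] conjI)
        have "\<bar>(\<Sum>i\<in>I. f (w (i, False))) - card I * (\<integral>x. f x \<partial>M)\<bar> < t f"
          using that(1) w by (simp add: E1_def J(5) sum2[of f])
        then show "a f < \<bar>\<Sum>i\<in>I. f (merge J1 J2 (u, w) (i, True)) - f (merge J1 J2 (u, w) (i, False))\<bar>"
          using fB by (simp add: mT mF sum_subtractf)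
        show "(\<Sum>i\<in>I. (f (merge J1 J2 (u, w) (i, False)))\<^sup>2) \<le> 4 * V f"
          using that(2) w by (simp add: E2_def mF sum2[of "\<lambda>x. (f x)\<^sup>2"])
      qed
      moreover have "merge J1 J2 (u, w) \<in> space P"
        using measurable_space[OF merge, of "(u, w)"] u w by (simp add: space_pair_measure)
      ultimately show "indicator (space P2 - (E1 \<union> E2)) w \<le> (indicator {z\<in>space P. Q z} (merge J1 J2 (u, w)) :: ennreal)"
        by (auto simp: indicator_def)
    qed
    finally show ?thesis using True u by (simp add: ennreal_divide_numeral divide_ennreal_def)
  qed auto
  have "measure PI {x\<in>space PI. B x} = measure P1 {u\<in>space P1. B (\<lambda>i. u (i, True))}"
  proof -
    have "distr P1 PI (\<lambda>u. \<lambda>i\<in>I. u (i, True)) = PI"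
      unfolding P1_def PI_def
      using distr_PiM_reindex[OF prob_space_axioms, where f="\<lambda>i. (i, True)" and I=I and K=J1]
      by (auto simp: inj_on_def J1_def)
    then have "measure PI {x\<in>space PI. B x} = measure (distr P1 PI (\<lambda>u. \<lambda>i\<in>I. u (i, True))) {x\<in>space PI. B x}"
      by simp
    also have "\<dots> = measure P1 ((\<lambda>u. \<lambda>i\<in>I. u (i, True)) -` {x\<in>space PI. B x} \<inter> space P1)"
      by (intro measure_distr) measurable
    also have "(\<lambda>u. \<lambda>i\<in>I. u (i, True)) -` {x\<in>space PI. B x} \<inter> space P1 = {u\<in>space P1. B (\<lambda>i. u (i, True))}"
      using measurable_space[OF res] by (auto simp: resB)
    finally show ?thesis .
  qed
  moreover have "(1/2) * emeasure P1 {u\<in>space P1. B (\<lambda>i. u (i, True))} \<le> emeasure P {z\<in>space P. Q z}"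
  proof -
    have B1[measurable]: "{u\<in>space P1. B (\<lambda>i. u (i, True))} \<in> sets P1"
      using measurable_compose[OF res Bm] by (simp add: resB pred_def)
    have "(1/2) * emeasure P1 {u\<in>space P1. B (\<lambda>i. u (i, True))}
        = (\<integral>\<^sup>+u. (1/2) * indicator {u\<in>space P1. B (\<lambda>i. u (i, True))} u \<partial>P1)"
      by (subst nn_integral_cmult) auto
    also have "\<dots> \<le> (\<integral>\<^sup>+u. (\<integral>\<^sup>+w. indicator {z\<in>space P. Q z} (merge J1 J2 (u, w)) \<partial>P2) \<partial>P1)"
      by (intro nn_integral_mono inner)
    also have "\<dots> = (\<integral>\<^sup>+z. indicator {z\<in>space P. Q z} z \<partial>P)"
      using product_nn_integral_fold[OF J(1-3), of "indicator {z\<in>space P. Q z}"] Qm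
      unfolding J(4) P_def[symmetric] P1_def[symmetric] P2_def[symmetric] by simp
    finally show ?thesis by simp
  qed
  then have "(1/2) * measure P1 {u\<in>space P1. B (\<lambda>i. u (i, True))} \<le> measure P {z\<in>space P. Q z}"
  proof -
    assume *: "(1/2) * emeasure P1 {u\<in>space P1. B (\<lambda>i. u (i, True))} \<le> emeasure P {z\<in>space P. Q z}"
    have "(1/2 :: ennreal) = ennreal (1/2)" by (simp add: ennreal_divide_numeral divide_ennreal_def)
    then show ?thesis using *
      by (simp only: P.emeasure_eq_measure P1.emeasure_eq_measure) (subst (asm) ennreal_mult[symmetric], auto)
  qed
  ultimately show ?thesis unfolding P_def PI_def Q_def B_def by simp
qed

text \<open>With \<open>z\<close> fixed the centres are fixed as well, so a union bound over the net
  suffices. Each centre \<open>c\<close> excludes two families of sign patterns, one for the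
  differences of \<open>c\<close> and one for those of its square; each has a fraction at most
  \<open>2 * exp (- L)\<close>, whence the factor 4.\<close>

lemma (in prob_space) card_flips_le_of_pair_net:
  fixes G :: "('a \<Rightarrow> real) set" and I :: "'i set"
  assumes I: "finite I" and K: "0 \<le> K" and L: "0 < L" and r: "0 \<le> r"
    and GK: "\<And>f x. f \<in> G \<Longrightarrow> x \<in> space M \<Longrightarrow> \<bar>f x\<bar> \<le> K"
    and z: "z \<in> space (Pi\<^sub>M (I \<times> UNIV) (\<lambda>_. M))" and net: "has_pair_net I G N r k z"
    and a: "\<And>f. f \<in> G \<Longrightarrow>
      2 * real k * K + sqrt (2 * real (card I) * r) + sqrt (4 * L * (8 * s f + 8 * r + 2 * L * K\<^sup>2)) \<le> a f"
  shows "real (card {T\<in>Pow I. \<exists>f\<in>G.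
      a f < \<bar>\<Sum>i\<in>I. f (flip_pairs I T z (i, True)) - f (flip_pairs I T z (i, False))\<bar> \<and>
      (\<Sum>i\<in>I. (f (flip_pairs I T z (i, False)))\<^sup>2) \<le> s f}) \<le> real N * (4 * exp (- L)) * 2 ^ card I"
proof -
  obtain J C where J: "J \<subseteq> I" "card J \<le> k" and C: "finite C" "C \<subseteq> G" "card C \<le> N"
    and near: "\<And>f. f \<in> G \<Longrightarrow> \<exists>c\<in>C. (\<Sum>i\<in>I-J. (f (z (i, True)) - c (z (i, True)))\<^sup>2 + (f (z (i, False)) - c (z (i, False)))\<^sup>2) \<le> r"
    using net unfolding has_pair_net_def by blast
  \<comment> \<open>Discarded pairs get coefficient 0 instead of being dropped from the index set,
    so that all patterns are counted in the same \<open>Pow I\<close>. The squares of these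
    coefficients are unaffected by swaps, so the threshold in \<open>bad\<close> is the same for
    every \<open>T\<close>.\<close>
  define d where "d c i = (if i \<in> J then 0 else c (z (i, True)) - c (z (i, False)))" for c :: "'a \<Rightarrow> real" and i
  define e where "e c = d (\<lambda>x. (c x)\<^sup>2)" for c :: "'a \<Rightarrow> real"
  define bad where "bad v = {T\<in>Pow I. sqrt (2 * L * (\<Sum>i\<in>I. (v i)\<^sup>2)) < \<bar>signed_sum I T v\<bar>}" for v
  let ?w = "\<lambda>T. flip_pairs I T z"
  have ss: "signed_sum I T (d c) = (\<Sum>i\<in>I-J. c (?w T (i, True)) - c (?w T (i, False)))" for T c
    unfolding signed_sum_def using I J(1)
    by (intro sum.mono_neutral_cong_right) (auto simp: d_def flip_pairs_apply)
  have sq: "(\<Sum>i\<in>I. (d c i)\<^sup>2) = (\<Sum>i\<in>I-J. (c (?w T (i, True)) - c (?w T (i, False)))\<^sup>2)" for T c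
    using I J(1)
    by (intro sum.mono_neutral_cong_right)
       (auto simp: d_def flip_pairs_apply, rename_tac i, case_tac "i \<in> T", auto simp: power2_commute)
  have wK: "\<bar>f (?w T (i, b))\<bar> \<le> K" if "f \<in> G" "i \<in> I" for f T i b
  proof -
    have "z (i, b \<noteq> (i \<in> T)) \<in> space M" using z that(2) by (auto simp: space_PiM)
    then show ?thesis using GK[OF that(1)] that(2) by (simp add: flip_pairs_apply)
  qed
  have sub: "{T\<in>Pow I. \<exists>f\<in>G. a f < \<bar>\<Sum>i\<in>I. f (?w T (i, True)) - f (?w T (i, False))\<bar> \<and>
      (\<Sum>i\<in>I. (f (?w T (i, False)))\<^sup>2) \<le> s f} \<subseteq> (\<Union>c\<in>C. bad (d c) \<union> bad (e c))"
  proof (rule subsetI, rule ccontr)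
    fix T
    assume T: "T \<in> {T\<in>Pow I. \<exists>f\<in>G. a f < \<bar>\<Sum>i\<in>I. f (?w T (i, True)) - f (?w T (i, False))\<bar> \<and>
      (\<Sum>i\<in>I. (f (?w T (i, False)))\<^sup>2) \<le> s f}"
      and nT: "T \<notin> (\<Union>c\<in>C. bad (d c) \<union> bad (e c))"
    then obtain f where f: "f \<in> G" and dev: "a f < \<bar>\<Sum>i\<in>I. f (?w T (i, True)) - f (?w T (i, False))\<bar>"
      and small: "(\<Sum>i\<in>I. (f (?w T (i, False)))\<^sup>2) \<le> s f" and TI: "T \<in> Pow I" by auto
    from near[OF f] obtain c where c: "c \<in> C"
      and fc: "(\<Sum>i\<in>I-J. (f (z (i, True)) - c (z (i, True)))\<^sup>2 + (f (z (i, False)) - c (z (i, False)))\<^sup>2) \<le> r" by auto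
    have cG: "c \<in> G" using c C by auto
    have "\<bar>\<Sum>i\<in>I. f (?w T (i, True)) - f (?w T (i, False))\<bar>
        \<le> 2 * real k * K + sqrt (2 * real (card I) * r) + sqrt (4 * L * (8 * s f + 8 * r + 2 * L * K\<^sup>2))"
    proof (rule abs_sum_diff_le_of_near[where P="\<lambda>i. c (?w T (i, True))" and Q="\<lambda>i. c (?w T (i, False))", OF I J K])
      show "\<bar>\<Sum>i\<in>I-J. c (?w T (i, True)) - c (?w T (i, False))\<bar>
          \<le> sqrt (2 * L * (\<Sum>i\<in>I-J. (c (?w T (i, True)) - c (?w T (i, False)))\<^sup>2))"
        using nT c TI unfolding ss[symmetric] sq[symmetric] by (auto simp: bad_def not_less)
      show "\<bar>\<Sum>i\<in>I-J. (c (?w T (i, True)))\<^sup>2 - (c (?w T (i, False)))\<^sup>2\<bar>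
          \<le> sqrt (2 * L * (\<Sum>i\<in>I-J. ((c (?w T (i, True)))\<^sup>2 - (c (?w T (i, False)))\<^sup>2)\<^sup>2))"
        using nT c TI ss[of T "\<lambda>x. (c x)\<^sup>2"] sq[of "\<lambda>x. (c x)\<^sup>2" T] by (auto simp: bad_def e_def not_less)
      have "(\<Sum>i\<in>I-J. (f (?w T (i, True)) - c (?w T (i, True)))\<^sup>2 + (f (?w T (i, False)) - c (?w T (i, False)))\<^sup>2)
          = (\<Sum>i\<in>I-J. (f (z (i, True)) - c (z (i, True)))\<^sup>2 + (f (z (i, False)) - c (z (i, False)))\<^sup>2)"
        by (intro sum.cong refl, rename_tac i, case_tac "i \<in> T") (auto simp: flip_pairs_apply)
      then show "(\<Sum>i\<in>I-J. (f (?w T (i, True)) - c (?w T (i, True)))\<^sup>2 + (f (?w T (i, False)) - c (?w T (i, False)))\<^sup>2) \<le> r"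
        using fc by simp
    qed (use L r small wK f cG in auto)
    then show False using a[OF f] dev by linarith
  qed
  have badle: "real (card (bad v)) \<le> 2 ^ card I * (2 * exp (- L))" for v
    unfolding bad_def by (rule card_abs_signed_sum_gt_le[OF I L])
  have finbad: "finite (bad v)" for v unfolding bad_def using I by auto
  have "real (card {T\<in>Pow I. \<exists>f\<in>G. a f < \<bar>\<Sum>i\<in>I. f (?w T (i, True)) - f (?w T (i, False))\<bar> \<and>
      (\<Sum>i\<in>I. (f (?w T (i, False)))\<^sup>2) \<le> s f}) \<le> real (card (\<Union>c\<in>C. bad (d c) \<union> bad (e c)))"
    using sub C finbad by (intro of_nat_mono card_mono) auto
  also have "\<dots> \<le> real (\<Sum>c\<in>C. card (bad (d c) \<union> bad (e c)))"
    using C by (intro of_nat_mono card_UN_le) auto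
  also have "\<dots> \<le> (\<Sum>c\<in>C. 2 ^ card I * (4 * exp (- L)))"
    unfolding of_nat_sum
  proof (intro sum_mono)
    fix c
    have "real (card (bad (d c) \<union> bad (e c))) \<le> real (card (bad (d c))) + real (card (bad (e c)))"
      using card_Un_le[of "bad (d c)" "bad (e c)"] by linarith
    then show "real (card (bad (d c) \<union> bad (e c))) \<le> 2 ^ card I * (4 * exp (- L))"
      using badle[of "d c"] badle[of "e c"] by simp
  qed
  also have "\<dots> = real (card C) * (4 * exp (- L)) * 2 ^ card I" by simp
  also have "\<dots> \<le> real N * (4 * exp (- L)) * 2 ^ card I"
    using C by (intro mult_right_mono) auto
  finally show ?thesis .
qed


theorem (in prob_space) uniform_deviation_bounded:
  fixes G :: "('a \<Rightarrow> real) set" and I :: "'i set" and \<delta> :: real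
  defines "n \<equiv> real (card I)"
  assumes I: "finite I" "I \<noteq> {}" and G: "countable G" "G \<subseteq> borel_measurable M"
    and GK: "\<And>f x. f \<in> G \<Longrightarrow> x \<in> space M \<Longrightarrow> \<bar>f x\<bar> \<le> K" and K: "1 \<le> K"
    and m: "1 \<le> m" and \<delta>: "0 < \<delta>" "\<delta> < 1"
    and good: "7/8 \<le> measure (Pi\<^sub>M I (\<lambda>_. M)) {x\<in>space (Pi\<^sub>M I (\<lambda>_. M)). has_net I G m (4 / n) x}"
    and l: "l = ln (real m) + ln (exp 1 / \<delta>)"
  shows "measure (Pi\<^sub>M I (\<lambda>_. M)) {x\<in>space (Pi\<^sub>M I (\<lambda>_. M)). \<exists>f\<in>G.
      156 * sqrt (l * (n * (\<integral>x. (f x)\<^sup>2 \<partial>M) + K\<^sup>2 * l)) < \<bar>(\<Sum>i\<in>I. f (x i)) - n * (\<integral>x. f x \<partial>M)\<bar>} \<le> \<delta> / 2"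
proof -
  define P where "P = Pi\<^sub>M (I \<times> (UNIV :: bool set)) (\<lambda>_. M)"
  interpret P: prob_space P unfolding P_def by (intro prob_space_PiM) (rule prob_space_axioms)
  have n: "1 \<le> n" using I by (simp add: n_def Suc_le_eq card_gt_0_iff)
  have lnm: "0 \<le> ln (real m)" using m by simp
  have ln\<delta>: "ln (exp 1 / \<delta>) = 1 - ln \<delta>" using \<delta> by (simp add: ln_div)
  have "ln \<delta> < 0" using \<delta> by simp
  then have l1: "1 \<le> l" using lnm l ln\<delta> by simp
  \<comment> \<open>The summand \<open>K\<^sup>2 * l\<close> makes \<open>V f\<close> at least 1 and
    lets it absorb the net radius as well as the terms \<open>L * K\<^sup>2\<close>. Correspondingly
    \<open>X f\<close> dominates both 1 and \<open>K * l\<close>.\<close>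
  define V where "V f = n * (\<integral>x. (f x)\<^sup>2 \<partial>M) + K\<^sup>2 * l" for f :: "'a \<Rightarrow> real"
  define X where "X f = sqrt (l * V f)" for f
  \<comment> \<open>\<open>L\<close> and \<open>k\<close> are tuned to the same failure probability:
    the union bound over \<open>m ^ 4\<close> centres gives \<open>m ^ 4 * 4 * exp (- L)\<close> =
    \<delta>/8, and the missing pair net gives \<open>(1/2) ^ k\<close> \<le> \<delta>/8. Both are
    bounded by multiples of \<open>l\<close>.\<close>
  define L where "L = 4 * ln (real m) + ln (32 / \<delta>)"
  define k where "k = nat \<lceil>log 2 (8 / \<delta>)\<rceil>"
  have K2: "1 \<le> K\<^sup>2" using K by simp
  have sqn: "0 \<le> (\<integral>x. (f x)\<^sup>2 \<partial>M)" for f :: "'a \<Rightarrow> real" by (intro integral_nonneg_AE) auto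
  have V: "K\<^sup>2 * l \<le> V f" "n * (\<integral>x. (f x)\<^sup>2 \<partial>M) \<le> V f" "1 \<le> V f" for f
  proof -
    show "K\<^sup>2 * l \<le> V f" using sqn[of f] n by (simp add: V_def)
    moreover have "1 * 1 \<le> K\<^sup>2 * l" using K2 l1 by (intro mult_mono) auto
    ultimately show "1 \<le> V f" by simp
    show "n * (\<integral>x. (f x)\<^sup>2 \<partial>M) \<le> V f" using K2 l1 by (simp add: V_def)
  qed
  have X: "K * l \<le> X f" "1 \<le> X f" "(X f)\<^sup>2 = l * V f" for f
  proof -
    have "(K * l)\<^sup>2 \<le> l * V f" using mult_left_mono[OF V(1)[of f], of l] l1 by (simp add: power2_eq_square ac_simps)
    then show "K * l \<le> X f" unfolding X_def by (rule real_le_rsqrt)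
    moreover have "1 * 1 \<le> K * l" using K l1 by (intro mult_mono) auto
    ultimately show "1 \<le> X f" by simp
    show "(X f)\<^sup>2 = l * V f" using V(3)[of f] l1 by (simp add: X_def)
  qed
  have ln32: "ln (32::real) \<le> 4"
  proof -
    have "ln (32::real) = 5 * ln 2" using ln_realpow[of 2 5] by simp
    then show ?thesis using ln2_le_25_over_36 by simp
  qed
  have L: "0 < L" "L \<le> 8 * l"
  proof -
    have eq: "ln (32 / \<delta>) = ln 32 - ln \<delta>" using \<delta> by (simp add: ln_div)
    show "L \<le> 8 * l" using eq ln32 lnm \<open>ln \<delta> < 0\<close> unfolding L_def l ln\<delta> by simp
    have "0 < ln (32::real)" by simp
    then show "0 < L" using eq lnm \<open>ln \<delta> < 0\<close> unfolding L_def by linarith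
  qed
  have expL: "real (m ^ 4) * (4 * exp (- L)) = \<delta> / 8"
  proof -
    have "exp L = exp (ln (real m)) ^ 4 * exp (ln (32 / \<delta>))"
      unfolding L_def exp_add using exp_of_nat_mult[of 4 "ln (real m)"] by simp
    also have "\<dots> = real m ^ 4 * (32 / \<delta>)" using m \<delta> by simp
    finally have "exp L = real m ^ 4 * (32 / \<delta>)" .
    then have "exp (- L) = \<delta> / (32 * real m ^ 4)" using \<delta> m by (simp add: exp_minus field_simps)
    then show ?thesis using m by simp
  qed
  have logpos: "0 < log 2 (8 / \<delta>)" using \<delta> by simp
  have k: "real k \<le> 4 * l"
  proof -
    have "real k \<le> log 2 (8 / \<delta>) + 1" unfolding k_def using logpos by linarith
    moreover have "log 2 (8 / \<delta>) = 3 - log 2 \<delta>"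
    proof -
      have "log 2 (2 ^ 3 :: real) = 3" by (subst log_nat_power) auto
      then show ?thesis using \<delta> by (simp add: log_divide)
    qed
    moreover have "- log 2 \<delta> \<le> 2 * (- ln \<delta>)"
    proof -
      have "- ln \<delta> \<le> (2 * ln 2) * (- ln \<delta>)"
        using mult_right_mono[of 1 "2 * ln 2" "- ln \<delta>"] ln2_ge_two_thirds \<open>ln \<delta> < 0\<close> by simp
      then show ?thesis by (simp add: log_def field_simps)
    qed
    ultimately show ?thesis using lnm \<open>ln \<delta> < 0\<close> unfolding l ln\<delta> by simp
  qed
  have pk: "(1/2) ^ k \<le> \<delta> / 8"
  proof -
    have "log 2 (8 / \<delta>) \<le> real k" unfolding k_def using logpos by linarith
    then have "8 / \<delta> \<le> 2 powr real k" using \<delta> by (simp add: log_le_iff)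
    then have "8 / \<delta> \<le> 2 ^ k" by (simp add: powr_realpow)
    then show ?thesis using \<delta> by (simp add: power_divide field_simps)
  qed
  \<comment> \<open>The constant is 154 = 8 + 12 + 134: the discarded pairs, the passage to the
    centres, and the Rademacher sum. The last part comes from 32 * 560 = 17920 \<le> 134^2.\<close>
  define Q where "Q z \<longleftrightarrow> (\<exists>f\<in>G. 154 * X f < \<bar>\<Sum>i\<in>I. f (z (i, True)) - f (z (i, False))\<bar> \<and> (\<Sum>i\<in>I. (f (z (i, False)))\<^sup>2) \<le> 4 * V f)"
    for z :: "'i \<times> bool \<Rightarrow> 'a"
  define W where "W = has_pair_net I G (m ^ 4) (16 * (4 / n)) k"
  have Qm[measurable]: "Measurable.pred P Q"
  proof -
    have [measurable]: "(\<lambda>z. f (z (i, b))) \<in> borel_measurable P" if "f \<in> G" "i \<in> I" for f i b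
      unfolding P_def using that G(2) by (intro measurable_compose[OF measurable_component_singleton]) auto
    show ?thesis unfolding Q_def by (intro pred_countable_Bex G(1)) measurable
  qed
  have Wm[measurable]: "Measurable.pred P W" unfolding P_def W_def by (rule pred_has_pair_net[OF I(1) G])
  have QW: "measure P {z\<in>space P. Q z \<and> W z} \<le> \<delta> / 8"
    unfolding P_def
  proof (rule prob_le_of_flip_fraction[OF I(1)])
    fix z assume z: "z \<in> space (Pi\<^sub>M (I \<times> (UNIV :: bool set)) (\<lambda>_. M))" and W: "W z"
    have "real (card {T\<in>Pow I. Q (flip_pairs I T z)}) \<le> real (m ^ 4) * (4 * exp (- L)) * 2 ^ card I"
      unfolding Q_def
    proof (rule card_flips_le_of_pair_net[where G=G and K=K and r="16 * (4 / n)" and k=k, OF I(1) _ L(1)])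
      fix f
      have "2 * real k * K \<le> 8 * X f"
        proof -
        have "real k * K \<le> (4 * l) * K" using K by (intro mult_right_mono[OF k]) simp
        also have "\<dots> = 4 * (K * l)" by simp
        finally show ?thesis using X(1)[of f] by linarith
      qed
      moreover have "sqrt (2 * real (card I) * (16 * (4 / n))) \<le> 12 * X f"
      proof -
        have "sqrt (2 * real (card I) * (16 * (4 / n))) = sqrt 128" using n by (simp add: n_def)
        also have "\<dots> \<le> 12" by (rule real_le_lsqrt) auto
        finally show ?thesis using X(2)[of f] by simp
      qed
      moreover have "sqrt (4 * L * (8 * (4 * V f) + 8 * (16 * (4 / n)) + 2 * L * K\<^sup>2)) \<le> 134 * X f"
      proof (rule real_le_lsqrt)
        have "4 / n \<le> 4 * V f"
        proof -
          have "4 / n \<le> 4" using n by (simp add: field_simps)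
          then show ?thesis using V(3)[of f] by linarith
        qed
        moreover have "L * K\<^sup>2 \<le> 8 * V f"
          using mult_right_mono[OF L(2), of "K\<^sup>2"] V(1)[of f] by (simp add: ac_simps)
        ultimately have "8 * (4 * V f) + 8 * (16 * (4 / n)) + 2 * L * K\<^sup>2 \<le> 560 * V f" using V(3)[of f] by linarith
        moreover have "4 * L \<le> 32 * l" using L by simp
        ultimately have "4 * L * (8 * (4 * V f) + 8 * (16 * (4 / n)) + 2 * L * K\<^sup>2) \<le> (32 * l) * (560 * V f)"
          by (intro mult_mono[of "4 * L" "32 * l"]) (use L l1 V(3)[of f] n in \<open>auto intro!: add_nonneg_nonneg\<close>)
        also have "\<dots> = 17920 * (X f)\<^sup>2" unfolding X(3) by simp
        also have "\<dots> \<le> (134 * X f)\<^sup>2" by (simp add: power_mult_distrib)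
        finally show "4 * L * (8 * (4 * V f) + 8 * (16 * (4 / n)) + 2 * L * K\<^sup>2) \<le> (134 * X f)\<^sup>2" .
      qed (use X(2)[of f] in simp)
      ultimately show "2 * real k * K + sqrt (2 * real (card I) * (16 * (4 / n))) +
          sqrt (4 * L * (8 * (4 * V f) + 8 * (16 * (4 / n)) + 2 * L * K\<^sup>2)) \<le> 154 * X f" by linarith
    qed (use K n GK z W in \<open>auto simp: W_def\<close>)
    then show "real (card {T\<in>Pow I. Q (flip_pairs I T z)}) \<le> \<delta> / 8 * 2 ^ card I" unfolding expL .
  qed (use \<delta> Qm Wm in \<open>auto simp: P_def W_def has_pair_net_flip\<close>)
  have NW: "measure P {z\<in>space P. \<not> W z} \<le> \<delta> / 8"
    using prob_no_pair_net_le[OF I(1) G good, of k] pk unfolding P_def W_def by linarith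
  have PQ: "measure P {z\<in>space P. Q z} \<le> \<delta> / 4"
  proof -
    have "measure P {z\<in>space P. Q z} \<le> measure P ({z\<in>space P. Q z \<and> W z} \<union> {z\<in>space P. \<not> W z})"
      by (intro P.finite_measure_mono) auto
    also have "\<dots> \<le> measure P {z\<in>space P. Q z \<and> W z} + measure P {z\<in>space P. \<not> W z}"
      by (intro measure_Un_le) auto
    finally show ?thesis using QW NW by simp
  qed
  \<comment> \<open>The extra \<open>2 * X f\<close> is the deviation allowed to the ghost half; its
    square dominates 4 n P f^2 as Chebyshev's inequality requires. The ghost argument doubles
    \<delta>/4 to \<delta>/2, leaving the other half for the truncation.\<close>
  have "measure (Pi\<^sub>M I (\<lambda>_. M)) {x\<in>space (Pi\<^sub>M I (\<lambda>_. M)). \<exists>f\<in>G.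
      154 * X f + 2 * X f < \<bar>(\<Sum>i\<in>I. f (x i)) - card I * (\<integral>x. f x \<partial>M)\<bar>} \<le> 2 * measure P {z\<in>space P. Q z}"
    unfolding P_def Q_def
  proof (rule prob_deviation_le_ghost[where K=K, OF I(1) G])
    fix f
    show "0 < 2 * X f" "0 < V f" using X(2)[of f] V(3)[of f] by auto
    show "real (card I) * (\<integral>x. (f x)\<^sup>2 \<partial>M) \<le> V f" using V(2)[of f] by (simp add: n_def)
    have "V f \<le> l * V f" using l1 V(3)[of f] by simp
    then show "4 * (real (card I) * (\<integral>x. (f x)\<^sup>2 \<partial>M)) \<le> (2 * X f)\<^sup>2"
      using V(2)[of f] X(3)[of f] by (simp add: n_def power_mult_distrib)
  qed (use GK in auto)
  then show ?thesis using PQ by (simp add: X_def V_def n_def)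
qed


section \<open>Truncation of an exponentially integrable envelope\<close>

lemma exp_ext_infinity [simp]: "exp_ext \<infinity> = \<infinity>" "exp_ext (- \<infinity>) = 0"
  using exp_ext.simps(2,3) by (simp_all only: PInfty_eq_infinity MInfty_eq_minfinity)

lemma exp_ext_eq: "exp_ext x = (if x = \<infinity> then \<infinity> else if x = -\<infinity> then 0 else ennreal (exp (real_of_ereal x)))"
  by (cases x) auto

lemma measurable_exp_ext [measurable]: "exp_ext \<in> borel_measurable borel"
  unfolding exp_ext_eq[abs_def] by measurable

lemma exp_ext_mono: "x \<le> y \<Longrightarrow> exp_ext x \<le> exp_ext y"
  by (cases x; cases y) (auto simp: ennreal_leI)

text \<open>Above the level 2 c ln N the number exp (e / (2 c)) is at least N, so halving the
  exponent gains a factor 1/N. With N = n the expectation is 1 + O(1/n), and the product over an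
  entire sample of size n still has bounded expectation.\<close>

lemma exp_ext_truncation_le:
  fixes e :: ereal
  assumes c: "0 < c" and N: "0 < N"
  shows "(if e \<le> ereal (2 * c * ln N) then 1 else exp_ext (e / ereal (2 * c)))
    \<le> 1 + ennreal (1 / N) * exp_ext (e / ereal c)"
proof (cases e)
  case (real u)
  show ?thesis
  proof (cases "u \<le> 2 * c * ln N")
    case False
    then have "ln N \<le> u / (2 * c)" using c by (simp add: field_simps)
    then have "exp (ln N) * exp (u / (2 * c)) \<le> exp (u / (2 * c)) * exp (u / (2 * c))"
      by (intro mult_right_mono) auto
    also have "\<dots> = exp (u / c)" by (simp flip: exp_add)
    finally have "exp (u / (2 * c)) \<le> 1 / N * exp (u / c)" using N by (simp add: field_simps)
    then have "ennreal (exp (u / (2 * c))) \<le> ennreal (1 / N) * ennreal (exp (u / c))"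
      using N by (simp flip: ennreal_mult add: ennreal_leI)
    also have "\<dots> \<le> 1 + ennreal (1 / N) * ennreal (exp (u / c))" by (simp add: add_increasing)
    finally show ?thesis using False real c by simp
  qed (use real in \<open>simp add: add_increasing2\<close>)
next
  case PInf
  then show ?thesis using c N by (simp add: ennreal_mult_top)
qed auto

lemma prod_ennreal_exp: "finite I \<Longrightarrow> ennreal (exp (\<Sum>i\<in>I. u i)) = (\<Prod>i\<in>I. ennreal (exp (u i)))"
  by (simp add: exp_sum prod_ennreal)

theorem (in prob_space) uniform_deviation_exponential_envelope:
  fixes G :: "('a \<Rightarrow> real) set" and I :: "'i set" and \<delta> :: real and E :: "'a \<Rightarrow> ereal"
  defines "n \<equiv> real (card I)"
  assumes I: "finite I" "2 \<le> card I" and G: "countable G" "G \<subseteq> borel_measurable M"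
    and E[measurable]: "E \<in> borel_measurable M"
    and GE: "\<And>f x. f \<in> G \<Longrightarrow> x \<in> space M \<Longrightarrow> ereal \<bar>f x\<bar> \<le> E x"
    and c: "1 \<le> c" and Eexp: "(\<integral>\<^sup>+x. exp_ext (E x / ereal c) \<partial>M) \<le> 2"
    and m: "1 \<le> m" and \<delta>: "0 < \<delta>" "\<delta> < 1"
    and good: "7/8 \<le> measure (Pi\<^sub>M I (\<lambda>_. M)) {x\<in>space (Pi\<^sub>M I (\<lambda>_. M)). has_net I G m (4 / n) x}"
    and l: "l = ln (real m) + ln (exp 1 / \<delta>)"
  shows "measure (Pi\<^sub>M I (\<lambda>_. M)) {x\<in>space (Pi\<^sub>M I (\<lambda>_. M)). \<exists>f\<in>G.
      156 * sqrt (l * (n * (\<integral>x. (f x)\<^sup>2 \<partial>M) + (2 * c * ln n)\<^sup>2 * l)) + 10 * c * l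
        < \<bar>(\<Sum>i\<in>I. f (x i)) - n * (\<integral>x. f x \<partial>M)\<bar>} \<le> \<delta>"
proof -
  define PI where "PI = Pi\<^sub>M I (\<lambda>_. M)"
  interpret PI: prob_space PI unfolding PI_def by (intro prob_space_PiM) (rule prob_space_axioms)
  interpret product_sigma_finite "\<lambda>_. M" by unfold_locales
  have n: "2 \<le> n" using I by (simp add: n_def)
  have ln\<delta>: "ln (exp 1 / \<delta>) = 1 - ln \<delta>" "ln \<delta> < 0" using \<delta> by (auto simp: ln_div)
  have "0 \<le> ln (real m)" using m by simp
  then have l1: "1 - ln \<delta> \<le> l" "1 \<le> l" using l ln\<delta> by linarith+
  define K where "K = 2 * c * ln n"
  have K: "1 \<le> K"
  proof -
    have "2 / 3 \<le> ln (2::real)" by (rule ln2_ge_two_thirds)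
    also have "ln 2 \<le> ln n" using n by simp
    finally have "1 * 1 \<le> (2 * ln n) * c" using c by (intro mult_mono) auto
    then show ?thesis by (simp add: K_def ac_simps)
  qed
  \<comment> \<open>All functions are cut on the same set, determined by the envelope. A difference
    of two functions is then either unchanged or set to zero, so a net of the class becomes a net of
    the truncated class with the same radius and no more centres.\<close>
  define tr where "tr f x = (if E x \<le> ereal K then f x else 0)" for f :: "'a \<Rightarrow> real" and x
  \<comment> \<open>A single weight that dominates the exponential tail of every member of the
    class, so that one exceptional event serves all of them at once.\<close>
  define w where "w x = (if E x \<le> ereal K then 1 else exp_ext (E x / ereal (2 * c)))" for x
  have [measurable]: "w \<in> borel_measurable M" unfolding w_def by measurable
  have Gm[measurable]: "f \<in> borel_measurable M" if "f \<in> G" for f using that G by auto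
  have trm[measurable]: "tr f \<in> borel_measurable M" if [measurable]: "f \<in> borel_measurable M" for f
    unfolding tr_def[abs_def] by measurable
  have w: "(\<integral>\<^sup>+x. w x \<partial>M) \<le> ennreal (1 + 2 / n)"
  proof -
    have "(\<integral>\<^sup>+x. w x \<partial>M) \<le> (\<integral>\<^sup>+x. 1 + ennreal (1 / n) * exp_ext (E x / ereal c) \<partial>M)"
      unfolding w_def K_def using c n by (intro nn_integral_mono exp_ext_truncation_le) auto
    also have "\<dots> = 1 + ennreal (1 / n) * (\<integral>\<^sup>+x. exp_ext (E x / ereal c) \<partial>M)"
      by (subst nn_integral_add) (auto simp: nn_integral_cmult emeasure_space_1)
    also have "\<dots> \<le> 1 + ennreal (1 / n) * 2" using Eexp by (intro add_left_mono mult_left_mono) auto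
    also have "\<dots> = ennreal (1 + 2 / n)"
    proof -
      have "ennreal (1 / n) * 2 = ennreal (1 / n * 2)" using n by (subst ennreal_mult) auto
      then show ?thesis using n by (simp add: ennreal_plus)
    qed
    finally show ?thesis .
  qed
  have tail: "ennreal (exp (\<bar>f x - tr f x\<bar> / (2 * c))) \<le> w x" if f: "f \<in> G" and x: "x \<in> space M" for f x
  proof (cases "E x \<le> ereal K")
    case False
    have "ereal (\<bar>f x\<bar> / (2 * c)) \<le> E x / ereal (2 * c)"
      using GE[OF f x] c ereal_divide_right_mono[of "ereal \<bar>f x\<bar>" "E x" "ereal (2 * c)"] by simp
    from exp_ext_mono[OF this] show ?thesis using False by (simp add: w_def tr_def)
  qed (simp add: w_def tr_def)
  \<comment> \<open>The bias of truncation comes from the same weight: 1 + u \<le> exp u \<le> w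
    pointwise and the integral of w is at most 1 + 2/n, so the integral of u is at most 2/n.\<close>
  have mean: "integrable M f" "\<bar>(\<integral>x. f x \<partial>M) - (\<integral>x. tr f x \<partial>M)\<bar> \<le> 4 * c / n" if f: "f \<in> G" for f
  proof -
    define u where "u x = \<bar>f x - tr f x\<bar> / (2 * c)" for x
    have [measurable]: "u \<in> borel_measurable M" unfolding u_def using f by measurable
    have u0: "0 \<le> u x" for x using c by (simp add: u_def)
    have "1 + (\<integral>\<^sup>+x. ennreal (u x) \<partial>M) = (\<integral>\<^sup>+x. 1 + ennreal (u x) \<partial>M)"
      by (subst nn_integral_add) (auto simp: emeasure_space_1)
    also have "\<dots> \<le> (\<integral>\<^sup>+x. w x \<partial>M)"
    proof (intro nn_integral_mono)
      fix x assume x: "x \<in> space M"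
      have "1 + ennreal (u x) = ennreal (1 + u x)" using u0 by (simp add: ennreal_plus)
      also have "\<dots> \<le> ennreal (exp (u x))" by (intro ennreal_leI exp_ge_add_one_self)
      also have "\<dots> \<le> w x" unfolding u_def by (rule tail[OF f x])
      finally show "1 + ennreal (u x) \<le> w x" .
    qed
    also have "\<dots> \<le> 1 + ennreal (2 / n)" using w n by (simp add: ennreal_plus)
    finally have u: "(\<integral>\<^sup>+x. ennreal (u x) \<partial>M) \<le> ennreal (2 / n)"
      by (simp add: ennreal_add_left_cancel_le)
    have iu: "integrable M u"
      using u u0 by (intro integrableI_nonneg) (auto simp: less_top[symmetric] top_unique)
    have Iu: "(\<integral>x. u x \<partial>M) \<le> 2 / n"
      using u n u0 iu by (subst (asm) nn_integral_eq_integral) (auto simp: ennreal_le_iff)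
    have "integrable M (\<lambda>x. 2 * c * u x)" using iu by auto
    then have idiff: "integrable M (\<lambda>x. f x - tr f x)"
      by (rule Bochner_Integration.integrable_bound) (use f c in \<open>auto simp: u_def abs_mult\<close>)
    have itr: "integrable M (tr f)"
    proof (intro integrable_const_bound[where B=K] AE_I2)
      fix x assume x: "x \<in> space M"
      show "norm (tr f x) \<le> K"
        using order.trans[OF GE[OF f x], of "ereal K"] K by (auto simp: tr_def)
    qed (use f in measurable)
    show intf: "integrable M f" using Bochner_Integration.integrable_add[OF idiff itr] by simp
    have "\<bar>(\<integral>x. f x \<partial>M) - (\<integral>x. tr f x \<partial>M)\<bar> = \<bar>\<integral>x. f x - tr f x \<partial>M\<bar>" using intf itr by simp
    also have "\<dots> \<le> (\<integral>x. \<bar>f x - tr f x\<bar> \<partial>M)" by (rule integral_abs_bound)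
    also have "\<dots> = (\<integral>x. 2 * c * u x \<partial>M)" using c by (simp add: u_def)
    also have "\<dots> = 2 * c * (\<integral>x. u x \<partial>M)" by simp
    also have "\<dots> \<le> 2 * c * (2 / n)" using Iu c by (intro mult_left_mono) auto
    finally show "\<bar>(\<integral>x. f x \<partial>M) - (\<integral>x. tr f x \<partial>M)\<bar> \<le> 4 * c / n" by simp
  qed
  \<comment> \<open>Integrability of the square of \<open>f\<close> has to be shown first, since the
    Bochner integral of a nonintegrable function is 0 by default and the comparison could then
    fail.\<close>
  have square: "(\<integral>x. (tr f x)\<^sup>2 \<partial>M) \<le> (\<integral>x. (f x)\<^sup>2 \<partial>M)" if f: "f \<in> G" for f
  proof -
    have "(\<integral>\<^sup>+x. ennreal ((f x)\<^sup>2) \<partial>M) \<le> (\<integral>\<^sup>+x. ennreal (2 * c\<^sup>2) * exp_ext (E x / ereal c) \<partial>M)"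
    proof (intro nn_integral_mono)
      fix x assume x: "x \<in> space M"
      define v where "v = \<bar>f x\<bar> / c"
      have v: "0 \<le> v" "(f x)\<^sup>2 = c\<^sup>2 * v\<^sup>2" using c by (auto simp: v_def power_divide)
      have "v\<^sup>2 \<le> 2 * exp v" using exp_lower_Taylor_quadratic[OF v(1)] v(1) by linarith
      then have "(f x)\<^sup>2 \<le> 2 * c\<^sup>2 * exp v" using mult_left_mono[of "v\<^sup>2" "2 * exp v" "c\<^sup>2"] v by simp
      then have "ennreal ((f x)\<^sup>2) \<le> ennreal (2 * c\<^sup>2) * ennreal (exp v)"
        by (simp flip: ennreal_mult add: ennreal_leI)
      also have "ereal v \<le> E x / ereal c"
        using GE[OF f x] c ereal_divide_right_mono[of "ereal \<bar>f x\<bar>" "E x" "ereal c"] by (simp add: v_def)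
      then have "ennreal (2 * c\<^sup>2) * ennreal (exp v) \<le> ennreal (2 * c\<^sup>2) * exp_ext (E x / ereal c)"
        using exp_ext_mono[of "ereal v" "E x / ereal c"] by (intro mult_left_mono) auto
      finally show "ennreal ((f x)\<^sup>2) \<le> ennreal (2 * c\<^sup>2) * exp_ext (E x / ereal c)" .
    qed
    also have "\<dots> = ennreal (2 * c\<^sup>2) * (\<integral>\<^sup>+x. exp_ext (E x / ereal c) \<partial>M)" by (rule nn_integral_cmult) measurable
    also have "\<dots> \<le> ennreal (2 * c\<^sup>2) * 2" using Eexp by (intro mult_left_mono) auto
    also have "\<dots> < \<infinity>" by (simp add: ennreal_mult_less_top)
    finally have "integrable M (\<lambda>x. (f x)\<^sup>2)" using f by (intro integrableI_nonneg) auto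
    then show ?thesis by (intro integral_mono') (auto simp: tr_def)
  qed
  define S where "S = {x\<in>space PI. \<exists>f\<in>G. 156 * sqrt (l * (n * (\<integral>x. (tr f x)\<^sup>2 \<partial>M) + K\<^sup>2 * l))
      < \<bar>(\<Sum>i\<in>I. tr f (x i)) - n * (\<integral>x. tr f x \<partial>M)\<bar>}"
  have S: "measure PI S \<le> \<delta> / 2"
  proof -
    have "measure (Pi\<^sub>M I (\<lambda>_. M)) {x\<in>space (Pi\<^sub>M I (\<lambda>_. M)). \<exists>f\<in>tr ` G.
      156 * sqrt (l * (card I * (\<integral>x. (f x)\<^sup>2 \<partial>M) + K\<^sup>2 * l)) < \<bar>(\<Sum>i\<in>I. f (x i)) - card I * (\<integral>x. f x \<partial>M)\<bar>} \<le> \<delta> / 2"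
    proof (rule uniform_deviation_bounded[OF I(1) _ _ _ _ K m \<delta> _ l])
      show "I \<noteq> {}" using I by auto
      show trG: "countable (tr ` G)" "tr ` G \<subseteq> borel_measurable M" using G by auto
      show "\<bar>g x\<bar> \<le> K" if "g \<in> tr ` G" "x \<in> space M" for g x
      proof -
        obtain f where f: "f \<in> G" "g = tr f" using \<open>g \<in> tr ` G\<close> by auto
        show ?thesis using order.trans[OF GE[OF f(1) that(2)], of "ereal K"] K by (auto simp: tr_def f)
      qed
      have "{x\<in>space PI. has_net I G m (4 / n) x} \<subseteq> {x\<in>space PI. has_net I (tr ` G) m (4 / n) x}"
      proof safe
        fix x assume "has_net I G m (4 / n) x"
        then obtain C where C: "finite C" "C \<subseteq> G" "card C \<le> m"
          and near: "\<And>f. f \<in> G \<Longrightarrow> \<exists>c\<in>C. (\<Sum>i\<in>I. (f (x i) - c (x i))\<^sup>2) \<le> 4 / n"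
          unfolding has_net_def by blast
        have "\<exists>c\<in>tr ` C. (\<Sum>i\<in>I. (tr f (x i) - c (x i))\<^sup>2) \<le> 4 / n" if f: "f \<in> G" for f
        proof -
          obtain c where c: "c \<in> C" "(\<Sum>i\<in>I. (f (x i) - c (x i))\<^sup>2) \<le> 4 / n" using near[OF f] by auto
          have "(\<Sum>i\<in>I. (tr f (x i) - tr c (x i))\<^sup>2) \<le> (\<Sum>i\<in>I. (f (x i) - c (x i))\<^sup>2)"
            by (intro sum_mono) (auto simp: tr_def)
          then show ?thesis using c by (intro bexI[of _ "tr c"]) auto
        qed
        then have near': "\<forall>g\<in>tr ` G. \<exists>c\<in>tr ` C. (\<Sum>i\<in>I. (g (x i) - c (x i))\<^sup>2) \<le> 4 / n" by blast
        have "finite (tr ` C)" "tr ` C \<subseteq> tr ` G" "card (tr ` C) \<le> m"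
          using C card_image_le[OF C(1), of tr] by auto
        then show "has_net I (tr ` G) m (4 / n) x" unfolding has_net_def using near' by blast
      qed
      then have "measure PI {x\<in>space PI. has_net I G m (4 / n) x} \<le> measure PI {x\<in>space PI. has_net I (tr ` G) m (4 / n) x}"
        using pred_has_net[OF trG, of I m "4 / n"]
        by (intro PI.finite_measure_mono) (auto simp: PI_def pred_def)
      then show "7/8 \<le> measure (Pi\<^sub>M I (\<lambda>_. M)) {x\<in>space (Pi\<^sub>M I (\<lambda>_. M)). has_net I (tr ` G) m (4 / real (card I)) x}"
        using good unfolding PI_def n_def by linarith
    qed
    then show ?thesis by (simp add: S_def PI_def n_def)
  qed
  \<comment> \<open>The product of the weights over the sample has mean at most (1 + 2/n)^n \<le>
    exp 2, so it exceeds \<open>b\<close> with probability at most \<delta>/2 by Markov's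
    inequality. Since ln b \<le> 3 l, the truncated part of the sum is at most 6 c l off this event;
    the bias adds at most 4 c l.\<close>
  define b where "b = 2 * exp 2 / \<delta>"
  have b: "0 < b" using \<delta> by (simp add: b_def)
  have wPm[measurable]: "(\<lambda>x. \<Prod>i\<in>I. w (x i)) \<in> borel_measurable PI"
    unfolding PI_def by measurable
  define R where "R = {x\<in>space PI. 1 \<le> ennreal (1 / b) * (\<Prod>i\<in>I. w (x i))}"
  have R: "measure PI R \<le> \<delta> / 2"
  proof -
    have "(\<integral>\<^sup>+x. (\<Prod>i\<in>I. w (x i)) \<partial>PI) = (\<Prod>i\<in>I. \<integral>\<^sup>+x. w x \<partial>M)"
      unfolding PI_def by (rule product_nn_integral_prod[OF I(1)]) auto
    also have "\<dots> \<le> (\<Prod>i\<in>I. ennreal (1 + 2 / n))" using w by (intro prod_mono_ennreal) auto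
    also have "\<dots> = ennreal ((1 + 2 / n) ^ card I)" using n by (simp add: ennreal_power del: ennreal_plus)
    also have "\<dots> \<le> ennreal (exp 2)"
    proof (rule ennreal_leI)
      have "(1 + 2 / n) ^ card I \<le> exp (2 / n) ^ card I"
        using n by (intro power_mono exp_ge_add_one_self) auto
      also have "\<dots> = exp 2" using n by (simp add: n_def flip: exp_of_nat_mult)
      finally show "(1 + 2 / n) ^ card I \<le> exp 2" .
    qed
    finally have le: "(\<integral>\<^sup>+x. (\<Prod>i\<in>I. w (x i)) \<partial>PI) \<le> ennreal (exp 2)" .
    have "emeasure PI R \<le> ennreal (1 / b) * (\<integral>\<^sup>+x. (\<Prod>i\<in>I. w (x i)) * indicator (space PI) x \<partial>PI)"
      unfolding R_def by (rule nn_integral_Markov_inequality) auto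
    also have "(\<integral>\<^sup>+x. (\<Prod>i\<in>I. w (x i)) * indicator (space PI) x \<partial>PI) = (\<integral>\<^sup>+x. (\<Prod>i\<in>I. w (x i)) \<partial>PI)"
      by (intro nn_integral_cong) auto
    also have "ennreal (1 / b) * \<dots> \<le> ennreal (1 / b) * ennreal (exp 2)" using le by (intro mult_left_mono) auto
    also have "\<dots> = ennreal (1 / b * exp 2)" using b by (subst ennreal_mult) auto
    also have "1 / b * exp 2 = \<delta> / 2" by (simp add: b_def)
    finally show ?thesis using \<delta> by (simp add: PI.emeasure_eq_measure ennreal_le_iff)
  qed
  have Rm: "R \<in> sets PI" unfolding R_def by measurable
  have Sm: "S \<in> sets PI"
  proof -
    have [measurable]: "(\<lambda>x. tr f (x i)) \<in> borel_measurable PI" if "f \<in> G" "i \<in> I" for f i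
      unfolding PI_def using that Gm by (intro measurable_compose[OF measurable_component_singleton] trm) auto
    have "Measurable.pred PI (\<lambda>x. \<exists>f\<in>G. 156 * sqrt (l * (n * (\<integral>x. (tr f x)\<^sup>2 \<partial>M) + K\<^sup>2 * l))
      < \<bar>(\<Sum>i\<in>I. tr f (x i)) - n * (\<integral>x. tr f x \<partial>M)\<bar>)"
      by (intro pred_countable_Bex G(1)) measurable
    then show ?thesis by (simp add: S_def pred_def)
  qed
  have "{x\<in>space PI. \<exists>f\<in>G. 156 * sqrt (l * (n * (\<integral>x. (f x)\<^sup>2 \<partial>M) + K\<^sup>2 * l)) + 10 * c * l
      < \<bar>(\<Sum>i\<in>I. f (x i)) - n * (\<integral>x. f x \<partial>M)\<bar>} \<subseteq> S \<union> R"
  proof (rule subsetI, rule ccontr)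
    fix x
    assume "x \<in> {x\<in>space PI. \<exists>f\<in>G. 156 * sqrt (l * (n * (\<integral>x. (f x)\<^sup>2 \<partial>M) + K\<^sup>2 * l)) + 10 * c * l
        < \<bar>(\<Sum>i\<in>I. f (x i)) - n * (\<integral>x. f x \<partial>M)\<bar>}" and nx: "x \<notin> S \<union> R"
    then obtain f where x: "x \<in> space PI" and f: "f \<in> G"
      and dev: "156 * sqrt (l * (n * (\<integral>x. (f x)\<^sup>2 \<partial>M) + K\<^sup>2 * l)) + 10 * c * l < \<bar>(\<Sum>i\<in>I. f (x i)) - n * (\<integral>x. f x \<partial>M)\<bar>" by auto
    have xi: "x i \<in> space M" if "i \<in> I" for i using x that by (auto simp: PI_def space_PiM)
    have 1: "\<bar>(\<Sum>i\<in>I. tr f (x i)) - n * (\<integral>x. tr f x \<partial>M)\<bar> \<le> 156 * sqrt (l * (n * (\<integral>x. (tr f x)\<^sup>2 \<partial>M) + K\<^sup>2 * l))"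
      using nx x f by (auto simp: S_def not_less)
    have 2: "sqrt (l * (n * (\<integral>x. (tr f x)\<^sup>2 \<partial>M) + K\<^sup>2 * l)) \<le> sqrt (l * (n * (\<integral>x. (f x)\<^sup>2 \<partial>M) + K\<^sup>2 * l))"
      using square[OF f] l1 n by (intro real_sqrt_le_mono mult_left_mono add_right_mono) auto
    have 3: "\<bar>(\<Sum>i\<in>I. f (x i)) - (\<Sum>i\<in>I. tr f (x i))\<bar> \<le> 6 * c * l"
    proof -
      define u where "u i = \<bar>f (x i) - tr f (x i)\<bar> / (2 * c)" for i
      have "ennreal (exp (\<Sum>i\<in>I. u i)) = (\<Prod>i\<in>I. ennreal (exp (u i)))"
        by (rule prod_ennreal_exp[OF I(1)])
      also have "\<dots> \<le> (\<Prod>i\<in>I. w (x i))" unfolding u_def using tail[OF f xi] by (intro prod_mono_ennreal) auto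
      finally have "ennreal (1 / b) * ennreal (exp (\<Sum>i\<in>I. u i)) \<le> ennreal (1 / b) * (\<Prod>i\<in>I. w (x i))"
        by (intro mult_left_mono) auto
      also have "\<dots> < 1" using nx x by (simp add: R_def not_le)
      finally have "ennreal (1 / b) * ennreal (exp (\<Sum>i\<in>I. u i)) < 1" .
      moreover have "ennreal (1 / b) * ennreal (exp (\<Sum>i\<in>I. u i)) = ennreal (exp (\<Sum>i\<in>I. u i) / b)"
        using b by (subst ennreal_mult[symmetric]) auto
      ultimately have "exp (\<Sum>i\<in>I. u i) / b < 1" using b by (simp add: ennreal_less_one_iff)
      then have "exp (\<Sum>i\<in>I. u i) < b" using b by (simp add: field_simps)
      then have "(\<Sum>i\<in>I. u i) < ln b" using b by (metis exp_less_cancel_iff exp_ln)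
      also have "ln b = ln 2 + 2 - ln \<delta>" using \<delta> by (simp add: b_def ln_mult ln_div)
      also have "\<dots> \<le> 3 * l" using l1 ln\<delta> ln2_le_25_over_36 by linarith
      finally have "(\<Sum>i\<in>I. u i) * (2 * c) \<le> 3 * l * (2 * c)" using c by (intro mult_right_mono) auto
      also have "(\<Sum>i\<in>I. u i) * (2 * c) = (\<Sum>i\<in>I. \<bar>f (x i) - tr f (x i)\<bar>)"
        using c by (simp add: u_def sum_distrib_right)
      finally have "(\<Sum>i\<in>I. \<bar>f (x i) - tr f (x i)\<bar>) \<le> 6 * c * l" by (simp add: ac_simps)
      moreover have "\<bar>(\<Sum>i\<in>I. f (x i)) - (\<Sum>i\<in>I. tr f (x i))\<bar> \<le> (\<Sum>i\<in>I. \<bar>f (x i) - tr f (x i)\<bar>)"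
        unfolding sum_subtractf[symmetric] by (rule sum_abs)
      ultimately show ?thesis by linarith
    qed
    have 4: "\<bar>n * (\<integral>x. tr f x \<partial>M) - n * (\<integral>x. f x \<partial>M)\<bar> \<le> 4 * c * l"
    proof -
      have "\<bar>n * (\<integral>x. tr f x \<partial>M) - n * (\<integral>x. f x \<partial>M)\<bar> = n * \<bar>(\<integral>x. f x \<partial>M) - (\<integral>x. tr f x \<partial>M)\<bar>"
        using n by (simp add: abs_mult abs_minus_commute flip: right_diff_distrib)
      also have "\<dots> \<le> n * (4 * c / n)" using mean(2)[OF f] n by (intro mult_left_mono) auto
      also have "\<dots> = 4 * c * 1" using n by simp
      also have "\<dots> \<le> 4 * c * l" using l1 c by (intro mult_left_mono) auto
      finally show ?thesis .
    qed
    show False using 1 2 3 4 dev by linarith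
  qed
  then have "measure PI {x\<in>space PI. \<exists>f\<in>G. 156 * sqrt (l * (n * (\<integral>x. (f x)\<^sup>2 \<partial>M) + K\<^sup>2 * l)) + 10 * c * l
      < \<bar>(\<Sum>i\<in>I. f (x i)) - n * (\<integral>x. f x \<partial>M)\<bar>} \<le> measure PI (S \<union> R)"
    using Sm Rm by (intro PI.finite_measure_mono) auto
  also have "\<dots> \<le> \<delta> / 2 + \<delta> / 2" using S R by (intro order.trans[OF measure_Un_le[OF Sm Rm]]) auto
  finally show ?thesis by (simp add: PI_def K_def)
qed

section \<open>Relative deviations\<close>


text \<open>Young's inequality with weights 1 - \<kappa>/2 and \<kappa>/2. The exponent 1/(2 -
  \<kappa>) is forced by requiring that Y to the power 1 - \<kappa>/2 be a square root. The weights
  are at most 1 and 1/(2 - \<kappa>) \<le> 1, so the constant \<open>c\<^sup>2\<close> does not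
  depend on \<kappa>.\<close>

lemma sqrt_mult_powr_le:
  fixes p e U B \<kappa> c :: real
  assumes p: "0 \<le> p" and e: "0 < e" and U: "0 < U" and B: "0 < B" and \<kappa>: "0 < \<kappa>" "\<kappa> \<le> 1" and c: "1 \<le> c"
  shows "c * sqrt (U * (B * p powr \<kappa>)) \<le> e * p + c\<^sup>2 * (B / e powr \<kappa> * U) powr (1 / (2 - \<kappa>))"
proof (cases "p = 0")
  case False
  then have p: "0 < p" using p by simp
  define Z where "Z = B / e powr \<kappa> * U"
  have Z: "0 < Z" using U B e by (simp add: Z_def)
  define Y where "Y = (c\<^sup>2 * Z) powr (1 / (2 - \<kappa>))"
  have Y: "0 < Y" using Z c by (simp add: Y_def)
  have "c * sqrt (U * (B * p powr \<kappa>)) = sqrt (c\<^sup>2 * (U * (B * p powr \<kappa>)))"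
    using c by (simp add: real_sqrt_mult)
  also have "c\<^sup>2 * (U * (B * p powr \<kappa>)) = (c\<^sup>2 * Z) * (e * p) powr \<kappa>"
    using e p by (simp add: Z_def powr_mult)
  also have "sqrt \<dots> = (c\<^sup>2 * Z) powr (1/2) * ((e * p) powr \<kappa>) powr (1/2)"
    using Z c e p by (simp add: powr_half_sqrt real_sqrt_mult)
  also have "(c\<^sup>2 * Z) powr (1/2) = Y powr (1 - \<kappa> / 2)"
  proof -
    have "1 / (2 - \<kappa>) * (1 - \<kappa> / 2) = 1 / 2" using \<kappa> by (simp add: field_simps)
    then show ?thesis by (simp only: Y_def powr_powr)
  qed
  also have "((e * p) powr \<kappa>) powr (1/2) = (e * p) powr (\<kappa> / 2)" by (simp add: powr_powr)
  also have "Y powr (1 - \<kappa> / 2) * (e * p) powr (\<kappa> / 2) \<le> (1 - \<kappa> / 2) * Y + (\<kappa> / 2) * (e * p)"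
    using \<kappa> Y e p by (intro Youngs_inequality_0) auto
  also have "\<dots> \<le> 1 * Y + 1 * (e * p)"
    using \<kappa> Y e p by (intro add_mono mult_right_mono) auto
  finally have "c * sqrt (U * (B * p powr \<kappa>)) \<le> e * p + Y" by simp
  also have "Y = (c\<^sup>2) powr (1 / (2 - \<kappa>)) * Z powr (1 / (2 - \<kappa>))"
    unfolding Y_def using Z c by (intro powr_mult)
  also have "\<dots> \<le> (c\<^sup>2) powr 1 * Z powr (1 / (2 - \<kappa>))"
    using \<kappa> c by (intro mult_right_mono powr_mono) auto
  finally show ?thesis using c by (simp add: Z_def)
qed (use c in simp)

text \<open>The two one-sided bounds use Young's inequality with different parameters. The lower one
  is the more expensive and explains the factor (1 + \<epsilon>)^2: with \<gamma> = 1/(2 - \<kappa>)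
  one has 1 + \<kappa> \<gamma> = 2 \<gamma>, so a prefactor 1 + \<epsilon> and a power (1 +
  \<epsilon>)^(\<kappa> \<gamma>) combine to (1 + \<epsilon>)^(2 \<gamma>).\<close>

lemma relative_deviation_le:
  fixes p pn \<epsilon> U B \<kappa> c d :: real
  assumes p: "0 \<le> p" and \<epsilon>: "0 < \<epsilon>" and U: "0 < U" and B: "0 < B" and \<kappa>: "0 < \<kappa>" "\<kappa> \<le> 1" and c: "1 \<le> c"
    and d: "0 \<le> d" and dev: "\<bar>pn - p\<bar> \<le> c * sqrt (U * (B * p powr \<kappa>)) + d"
  shows "max (pn - (1 + \<epsilon>) * p) (p - (1 + \<epsilon>) * pn)
    \<le> c\<^sup>2 * (((1 + \<epsilon>)\<^sup>2 * B / \<epsilon> powr \<kappa> * U) powr (1 / (2 - \<kappa>))) + (1 + \<epsilon>) * d"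
proof (rule max.boundedI)
  define \<gamma> where "\<gamma> = 1 / (2 - \<kappa>)"
  have \<gamma>: "0 < \<gamma>" "1 + \<kappa> * \<gamma> = 2 * \<gamma>" using \<kappa> by (auto simp: \<gamma>_def field_simps)
  define Z where "Z = B / \<epsilon> powr \<kappa> * U"
  have Z: "0 < Z" using U B \<epsilon> by (simp add: Z_def)
  have Zeq: "(1 + \<epsilon>)\<^sup>2 * B / \<epsilon> powr \<kappa> * U = (1 + \<epsilon>)\<^sup>2 * Z" by (simp add: Z_def)
  have "1 \<le> (1 + \<epsilon>)\<^sup>2" using \<epsilon> by simp
  then have "Z powr \<gamma> \<le> ((1 + \<epsilon>)\<^sup>2 * Z) powr \<gamma>" using Z \<gamma> by (intro powr_mono2) auto
  then have "c\<^sup>2 * Z powr \<gamma> \<le> c\<^sup>2 * ((1 + \<epsilon>)\<^sup>2 * Z) powr \<gamma>" by (intro mult_left_mono) auto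
  moreover have "d \<le> (1 + \<epsilon>) * d" using d \<epsilon> by (simp add: algebra_simps)
  ultimately show "pn - (1 + \<epsilon>) * p \<le> c\<^sup>2 * (((1 + \<epsilon>)\<^sup>2 * B / \<epsilon> powr \<kappa> * U) powr (1 / (2 - \<kappa>))) + (1 + \<epsilon>) * d"
    using dev sqrt_mult_powr_le[OF p \<epsilon> U B \<kappa> c]
    unfolding Zeq \<gamma>_def[symmetric] Z_def[symmetric] by (simp add: algebra_simps)
  \<comment> \<open>Since p - (1 + \<epsilon>) pn = (1 + \<epsilon>) (p - pn) - \<epsilon> p, the
    linear term of Young's inequality cancels when (1 + \<epsilon>) e = \<epsilon>.\<close>
  define e where "e = \<epsilon> / (1 + \<epsilon>)"
  have e: "0 < e" using \<epsilon> by (simp add: e_def)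
  have W: "(1 + \<epsilon>) * (B / e powr \<kappa> * U) powr \<gamma> = ((1 + \<epsilon>)\<^sup>2 * Z) powr \<gamma>"
  proof -
    have "B / e powr \<kappa> * U = (1 + \<epsilon>) powr \<kappa> * Z"
      using \<epsilon> by (simp add: e_def Z_def powr_divide)
    then have "(B / e powr \<kappa> * U) powr \<gamma> = (1 + \<epsilon>) powr (\<kappa> * \<gamma>) * Z powr \<gamma>"
      using \<epsilon> Z by (simp add: powr_mult powr_powr)
    then have "(1 + \<epsilon>) * (B / e powr \<kappa> * U) powr \<gamma> = (1 + \<epsilon>) powr 1 * (1 + \<epsilon>) powr (\<kappa> * \<gamma>) * Z powr \<gamma>"
      using \<epsilon> by simp
    also have "(1 + \<epsilon>) powr 1 * (1 + \<epsilon>) powr (\<kappa> * \<gamma>) = (1 + \<epsilon>) powr (2 * \<gamma>)"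
      unfolding \<gamma>(2)[symmetric] by (simp only: powr_add)
    also have "\<dots> = ((1 + \<epsilon>)\<^sup>2) powr \<gamma>"
      using \<epsilon> by (simp add: powr_powr flip: powr_numeral)
    finally show ?thesis using Z by (simp add: powr_mult)
  qed
  have "(1 + \<epsilon>) * (p - pn) \<le> (1 + \<epsilon>) * (e * p + c\<^sup>2 * (B / e powr \<kappa> * U) powr \<gamma> + d)"
    using dev sqrt_mult_powr_le[OF p e U B \<kappa> c] \<epsilon> unfolding \<gamma>_def by (intro mult_left_mono) auto
  also have "\<dots> = ((1 + \<epsilon>) * e) * p + c\<^sup>2 * ((1 + \<epsilon>) * (B / e powr \<kappa> * U) powr \<gamma>) + (1 + \<epsilon>) * d"
    by (simp only: distrib_left mult.assoc mult.left_commute[of "1 + \<epsilon>" "c\<^sup>2"])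
  also have "(1 + \<epsilon>) * e = \<epsilon>" using \<epsilon> by (simp add: e_def)
  finally have "(1 + \<epsilon>) * (p - pn) \<le> \<epsilon> * p + c\<^sup>2 * ((1 + \<epsilon>)\<^sup>2 * Z) powr \<gamma> + (1 + \<epsilon>) * d"
    unfolding W .
  moreover have "(1 + \<epsilon>) * (p - pn) = \<epsilon> * p + (p - (1 + \<epsilon>) * pn)" by (simp add: algebra_simps)
  ultimately show "p - (1 + \<epsilon>) * pn \<le> c\<^sup>2 * (((1 + \<epsilon>)\<^sup>2 * B / \<epsilon> powr \<kappa> * U) powr (1 / (2 - \<kappa>))) + (1 + \<epsilon>) * d"
    unfolding Zeq \<gamma>_def[symmetric] by linarith
qed

section \<open>From covering numbers to nets in a countable subclass\<close>

lemma sum_square_le_of_emp_dist: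
  assumes "emp_dist n x f g \<le> e" "0 < n" "0 \<le> e"
  shows "(\<Sum>i\<in>{1..n}. (f (x i) - g (x i))\<^sup>2) \<le> n * e\<^sup>2"
proof -
  let ?S = "\<Sum>i\<in>{1..n}. (f (x i) - g (x i))\<^sup>2"
  have "sqrt (?S / n) \<le> e" using assms(1) by (simp add: emp_dist_def emp_norm_def emp_mean_def)
  then have "(sqrt (?S / n))\<^sup>2 \<le> e\<^sup>2" by (intro power_mono) (auto intro!: divide_nonneg_nonneg sum_nonneg)
  also have "(sqrt (?S / n))\<^sup>2 = ?S / n" by (simp add: sum_nonneg)
  finally show ?thesis using assms(2) by (simp add: field_simps)
qed

text \<open>A real upper bound rules out the value of the empty infimum, and a nonempty infimum of
  extended naturals is attained.\<close>

lemma covering_number_le_imp: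
  assumes "ereal_of_enat (covering_number d e F) \<le> ereal r"
  obtains C where "finite C" "real (card C) \<le> r" "\<And>f. f \<in> F \<Longrightarrow> \<exists>c\<in>C. d f c \<le> e"
proof -
  let ?S = "{enat (card C) | C. finite C \<and> (\<forall>f\<in>F. \<exists>c\<in>C. d f c \<le> e)}"
  have "?S \<noteq> {}"
  proof
    assume empty: "?S = {}"
    have "covering_number d e F = \<infinity>" unfolding covering_number_def empty by (simp add: top_enat_def)
    then show False using assms by simp
  qed
  then have "Inf ?S \<in> ?S" by (meson Inf_enat_def LeastI_ex wellorder_InfI ex_in_conv)
  then obtain C where C: "Inf ?S = enat (card C)" "finite C" "\<forall>f\<in>F. \<exists>c\<in>C. d f c \<le> e" by auto
  then have "real (card C) \<le> r" using assms by (simp add: covering_number_def)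
  with C that show thesis by blast
qed

text \<open>At the scale 1/n a ball has squared radius n * (1/n)^2 = 1/n as a sum of squares. Moving
  the centres into \<open>G\<close> at most doubles distances, whence 4/n. The bound
  \<open>m + 1\<close> is strict so that a cardinality below it is at most \<open>m\<close>.\<close>

lemma has_net_of_covering_number:
  assumes n: "0 < n" and G: "G \<subseteq> F" "G \<noteq> {}" and \<zeta>: "0 \<le> \<zeta>" and A: "0 \<le> A"
    and D: "0 \<le> D" "D \<le> T" and m: "1 \<le> m" "A * (real n * T) powr \<zeta> < real m + 1"
    and cover: "\<And>e. 0 < e \<Longrightarrow> ereal e \<le> set_diameter (emp_dist n x) F \<Longrightarrow>
      ereal_of_enat (covering_number (emp_dist n x) e F) \<le> ereal (A * (D / e) powr \<zeta>)"
  shows "has_net {1..n} G m (4 / real n) x"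
proof -
  define e where "e = 1 / real n"
  have e: "0 < e" using n by (simp add: e_def)
  have near: "(\<Sum>i\<in>{1..n}. (f (x i) - g (x i))\<^sup>2) \<le> 1 / real n" if "emp_dist n x f g \<le> e" for f g
    using sum_square_le_of_emp_dist[OF that n] e n by (simp add: e_def power2_eq_square)
  show ?thesis
  proof (cases "ereal e \<le> set_diameter (emp_dist n x) F")
    case True
    obtain C where C: "finite C" "real (card C) \<le> A * (D / e) powr \<zeta>" "\<And>f. f \<in> F \<Longrightarrow> \<exists>c\<in>C. emp_dist n x f c \<le> e"
      using covering_number_le_imp[OF cover[OF e True]] by blast
    have "A * (D / e) powr \<zeta> \<le> A * (real n * T) powr \<zeta>"
      using D \<zeta> n A by (intro mult_left_mono powr_mono2) (auto simp: e_def mult.commute intro: mult_left_mono)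
    then have cm: "card C \<le> m" using C(2) m(2) by linarith
    \<comment> \<open>The given centres may lie outside \<open>G\<close>, and even outside
      \<open>F\<close>. Only those near some member of \<open>G\<close> are kept, and each of them
      is replaced by such a member.\<close>
    define C' where "C' = {c\<in>C. \<exists>g\<in>G. emp_dist n x g c \<le> e}"
    define \<phi> where "\<phi> c = (SOME g. g \<in> G \<and> emp_dist n x g c \<le> e)" for c
    have \<phi>: "\<phi> c \<in> G \<and> emp_dist n x (\<phi> c) c \<le> e" if "c \<in> C'" for c
      unfolding \<phi>_def by (rule someI_ex[of "\<lambda>g. g \<in> G \<and> emp_dist n x g c \<le> e"]) (use that in \<open>auto simp: C'_def\<close>)
    have fin: "finite (\<phi> ` C')" "\<phi> ` C' \<subseteq> G" using C(1) \<phi> by (auto simp: C'_def)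
    have "card (\<phi> ` C') \<le> card C'" using C(1) by (intro card_image_le) (simp add: C'_def)
    also have "\<dots> \<le> card C" using C(1) by (intro card_mono) (auto simp: C'_def)
    finally have card: "card (\<phi> ` C') \<le> m" using cm by simp
    have "\<exists>c\<in>\<phi> ` C'. (\<Sum>i\<in>{1..n}. (f (x i) - c (x i))\<^sup>2) \<le> 4 / real n" if f: "f \<in> G" for f
    proof -
      obtain c where c: "c \<in> C" "emp_dist n x f c \<le> e" using C(3)[of f] f G by auto
      then have c': "c \<in> C'" using f by (auto simp: C'_def)
      have "(\<Sum>i\<in>{1..n}. (f (x i) - \<phi> c (x i))\<^sup>2) \<le> 4 * (1 / real n)"
        using near[OF c(2)] near[of "\<phi> c" c] \<phi>[OF c'] by (intro sum_square_diff_triangle[where g="\<lambda>i. c (x i)"]) auto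
      then show ?thesis using c' by auto
    qed
    then show ?thesis unfolding has_net_def using fin card by blast
  next
    \<comment> \<open>Above the diameter the covering hypothesis is silent, but there any single
      member of the class is a net.\<close>
    case False
    obtain g where g: "g \<in> G" using G by auto
    have "(\<Sum>i\<in>{1..n}. (f (x i) - g (x i))\<^sup>2) \<le> 4 / real n" if f: "f \<in> G" for f
    proof -
      have "ereal (emp_dist n x f g) \<le> set_diameter (emp_dist n x) F"
        unfolding set_diameter_def using f g G by (intro SUP_upper2[of f] SUP_upper2[of g]) auto
      also have "\<dots> < ereal e" using False by simp
      finally have "(\<Sum>i\<in>{1..n}. (f (x i) - g (x i))\<^sup>2) \<le> 1 / real n" by (intro near) simp
      also have "\<dots> \<le> 4 / real n" using n by (intro divide_right_mono) auto
      finally show ?thesis .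
    qed
    then show ?thesis unfolding has_net_def using g m by (intro bexI[of _ "{g}"]) auto
  qed
qed

text \<open>Dominated convergence, with the envelope integrable because u \<le> c exp (u / c). As
  \<open>real_of_ereal\<close> sends infinity to 0, the domination can fail where the envelope is
  infinite; this is a null set, by finiteness of the exponential integral.\<close>

lemma (in prob_space) tendsto_integral_of_exponential_envelope:
  fixes g :: "nat \<Rightarrow> 'a \<Rightarrow> real" and E :: "'a \<Rightarrow> ereal"
  assumes E[measurable]: "E \<in> borel_measurable M" and c: "0 < c"
    and Eexp: "(\<integral>\<^sup>+x. exp_ext (E x / ereal c) \<partial>M) \<le> 2"
    and g[measurable]: "\<And>k. g k \<in> borel_measurable M" and f[measurable]: "f \<in> borel_measurable M"
    and gE: "\<And>k x. x \<in> space M \<Longrightarrow> ereal \<bar>g k x\<bar> \<le> E x"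
    and lim: "\<And>x. x \<in> space M \<Longrightarrow> (\<lambda>k. g k x) \<longlonglongrightarrow> f x"
  shows "(\<lambda>k. \<integral>x. g k x \<partial>M) \<longlonglongrightarrow> (\<integral>x. f x \<partial>M)"
proof (rule integral_dominated_convergence[where w="\<lambda>x. real_of_ereal (E x)"])
  have E0: "0 \<le> E x" if "x \<in> space M" for x using order.trans[OF _ gE[OF that, of 0], of 0] by simp
  have "(\<integral>\<^sup>+x. ennreal (real_of_ereal (E x)) \<partial>M) \<le> (\<integral>\<^sup>+x. ennreal c * exp_ext (E x / ereal c) \<partial>M)"
  proof (intro nn_integral_mono)
    fix x assume x: "x \<in> space M"
    show "ennreal (real_of_ereal (E x)) \<le> ennreal c * exp_ext (E x / ereal c)"
    proof (cases "E x")
      case (real u)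
      have "u / c \<le> exp (u / c)" using exp_ge_add_one_self[of "u / c"] by linarith
      then have "u \<le> c * exp (u / c)" using c by (simp add: field_simps)
      then have "ennreal u \<le> ennreal (c * exp (u / c))" by (rule ennreal_leI)
      then show ?thesis using real c by (simp add: ennreal_mult)
    qed simp_all
  qed
  also have "\<dots> = ennreal c * (\<integral>\<^sup>+x. exp_ext (E x / ereal c) \<partial>M)" by (rule nn_integral_cmult) measurable
  also have "\<dots> \<le> ennreal c * 2" using Eexp by (intro mult_left_mono) auto
  also have "\<dots> < \<infinity>" by (simp add: ennreal_mult_less_top)
  finally show "integrable M (\<lambda>x. real_of_ereal (E x))"
    using E0 by (intro integrableI_nonneg) (auto intro!: AE_I2 real_of_ereal_pos)
  have "(\<integral>\<^sup>+x. exp_ext (E x / ereal c) \<partial>M) \<noteq> \<infinity>" using Eexp by (auto simp: top_unique)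
  then have "AE x in M. exp_ext (E x / ereal c) \<noteq> \<infinity>" by (intro nn_integral_PInf_AE) auto
  from this AE_space show "AE x in M. norm (g k x) \<le> real_of_ereal (E x)" for k
  proof eventually_elim
    case (elim x)
    then have "E x \<noteq> \<infinity>" using c by auto
    then show ?case using gE[OF elim(2), of k] E0[OF elim(2)] by (cases "E x") auto
  qed
qed (use lim in auto)


text \<open>Strictness provides an admissible parameter below \<open>c\<close>, so attainment of the
  infimum does not enter.\<close>

lemma psi1_norm_lessD:
  assumes lt: "psi1_norm M \<eta> < ereal c"
  shows "(\<integral>\<^sup>+\<omega>. exp_ext (\<bar>\<eta> \<omega>\<bar> / ereal c) \<partial>M) \<le> 2"
proof -
  obtain t where t: "0 < t" "t < c" "(\<integral>\<^sup>+\<omega>. exp_ext (\<bar>\<eta> \<omega>\<bar> / ereal t) \<partial>M) \<le> 2"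
    using lt unfolding psi1_norm_def Inf_less_iff by auto
  have "(\<integral>\<^sup>+\<omega>. exp_ext (\<bar>\<eta> \<omega>\<bar> / ereal c) \<partial>M) \<le> (\<integral>\<^sup>+\<omega>. exp_ext (\<bar>\<eta> \<omega>\<bar> / ereal t) \<partial>M)"
  proof (intro nn_integral_mono exp_ext_mono)
    fix \<omega> show "\<bar>\<eta> \<omega>\<bar> / ereal c \<le> \<bar>\<eta> \<omega>\<bar> / ereal t"
    proof (cases "\<bar>\<eta> \<omega>\<bar>")
      case (real u)
      have "0 \<le> \<bar>\<eta> \<omega>\<bar>" by simp
      then have "0 \<le> u" using real by simp
      then show ?thesis using real t by (simp add: frac_le)
    next
      case MInf
      then show ?thesis using abs_ereal_ge0[of "\<eta> \<omega>"] abs_ereal_pos[of "\<eta> \<omega>"] by simp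
    qed (use t in simp)
  qed
  with t show ?thesis by simp
qed

text \<open>This turns the envelope of the whole class into a countable supremum, which is
  measurable.\<close>

lemma SUP_eq_of_pointwise_limits:
  fixes F G :: "('b \<Rightarrow> real) set"
  assumes "G \<subseteq> F" and lim: "\<And>f. f \<in> F \<Longrightarrow> \<exists>g. range g \<subseteq> G \<and> (\<lambda>k::nat. g k x) \<longlonglongrightarrow> f x"
  shows "(SUP f\<in>F. ereal \<bar>f x\<bar>) = (SUP f\<in>G. ereal \<bar>f x\<bar>)"
proof (rule antisym)
  show "(SUP f\<in>F. ereal \<bar>f x\<bar>) \<le> (SUP f\<in>G. ereal \<bar>f x\<bar>)"
  proof (rule SUP_least)
    fix f assume "f \<in> F"
    then obtain g where g: "range g \<subseteq> G" "(\<lambda>k::nat. g k x) \<longlonglongrightarrow> f x" using lim by blast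
    have "(\<lambda>k. ereal \<bar>g k x\<bar>) \<longlonglongrightarrow> ereal \<bar>f x\<bar>"
      by (intro tendsto_intros g)
    moreover have "ereal \<bar>g k x\<bar> \<le> (SUP f\<in>G. ereal \<bar>f x\<bar>)" for k
      using g(1) by (intro SUP_upper) auto
    ultimately show "ereal \<bar>f x\<bar> \<le> (SUP f\<in>G. ereal \<bar>f x\<bar>)"
      by (intro LIMSEQ_le_const2[of "\<lambda>k. ereal \<bar>g k x\<bar>"]) auto
  qed
qed (use assms(1) in \<open>auto intro!: SUP_subset_mono\<close>)

text \<open>Markov's inequality for the cube at level (2 r + 1)^3 \<ge> 8 r^3 produces the
  probability 1/8. The summand 1 keeps the level positive when r = 0.\<close>

lemma (in prob_space) prob_ln_less:
  fixes D :: "'a \<Rightarrow> real"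
  defines "r \<equiv> root 3 (\<integral>\<omega>. (ln (D \<omega>)) ^ 3 \<partial>M)"
  assumes [measurable]: "D \<in> borel_measurable M" and D1: "AE \<omega> in M. 1 \<le> D \<omega>"
    and int: "integrable M (\<lambda>\<omega>. (ln (D \<omega>)) ^ 3)"
  shows "0 \<le> r" and "7/8 \<le> prob {\<omega>\<in>space M. ln (D \<omega>) < 2 * r + 1}"
proof -
  have nn: "AE \<omega> in M. 0 \<le> (ln (D \<omega>)) ^ 3" using D1 by eventually_elim simp
  have I0: "0 \<le> (\<integral>\<omega>. (ln (D \<omega>)) ^ 3 \<partial>M)" using nn by (rule integral_nonneg_AE)
  then show r: "0 \<le> r" by (simp add: r_def)
  have r3: "r ^ 3 = (\<integral>\<omega>. (ln (D \<omega>)) ^ 3 \<partial>M)" unfolding r_def using I0 by (intro real_root_pow_pos2) auto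
  have "prob {\<omega>\<in>space M. (2 * r + 1) ^ 3 \<le> (ln (D \<omega>)) ^ 3} \<le> (\<integral>\<omega>. (ln (D \<omega>)) ^ 3 \<partial>M) / (2 * r + 1) ^ 3"
    using r by (intro integral_Markov_inequality_measure[where A="{}"] int nn) auto
  also have "\<dots> \<le> 1/8"
  proof -
    have "(2 * r) ^ 3 \<le> (2 * r + 1) ^ 3" using r by (intro power_mono) auto
    then show ?thesis using r unfolding r3[symmetric] by (simp add: pos_divide_le_eq power_mult_distrib)
  qed
  finally have "7/8 \<le> prob (space M - {\<omega>\<in>space M. (2 * r + 1) ^ 3 \<le> (ln (D \<omega>)) ^ 3})"
    by (subst prob_compl) auto
  also have "\<dots> \<le> prob {\<omega>\<in>space M. ln (D \<omega>) < 2 * r + 1}"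
  proof (rule finite_measure_mono_AE)
    show "AE \<omega> in M. \<omega> \<in> space M - {\<omega>\<in>space M. (2 * r + 1) ^ 3 \<le> (ln (D \<omega>)) ^ 3} \<longrightarrow>
        \<omega> \<in> {\<omega>\<in>space M. ln (D \<omega>) < 2 * r + 1}"
      using r by (intro AE_I2) (auto simp: not_le dest: power_less_imp_less_base intro: ccontr power_mono)
  qed measurable
  finally show "7/8 \<le> prob {\<omega>\<in>space M. ln (D \<omega>) < 2 * r + 1}" .
qed

section \<open>From the product measure back to the given sample\<close>

lemma iid_sampleD:
  assumes M: "prob_space M" and iid: "iid_sample M N n X" and n: "1 \<le> n"
  shows "\<And>i. i \<in> {0..n} \<Longrightarrow> X i \<in> measurable M N"
    and "distr M (Pi\<^sub>M {1..n} (\<lambda>_. N)) (\<lambda>\<omega>. \<lambda>i\<in>{1..n}. X i \<omega>) = Pi\<^sub>M {1..n} (\<lambda>_. distr M N (X 0))"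
proof -
  interpret prob_space M by fact
  have ind: "indep_vars (\<lambda>_. N) X {0..n}" and eq: "\<And>i. i \<in> {1..n} \<Longrightarrow> distr M N (X i) = distr M N (X 0)"
    using iid by (auto simp: iid_sample_def)
  show X: "\<And>i. i \<in> {0..n} \<Longrightarrow> X i \<in> measurable M N" using ind by (simp add: indep_vars_def)
  have "indep_vars (\<lambda>_. N) X {1..n}" using ind by (rule indep_vars_subset) auto
  then have "distr M (Pi\<^sub>M {1..n} (\<lambda>_. N)) (\<lambda>\<omega>. \<lambda>i\<in>{1..n}. X i \<omega>) = Pi\<^sub>M {1..n} (\<lambda>i. distr M N (X i))"
    using n X by (subst (asm) indep_vars_iff_distr_eq_PiM') auto
  also have "\<dots> = Pi\<^sub>M {1..n} (\<lambda>_. distr M N (X 0))" by (intro PiM_cong eq refl)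
  finally show "distr M (Pi\<^sub>M {1..n} (\<lambda>_. N)) (\<lambda>\<omega>. \<lambda>i\<in>{1..n}. X i \<omega>) = Pi\<^sub>M {1..n} (\<lambda>_. distr M N (X 0))" .
qed

text \<open>Division by n separates the two regimes under the root. The constants are 312 = 2 * 156,
  by sqrt 3 \<le> 2, and 981 = 3 * (312 + 15), where 15 arises from absorbing 10 c into 15 c ln n by
  ln n \<ge> 2/3.\<close>

lemma sample_deviation_scale:
  fixes l n q K c s p :: real
  assumes n: "2 \<le> n" and l: "0 \<le> l" "l \<le> 3 * (n * U)" and q: "0 \<le> q" "q \<le> Q" and c: "0 \<le> c"
    and dev: "\<bar>s - n * p\<bar> \<le> 156 * sqrt (l * (n * q + (2 * c * ln n)\<^sup>2 * l)) + 10 * c * l"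
  shows "\<bar>s / n - p\<bar> \<le> 312 * sqrt (U * Q) + 981 * c * (U * ln n)"
proof -
  define v where "v = l / n"
  have lv: "l = n * v" using n by (simp add: v_def)
  have v: "0 \<le> v" "v \<le> 3 * U" using l n by (auto simp: v_def field_simps)
  have ln: "2 / 3 \<le> ln n"
    using order.trans[OF ln2_ge_two_thirds, of "ln n"] n by simp
  define K where "K = 2 * c * ln n"
  have K: "0 \<le> K" using c ln by (simp add: K_def)
  have "sqrt (l * (n * q + K\<^sup>2 * l)) = n * sqrt (v * q + (K * v)\<^sup>2)"
  proof -
    have "l * (n * q + K\<^sup>2 * l) = n\<^sup>2 * (v * q + (K * v)\<^sup>2)"
      by (simp add: lv power2_eq_square algebra_simps)
    then show ?thesis using n by (simp add: real_sqrt_mult)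
  qed
  also have "\<dots> \<le> n * (sqrt (v * q) + K * v)"
  proof (rule mult_left_mono)
    have "sqrt (v * q + (K * v)\<^sup>2) \<le> sqrt (v * q) + sqrt ((K * v)\<^sup>2)"
      using v q by (intro sqrt_add_le_add_sqrt) auto
    then show "sqrt (v * q + (K * v)\<^sup>2) \<le> sqrt (v * q) + K * v" using K v by simp
  qed (use n in simp)
  finally have root: "sqrt (l * (n * q + K\<^sup>2 * l)) \<le> n * (sqrt (v * q) + K * v)" .
  have "\<bar>s - n * p\<bar> \<le> 156 * (n * (sqrt (v * q) + K * v)) + 10 * c * l"
    using dev root unfolding K_def by linarith
  also have "\<dots> = n * (156 * (sqrt (v * q) + K * v) + 10 * c * v)"
    by (simp add: lv algebra_simps)
  finally have "\<bar>s - n * p\<bar> \<le> n * (156 * (sqrt (v * q) + K * v) + 10 * c * v)" .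
  moreover have "\<bar>s - n * p\<bar> = n * \<bar>s / n - p\<bar>"
  proof -
    have "s - n * p = n * (s / n - p)" using n by (simp add: algebra_simps)
    then show ?thesis using n by (simp add: abs_mult)
  qed
  ultimately have "\<bar>s / n - p\<bar> \<le> 156 * (sqrt (v * q) + K * v) + 10 * c * v"
    using n mult_le_cancel_left_pos[of n "\<bar>s / n - p\<bar>" "156 * (sqrt (v * q) + K * v) + 10 * c * v"] by linarith
  moreover have "sqrt (v * q) \<le> 2 * sqrt (U * Q)"
  proof -
    have "v * q \<le> (4 * U) * Q" using v q by (intro mult_mono) auto
    then have "sqrt (v * q) \<le> sqrt (4 * (U * Q))" by (intro real_sqrt_le_mono) simp
    then show ?thesis by (simp add: real_sqrt_mult)
  qed
  moreover have "156 * (K * v) + 10 * c * v \<le> 981 * c * (U * ln n)"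
  proof -
    have "10 * c * v \<le> 15 * ln n * (c * v)"
      using mult_right_mono[of 10 "15 * ln n" "c * v"] ln c v by simp
    then have "156 * (K * v) + 10 * c * v \<le> 327 * (c * ln n) * v" by (simp add: K_def)
    also have "\<dots> \<le> 327 * (c * ln n) * (3 * U)" using v c ln by (intro mult_left_mono) auto
    finally show ?thesis by (simp add: ac_simps)
  qed
  ultimately show ?thesis by (simp add: distrib_left)
qed

theorem uniform_relative_deviation:
  fixes M :: "'a measure" and N :: "'b measure" and X :: "nat \<Rightarrow> 'a \<Rightarrow> 'b" and F :: "('b \<Rightarrow> real) set"
    and n :: nat and Dn :: "'a \<Rightarrow> real" and A \<zeta> \<kappa> B \<delta> \<epsilon> :: real
  defines "U \<equiv> Upsilon M A \<zeta> Dn n \<delta>"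
  assumes n: "2 \<le> n" and M: "prob_space M" and iid: "iid_sample M N n X" and F: "pointwise_measurable_class N F"
    and A: "1 \<le> A" and \<zeta>: "0 \<le> \<zeta>" and Dn[measurable]: "Dn \<in> borel_measurable M" and Dn1: "AE \<omega> in M. 1 \<le> Dn \<omega>"
    and Dn3: "integrable M (\<lambda>\<omega>. (ln (Dn \<omega>)) ^ 3)"
    and cover: "AE \<omega> in M. \<forall>e::real. 0 < e \<and> ereal e \<le> set_diameter (emp_dist n (\<lambda>i. X i \<omega>)) F \<longrightarrow>
      ereal_of_enat (covering_number (emp_dist n (\<lambda>i. X i \<omega>)) e F) \<le> ereal (A * (Dn \<omega> / e) powr \<zeta>)"
    and \<kappa>: "0 < \<kappa>" "\<kappa> \<le> 1" and B: "1 \<le> B"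
    and bernstein: "\<And>f. f \<in> F \<Longrightarrow> 0 \<le> (\<integral>\<omega>. f (X 0 \<omega>) \<partial>M) \<and>
      (\<integral>\<omega>. (f (X 0 \<omega>))\<^sup>2 \<partial>M) \<le> B * (\<integral>\<omega>. f (X 0 \<omega>) \<partial>M) powr \<kappa>"
    and \<delta>: "0 < \<delta>" "\<delta> < 1" and \<epsilon>: "0 < \<epsilon>"
  shows "1 - \<delta> \<le> measure M {\<omega> \<in> space M. \<forall>f\<in>F.
    ereal (max (emp_mean n (\<lambda>i. X i \<omega>) f - (1 + \<epsilon>) * (\<integral>\<omega>'. f (X 0 \<omega>') \<partial>M))
      ((\<integral>\<omega>'. f (X 0 \<omega>') \<partial>M) - (1 + \<epsilon>) * emp_mean n (\<lambda>i. X i \<omega>) f))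
    \<le> ereal 97344 * (ereal (((1 + \<epsilon>)\<^sup>2 * B / \<epsilon> powr \<kappa> * U) powr (1 / (2 - \<kappa>)))
      + ereal (1 + \<epsilon>) * max (psi1_envelope M (X 0) F) 1 * ereal (U * ln (real n)))}"
    (is "_ \<le> measure M {\<omega> \<in> space M. \<forall>f\<in>F. ereal (?dev \<omega> f) \<le> ?bound}")
proof -
  interpret prob_space M by fact
  have n0: "0 < n" "1 \<le> n" using n by auto
  note X = iid_sampleD[OF M iid n0(2)]
  have Xm[measurable]: "X i \<in> measurable M N" if "i \<in> {0..n}" for i using X(1) that .
  define r where "r = root 3 (\<integral>\<omega>. (ln (Dn \<omega>)) ^ 3 \<partial>M)"
  note r = prob_ln_less[OF Dn Dn1 Dn3, folded r_def]
  have ln\<delta>: "ln (exp 1 / \<delta>) = 1 - ln \<delta>" "ln \<delta> < 0" using \<delta> by (auto simp: ln_div)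
  have nU: "real n * U = ln A + \<zeta> * ln (real n) + \<zeta> * r + (1 - ln \<delta>)"
    using n0 by (simp add: U_def Upsilon_def r_def ln\<delta>)
  have lnn: "2 / 3 \<le> ln (real n)"
    using order.trans[OF ln2_ge_two_thirds, of "ln (real n)"] n by simp
  have lnA: "0 \<le> ln A" using A by simp
  have "0 < real n * U" unfolding nU using lnA lnn r(1) \<zeta> ln\<delta> by (intro add_nonneg_pos add_nonneg_nonneg) auto
  then have U: "0 < U" using n0 by (simp add: zero_less_mult_iff)
  obtain G where G: "G \<subseteq> F" "countable G" "F \<subseteq> borel_measurable N"
    and lim: "\<And>f. f \<in> F \<Longrightarrow> \<exists>g :: nat \<Rightarrow> 'b \<Rightarrow> real. range g \<subseteq> G \<and> (\<forall>x\<in>space N. (\<lambda>k. g k x) \<longlonglongrightarrow> f x)"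
    using F unfolding pointwise_measurable_class_def by blast
  have Gm: "f \<in> borel_measurable N" if "f \<in> G" for f using that G by auto
  show ?thesis
  proof (cases "F = {} \<or> psi1_envelope M (X 0) F = \<infinity>")
    case True
    have "{\<omega> \<in> space M. \<forall>f\<in>F. ereal (?dev \<omega> f) \<le> ?bound} = space M"
    proof (cases "F = {}")
      case False
      then have psi: "psi1_envelope M (X 0) F = \<infinity>" using True by simp
      have "0 < U * ln (real n)" using U lnn by simp
      \<comment> \<open>Positivity of \<open>U * ln n\<close> matters, since infinity times 0 is 0
        for extended reals.\<close>
      then have bound: "?bound = \<infinity>" unfolding psi using \<epsilon> U lnn by (auto simp: max_def)
      show ?thesis unfolding bound by simp
    qed simp
    then show ?thesis using \<delta> by (simp add: prob_space)
  next
    case False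
    then have G0: "G \<noteq> {}" using lim by blast
    have psi0: "0 \<le> psi1_envelope M (X 0) F"
      unfolding psi1_envelope_def psi1_norm_def by (intro Inf_greatest) auto
    obtain \<Psi> where \<Psi>: "psi1_envelope M (X 0) F = ereal \<Psi>" "0 \<le> \<Psi>"
      using False psi0 by (cases "psi1_envelope M (X 0) F") auto
    \<comment> \<open>The factor 2 puts \<open>c\<close> strictly above \<Psi>, as
      \<open>psi1_norm_lessD\<close> demands; the maximum keeps \<open>c\<close> at least 1.\<close>
    define c where "c = 2 * max \<Psi> 1"
    have c: "1 \<le> c" "0 < c" "\<Psi> < c" using \<Psi> by (auto simp: c_def max_def)
    define E where "E x = (SUP f\<in>G. ereal \<bar>f x\<bar>)" for x
    have Em[measurable]: "E \<in> borel_measurable N"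
      unfolding E_def using G Gm by (intro borel_measurable_SUP) auto
    have E: "ereal \<bar>f x\<bar> \<le> E x" if "f \<in> G" for f x unfolding E_def by (intro SUP_upper that)
    have E0: "0 \<le> E x" for x
      using G0 order.trans[OF _ E, of 0] by fastforce
    define \<mu> where "\<mu> = distr M N (X 0)"
    have X0[measurable]: "X 0 \<in> measurable M N" by (rule X) simp
    interpret \<mu>: prob_space \<mu> unfolding \<mu>_def by (rule prob_space_distr) measurable
    have sets\<mu>[measurable_cong]: "sets \<mu> = sets N" by (simp add: \<mu>_def)
    have space\<mu>: "space \<mu> = space N" by (simp add: \<mu>_def)
    have Eexp: "(\<integral>\<^sup>+x. exp_ext (E x / ereal c) \<partial>\<mu>) \<le> 2"
    proof -
      have "(\<integral>\<^sup>+x. exp_ext (E x / ereal c) \<partial>\<mu>) = (\<integral>\<^sup>+\<omega>. exp_ext (E (X 0 \<omega>) / ereal c) \<partial>M)"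
        unfolding \<mu>_def by (subst nn_integral_distr) auto
      also have "\<dots> = (\<integral>\<^sup>+\<omega>. exp_ext (\<bar>SUP f\<in>F. ereal \<bar>f (X 0 \<omega>)\<bar>\<bar> / ereal c) \<partial>M)"
      proof (intro nn_integral_cong)
        fix \<omega> assume "\<omega> \<in> space M"
        then have x: "X 0 \<omega> \<in> space N" using measurable_space[OF X0] by auto
        have "(SUP f\<in>F. ereal \<bar>f (X 0 \<omega>)\<bar>) = E (X 0 \<omega>)"
          unfolding E_def by (rule SUP_eq_of_pointwise_limits[OF G(1)]) (use lim x in blast)
        then show "exp_ext (E (X 0 \<omega>) / ereal c) = exp_ext (\<bar>SUP f\<in>F. ereal \<bar>f (X 0 \<omega>)\<bar>\<bar> / ereal c)"
          using E0[of "X 0 \<omega>"] by simp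
      qed
      also have "\<dots> \<le> 2"
        by (rule psi1_norm_lessD) (use \<Psi> c in \<open>simp add: psi1_envelope_def\<close>)
      finally show ?thesis .
    qed
    define T where "T = exp (2 * r + 1)"
    \<comment> \<open>The covering bound at scale 1/n with D_n replaced by its quantile bound
      \<open>T\<close>, rounded down to an integer.\<close>
    define m where "m = nat \<lfloor>A * (real n * T) powr \<zeta>\<rfloor>"
    have T1: "1 \<le> T" using r by (simp add: T_def)
    have "1 * 1 \<le> A * (real n * T) powr \<zeta>"
    proof (intro mult_mono A ge_one_powr_ge_zero \<zeta>)
      show "1 \<le> real n * T" using mult_mono[of 1 "real n" 1 T] n T1 by simp
    qed (use A in auto)
    then have m: "1 \<le> m" "real m \<le> A * (real n * T) powr \<zeta>" "A * (real n * T) powr \<zeta> < real m + 1"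
      unfolding m_def by linarith+
    define l where "l = ln (real m) + ln (exp 1 / \<delta>)"
    \<comment> \<open>The logarithm of \<open>m\<close> contains \<zeta> (2 r + 1). The isolated
      \<zeta> is absorbed by 2 \<zeta> ln n, because ln n \<ge> 2/3; this accounts for the factor
      3.\<close>
    have l: "0 \<le> l" "l \<le> 3 * (real n * U)"
    proof -
      have "0 \<le> ln (real m)" using m by simp
      then show "0 \<le> l" using ln\<delta> by (simp add: l_def)
      have "ln (real m) \<le> ln (A * (real n * T) powr \<zeta>)" using m by simp
      also have "\<dots> = ln A + \<zeta> * (ln (real n) + (2 * r + 1))"
        using A n0 by (simp add: ln_mult ln_powr T_def)
      finally have "ln (real m) \<le> ln A + \<zeta> * ln (real n) + 2 * (\<zeta> * r) + \<zeta>" by (simp add: algebra_simps)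
      moreover have "\<zeta> \<le> 2 * (\<zeta> * ln (real n))" using mult_left_mono[of 1 "2 * ln (real n)" \<zeta>] lnn \<zeta> by simp
      moreover have "0 \<le> \<zeta> * r" using \<zeta> r by simp
      ultimately show "l \<le> 3 * (real n * U)" unfolding nU l_def ln\<delta>(1) using lnA ln\<delta>(2) by argo
    qed
    let ?PI = "Pi\<^sub>M {1..n} (\<lambda>_. \<mu>)"
    let ?Y = "\<lambda>\<omega>. \<lambda>i\<in>{1..n}. X i \<omega>"
    have Y: "?Y \<in> measurable M (Pi\<^sub>M {1..n} (\<lambda>_. N))"
      by (intro measurable_restrict Xm) auto
    have YPI: "?Y \<in> measurable M ?PI"
      using Y by (subst measurable_cong_sets[OF refl sets_PiM_cong[OF refl sets\<mu>]])
    have law: "measure ?PI {x\<in>space ?PI. P x} = prob {\<omega>\<in>space M. P (?Y \<omega>)}"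
      if P: "Measurable.pred ?PI P" for P
    proof -
      have sets: "sets ?PI = sets (Pi\<^sub>M {1..n} (\<lambda>_. N))" by (intro sets_PiM_cong) (auto simp: sets\<mu>)
      have "measure ?PI {x\<in>space ?PI. P x} = measure (distr M (Pi\<^sub>M {1..n} (\<lambda>_. N)) ?Y) {x\<in>space ?PI. P x}"
        unfolding X(2) \<mu>_def ..
      also have "\<dots> = prob (?Y -` {x\<in>space ?PI. P x} \<inter> space M)"
        using P sets by (intro measure_distr Y) (auto simp: pred_def)
      also have "?Y -` {x\<in>space ?PI. P x} \<inter> space M = {\<omega>\<in>space M. P (?Y \<omega>)}"
        using measurable_space[OF Y] sets_eq_imp_space_eq[OF sets] by auto
      finally show ?thesis .
    qed
    have G\<mu>: "G \<subseteq> borel_measurable \<mu>" using Gm by (auto simp: measurable_cong_sets[OF sets\<mu> refl])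
    have good: "7/8 \<le> measure ?PI {x\<in>space ?PI. has_net {1..n} G m (4 / real n) x}"
    proof -
      have netm: "Measurable.pred ?PI (has_net {1..n} G m (4 / real n))"
        by (rule pred_has_net[OF G(2) G\<mu>])
      have "prob {\<omega>\<in>space M. ln (Dn \<omega>) < 2 * r + 1} \<le> prob {\<omega>\<in>space M. has_net {1..n} G m (4 / real n) (?Y \<omega>)}"
      proof (rule finite_measure_mono_AE)
        show "AE \<omega> in M. \<omega> \<in> {\<omega>\<in>space M. ln (Dn \<omega>) < 2 * r + 1} \<longrightarrow>
            \<omega> \<in> {\<omega>\<in>space M. has_net {1..n} G m (4 / real n) (?Y \<omega>)}"
          using cover Dn1
        proof eventually_elim
          case (elim \<omega>)
          have "has_net {1..n} G m (4 / real n) (\<lambda>i. X i \<omega>)" if "ln (Dn \<omega>) < 2 * r + 1"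
          proof (rule has_net_of_covering_number[OF n0(1) G(1) G0 \<zeta> _ _ _ m(1,3)])
            have "exp (ln (Dn \<omega>)) < T" using that by (simp add: T_def)
            then show "Dn \<omega> \<le> T" using elim(2) by simp
          qed (use elim A in auto)
          then show ?case by (simp add: has_net_def)
        qed
        show "{\<omega>\<in>space M. has_net {1..n} G m (4 / real n) (?Y \<omega>)} \<in> events"
          using measurable_compose[OF YPI netm] by (simp only: pred_def)
      qed
      then show ?thesis using r(2) unfolding law[OF netm] by linarith
    qed
    define bad where "bad x \<longleftrightarrow> (\<exists>f\<in>G. 156 * sqrt (l * (real n * (\<integral>x. (f x)\<^sup>2 \<partial>\<mu>) + (2 * c * ln (real n))\<^sup>2 * l)) + 10 * c * l
        < \<bar>(\<Sum>i\<in>{1..n}. f (x i)) - real n * (\<integral>x. f x \<partial>\<mu>)\<bar>)" for x :: "nat \<Rightarrow> 'b"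
    have badm: "Measurable.pred ?PI bad"
    proof -
      have [measurable]: "(\<lambda>x. f (x i)) \<in> borel_measurable ?PI" if "f \<in> G" "i \<in> {1..n}" for f i
        using that G\<mu> by (intro measurable_compose[OF measurable_component_singleton]) auto
      show ?thesis unfolding bad_def by (intro pred_countable_Bex G(2)) measurable
    qed
    have "measure ?PI {x\<in>space ?PI. bad x} \<le> \<delta>"
      unfolding bad_def
      using \<mu>.uniform_deviation_exponential_envelope[of "{1..n}" G E c m \<delta> l] n G(2) G\<mu> E c(1) Eexp m(1) \<delta> good
      by (simp add: l_def)
    then have pbad: "prob {\<omega>\<in>space M. bad (?Y \<omega>)} \<le> \<delta>" unfolding law[OF badm] .
    have int\<mu>: "(\<integral>x. f x \<partial>\<mu>) = (\<integral>\<omega>. f (X 0 \<omega>) \<partial>M)" if "f \<in> borel_measurable N" for f :: "'b \<Rightarrow> real"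
      unfolding \<mu>_def using that by (intro integral_distr X0)
    define R where "R = 97344 * (((1 + \<epsilon>)\<^sup>2 * B / \<epsilon> powr \<kappa> * U) powr (1 / (2 - \<kappa>))
      + (1 + \<epsilon>) * max \<Psi> 1 * (U * ln (real n)))"
    have bound: "?bound = ereal R" unfolding \<Psi>(1) R_def by (simp add: max_def one_ereal_def)
    have ok: "?dev \<omega> f \<le> R" if \<omega>: "\<omega> \<in> space M" "\<not> bad (?Y \<omega>)" and f: "f \<in> G" for \<omega> f
    proof -
      define p where "p = (\<integral>\<omega>. f (X 0 \<omega>) \<partial>M)"
      define q where "q = (\<integral>\<omega>. (f (X 0 \<omega>))\<^sup>2 \<partial>M)"
      have pq: "0 \<le> p" "q \<le> B * p powr \<kappa>" using bernstein[of f] f G by (auto simp: p_def q_def)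
      have q0: "0 \<le> q" unfolding q_def by (intro integral_nonneg_AE) auto
      have fm[measurable]: "f \<in> borel_measurable N" using Gm f .
      have "\<bar>(\<Sum>i\<in>{1..n}. f (X i \<omega>)) - real n * p\<bar> \<le> 156 * sqrt (l * (real n * q + (2 * c * ln (real n))\<^sup>2 * l)) + 10 * c * l"
        using \<omega>(2) f int\<mu>[OF fm] int\<mu>[of "\<lambda>x. (f x)\<^sup>2"] by (auto simp: bad_def not_less p_def q_def)
      then have "\<bar>(\<Sum>i\<in>{1..n}. f (X i \<omega>)) / real n - p\<bar> \<le> 312 * sqrt (U * (B * p powr \<kappa>)) + 981 * c * (U * ln (real n))"
        using n c l q0 pq by (intro sample_deviation_scale[where l=l and q=q]) auto
      then have "max ((\<Sum>i\<in>{1..n}. f (X i \<omega>)) / real n - (1 + \<epsilon>) * p) (p - (1 + \<epsilon>) * ((\<Sum>i\<in>{1..n}. f (X i \<omega>)) / real n))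
          \<le> 312\<^sup>2 * (((1 + \<epsilon>)\<^sup>2 * B / \<epsilon> powr \<kappa> * U) powr (1 / (2 - \<kappa>))) + (1 + \<epsilon>) * (981 * c * (U * ln (real n)))"
        using pq \<epsilon> U B \<kappa> c lnn by (intro relative_deviation_le) auto
      \<comment> \<open>The absolute constant is 97344 = 312^2, coming from the Young term. It also
        covers the linear term, whose constant is 2 * 981 = 1962 after inserting the value of
        \<open>c\<close>.\<close>
      also have "\<dots> \<le> R"
      proof -
        define W where "W = (1 + \<epsilon>) * max \<Psi> 1 * (U * ln (real n))"
        have "(1 + \<epsilon>) * (981 * c * (U * ln (real n))) = 1962 * W" by (simp add: c_def W_def)
        moreover have "0 \<le> W" unfolding W_def using \<epsilon> U lnn by (intro mult_nonneg_nonneg) auto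
        ultimately show ?thesis unfolding R_def W_def[symmetric] by (simp add: distrib_left)
      qed
      finally show ?thesis by (simp add: emp_mean_def p_def)
    qed
    \<comment> \<open>The bound passes to pointwise limits for each fixed outcome: the empirical
      mean involves finitely many points, and the population mean converges by dominated convergence
      under the envelope.\<close>
    have extend: "?dev \<omega> f \<le> R" if \<omega>: "\<omega> \<in> space M" and all: "\<And>g. g \<in> G \<Longrightarrow> ?dev \<omega> g \<le> R" and f: "f \<in> F" for \<omega> f
    proof -
      obtain g :: "nat \<Rightarrow> 'b \<Rightarrow> real" where g: "\<And>k. g k \<in> G" "\<And>x. x \<in> space N \<Longrightarrow> (\<lambda>k. g k x) \<longlonglongrightarrow> f x"
        using lim[OF f] by blast
      have fm: "f \<in> borel_measurable N" using f G by auto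
      have "(\<lambda>k. \<integral>x. g k x \<partial>\<mu>) \<longlonglongrightarrow> (\<integral>x. f x \<partial>\<mu>)"
        by (rule \<mu>.tendsto_integral_of_exponential_envelope[where E=E and c=c])
           (use Em c Eexp g E Gm fm in \<open>auto simp: space\<mu> measurable_cong_sets[OF sets\<mu> refl]\<close>)
      then have P: "(\<lambda>k. \<integral>\<omega>. g k (X 0 \<omega>) \<partial>M) \<longlonglongrightarrow> (\<integral>\<omega>. f (X 0 \<omega>) \<partial>M)"
        using int\<mu>[OF fm] int\<mu>[OF Gm[OF g(1)]] by simp
      have "(\<lambda>k. emp_mean n (\<lambda>i. X i \<omega>) (g k)) \<longlonglongrightarrow> emp_mean n (\<lambda>i. X i \<omega>) f"
        unfolding emp_mean_def
        using measurable_space[OF Xm] \<omega> n0 by (intro tendsto_intros g) auto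
      with P have "(\<lambda>k. ?dev \<omega> (g k)) \<longlonglongrightarrow> ?dev \<omega> f" by (intro tendsto_intros)
      then show ?thesis by (rule LIMSEQ_le_const2) (use all g in auto)
    qed
    \<comment> \<open>The event over the whole class coincides with the one over \<open>G\<close>
      and is therefore measurable, so its \<open>measure\<close> is a genuine probability and not a
      default value.\<close>
    have "{\<omega>\<in>space M. \<forall>f\<in>F. ereal (?dev \<omega> f) \<le> ?bound} = {\<omega>\<in>space M. \<forall>f\<in>G. ?dev \<omega> f \<le> R}"
      unfolding bound ereal_less_eq(3) using G(1) extend by blast
    moreover have "{\<omega>\<in>space M. \<forall>f\<in>G. ?dev \<omega> f \<le> R} \<in> events"
    proof -
      have [measurable]: "(\<lambda>\<omega>. f (X i \<omega>)) \<in> borel_measurable M" if "f \<in> G" "i \<in> {1..n}" for f i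
        using that by (intro measurable_compose[OF Xm Gm]) auto
      have "Measurable.pred M (\<lambda>\<omega>. \<forall>f\<in>G. ?dev \<omega> f \<le> R)"
        unfolding emp_mean_def by (intro pred_countable_Ball G(2)) measurable
      then show ?thesis by (simp add: pred_def)
    qed
    moreover have "1 - \<delta> \<le> prob (space M - {\<omega>\<in>space M. bad (?Y \<omega>)})"
    proof -
      have "{\<omega>\<in>space M. bad (?Y \<omega>)} \<in> events"
        using measurable_compose[OF YPI badm] by (simp only: pred_def)
      then show ?thesis using pbad by (subst prob_compl) auto
    qed
    moreover have "space M - {\<omega>\<in>space M. bad (?Y \<omega>)} \<subseteq> {\<omega>\<in>space M. \<forall>f\<in>G. ?dev \<omega> f \<le> R}"
      using ok by blast
    ultimately show ?thesis
      using finite_measure_mono[of "space M - {\<omega>\<in>space M. bad (?Y \<omega>)}" "{\<omega>\<in>space M. \<forall>f\<in>G. ?dev \<omega> f \<le> R}"]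
      by simp
  qed
qed

theorem theoremD3:
  shows "\<exists>C::real. 0 < C \<and>
    (\<forall>(D::nat) (n::nat) (M::'a measure) (X :: nat \<Rightarrow> 'a \<Rightarrow> (nat \<Rightarrow> real))
       (F :: ((nat \<Rightarrow> real) \<Rightarrow> real) set) (Dn :: 'a \<Rightarrow> real)
       (A::real) (\<zeta>::real) (\<kappa>::real) (B::real).
      1 \<le> D \<longrightarrow> 2 \<le> n \<longrightarrow>
      prob_space M \<longrightarrow>
      iid_sample M (borel_space D) n X \<longrightarrow>
      pointwise_measurable_class (borel_space D) F \<longrightarrow>
      psi1_diameter M (X 0) F < \<infinity> \<longrightarrow>
      1 \<le> A \<longrightarrow> 0 \<le> \<zeta> \<longrightarrow>
      Dn \<in> borel_measurable M \<longrightarrow>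
      (AE \<omega> in M. 1 \<le> Dn \<omega>) \<longrightarrow>
      integrable M (\<lambda>\<omega>. (ln (Dn \<omega>)) ^ 3) \<longrightarrow>
      (AE \<omega> in M. \<forall>e::real.
         0 < e \<and> ereal e \<le> set_diameter (emp_dist n (\<lambda>i. X i \<omega>)) F \<longrightarrow>
         ereal_of_enat (covering_number (emp_dist n (\<lambda>i. X i \<omega>)) e F)
           \<le> ereal (A * (Dn \<omega> / e) powr \<zeta>)) \<longrightarrow>
      0 < \<kappa> \<longrightarrow> \<kappa> \<le> 1 \<longrightarrow> 1 \<le> B \<longrightarrow>
      (\<forall>f\<in>F. 0 \<le> (\<integral>\<omega>. f (X 0 \<omega>) \<partial>M) \<and>
         (\<integral>\<omega>. (f (X 0 \<omega>))\<^sup>2 \<partial>M) \<le> B * (\<integral>\<omega>. f (X 0 \<omega>) \<partial>M) powr \<kappa>) \<longrightarrow>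
      (\<forall>(\<delta>::real) (\<epsilon>::real). 0 < \<delta> \<longrightarrow> \<delta> < 1 \<longrightarrow> 0 < \<epsilon> \<longrightarrow>
         1 - \<delta> \<le> measure M {\<omega> \<in> space M. \<forall>f\<in>F.
           ereal (max
             (emp_mean n (\<lambda>i. X i \<omega>) f - (1 + \<epsilon>) * (\<integral>\<omega>'. f (X 0 \<omega>') \<partial>M))
             ((\<integral>\<omega>'. f (X 0 \<omega>') \<partial>M) - (1 + \<epsilon>) * emp_mean n (\<lambda>i. X i \<omega>) f))
           \<le> ereal C *
             (ereal (((1 + \<epsilon>)\<^sup>2 * B / \<epsilon> powr \<kappa> * Upsilon M A \<zeta> Dn n \<delta>) powr (1 / (2 - \<kappa>)))
              + ereal (1 + \<epsilon>) * max (psi1_envelope M (X 0) F) 1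
                * ereal (Upsilon M A \<zeta> Dn n \<delta> * ln (real n)))}))"
proof (intro exI[of _ 97344] conjI allI impI)
  fix D n :: nat and M :: "'a measure" and X :: "nat \<Rightarrow> 'a \<Rightarrow> (nat \<Rightarrow> real)"
    and F :: "((nat \<Rightarrow> real) \<Rightarrow> real) set" and Dn :: "'a \<Rightarrow> real" and A \<zeta> \<kappa> B \<delta> \<epsilon> :: real
  assume n: "2 \<le> n" and M: "prob_space M" and iid: "iid_sample M (borel_space D) n X"
    and F: "pointwise_measurable_class (borel_space D) F"
    and A: "1 \<le> A" and \<zeta>: "0 \<le> \<zeta>" and Dn: "Dn \<in> borel_measurable M" "AE \<omega> in M. 1 \<le> Dn \<omega>"
      "integrable M (\<lambda>\<omega>. (ln (Dn \<omega>)) ^ 3)"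
    and cover: "AE \<omega> in M. \<forall>e::real. 0 < e \<and> ereal e \<le> set_diameter (emp_dist n (\<lambda>i. X i \<omega>)) F \<longrightarrow>
      ereal_of_enat (covering_number (emp_dist n (\<lambda>i. X i \<omega>)) e F) \<le> ereal (A * (Dn \<omega> / e) powr \<zeta>)"
    and \<kappa>: "0 < \<kappa>" "\<kappa> \<le> 1" and B: "1 \<le> B"
    and bernstein: "\<forall>f\<in>F. 0 \<le> (\<integral>\<omega>. f (X 0 \<omega>) \<partial>M) \<and>
      (\<integral>\<omega>. (f (X 0 \<omega>))\<^sup>2 \<partial>M) \<le> B * (\<integral>\<omega>. f (X 0 \<omega>) \<partial>M) powr \<kappa>"
    and \<delta>: "0 < \<delta>" "\<delta> < 1" and \<epsilon>: "0 < \<epsilon>"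
  show "1 - \<delta> \<le> measure M {\<omega> \<in> space M. \<forall>f\<in>F.
    ereal (max (emp_mean n (\<lambda>i. X i \<omega>) f - (1 + \<epsilon>) * (\<integral>\<omega>'. f (X 0 \<omega>') \<partial>M))
      ((\<integral>\<omega>'. f (X 0 \<omega>') \<partial>M) - (1 + \<epsilon>) * emp_mean n (\<lambda>i. X i \<omega>) f))
    \<le> ereal 97344 * (ereal (((1 + \<epsilon>)\<^sup>2 * B / \<epsilon> powr \<kappa> * Upsilon M A \<zeta> Dn n \<delta>) powr (1 / (2 - \<kappa>)))
      + ereal (1 + \<epsilon>) * max (psi1_envelope M (X 0) F) 1 * ereal (Upsilon M A \<zeta> Dn n \<delta> * ln (real n)))}"
    by (rule uniform_relative_deviation[OF n M iid F A \<zeta> Dn cover \<kappa> B _ \<delta> \<epsilon>]) (use bernstein in blast)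
qed simp

end
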